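(* Let $R$ be a unital ring and $\Gamma$ a discrete amenable group. (1) For any $\mathbb Z\Gamma$-modules $\mathcal M_1\subseteq\mathcal M_2$, $h(\mathcal M_2)=h(\mathcal M_1)+h(\mathcal M_2/\mathcal M_1)$, where $h$ denotes algebraic entropy of $\mathbb Z\Gamma$-modules. (2) Let $\mathrm L$ be a length function on $R$-modules. Then for any locally $\mathrm L$-finite $R\Gamma$-modules $\mathcal N_1\subseteq\mathcal N_2$, $\mathrm{mL}(\mathcal N_2)=\mathrm{mL}(\mathcal N_1)+\mathrm{mL}(\mathcal N_2/\mathcal N_1)$. (3) Let $\dim(\cdot|\cdot)$ be a bivariant Sylvester $R$-module rank function. Then for any $R\Gamma$-modules $\mathcal M_1\subseteq\mathcal M_2\subseteq\mathcal M_3$, $$\mathrm{mdim}(\mathcal M_2|\mathcal M_3)=\mathrm{mdim}(\mathcal M_1|\mathcal M_3)+\mathrm{mdim}(\mathcal M_2/\mathcal M_1\,|\,\mathcal M_3/\mathcal M_1).$$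
   Context: All modules are left modules. $\mathcal F(S)$ is the set of nonempty finite subsets of a set $S$; $\mathcal F^0(G)$ is the set of finite subsets of an abelian group $G$ containing $0$; $\langle A\rangle_R$ is the $R$-submodule generated by $A$. **Limits.** For $K\in\mathcal F(\Gamma)$, $\delta>0$, $F\in\mathcal F(\Gamma)$ is $(K,\delta)$-invariant if $|\{s\in F:Ks\subseteq F\}|\ge(1-\delta)|F|$; $\Gamma$ is amenable if for all $K,\delta$ such an $F$ exists. $\lim_F\varphi(F)=c$ means: for every $\varepsilon>0$ there are $K\in\mathcal F(\Gamma)$, $\delta>0$ with $|\varphi(F)-c|<\varepsilon$ for all $(K,\delta)$-invariant $F\in\mathcal F(\Gamma)$. For a subset $A$ of an $R\Gamma$-module and $F\in\mathcal F(\Gamma)$, $A^{[F]}=\sum_{s\in F}s^{-1}A$ (sum of sets). All limits below exist by the Ornstein–Weiss lemma. **Algebraic entropy.** For a $\mathbb Z\Gamma$-module $\mathcal M$, $h(\mathcal M)=\sup_{A\in\mathcal F^0(\mathcal M)}\lim_F\frac{\log|A^{[F]}|}{|F|}\in[0,+\infty]$. **Length function.** A map $\mathrm L$ from $R$-modules to $[0,+\infty]$ with $\mathrm L(0)=0$; $\mathrm L(\mathcal M_2)=\mathrm L(\mathcal M_1)+\mathrm L(\mathcal M_3)$ for every short exact sequence $0\to\mathcal M_1\to\mathcal M_2\to\mathcal M_3\to0$; and $\mathrm L(\mathcal M)=\sup_{\mathcal N}\mathrm L(\mathcal N)$ over finitely generated submodules $\mathcal N\subseteq\mathcal M$. A module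 is locally $\mathrm L$-finite if $\mathrm L(\mathcal N)<\infty$ for every finitely generated $R$-submodule $\mathcal N$. For a locally $\mathrm L$-finite $R\Gamma$-module $\mathcal N$, the mean length is $\mathrm{mL}(\mathcal N)=\sup_{A\in\mathcal F^0(\mathcal N)}\lim_F\frac{\mathrm L(\langle A^{[F]}\rangle_R)}{|F|}$. **Bivariant Sylvester $R$-module rank function.** A map $\dim(\cdot|\cdot)$ on pairs of $R$-modules $\mathcal M_1\subseteq\mathcal M_2$ with values in $[0,+\infty]$ such that: (1) it is an isomorphism invariant; (2) with $\dim(\mathcal M):=\dim(\mathcal M|\mathcal M)$, $\dim(0)=0$ and $\dim(R)=1$; (3) $\dim(\mathcal M_1\oplus\mathcal M_1'|\mathcal M_2\oplus\mathcal M_2')=\dim(\mathcal M_1|\mathcal M_2)+\dim(\mathcal M_1'|\mathcal M_2')$; (4) $\dim(\mathcal M_1|\mathcal M_2)=\sup\dim(\mathcal M_1'|\mathcal M_2)$ over finitely generated submodules $\mathcal M_1'\subseteq\mathcal M_1$; (5) if $\mathcal M_1$ is finitely generated, $\dim(\mathcal M_1|\mathcal M_2)=\inf\dim(\mathcal M_1|\mathcal M_2')$ over finitely generated submodules $\mathcal M_2'$ of $\mathcal M_2$ containing $\mathcal M_1$; (6) $\dim(\mathcal M_2)=\dim(\mathcal M_1|\mathcal M_2)+\dim(\mathcal M_2/\mathcal M_1)$. For $R\Gamma$-modules $\mathcal M_1\subseteq\mathcal M_2$, $\mathrm{mdim}(\mathcal M_1|\mathcal M_2)=\sup_{A\in\mathcal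 F^0(\mathcal M_1)}\lim_F\frac{\dim(\langle A^{[F]}\rangle_R\,|\,\mathcal M_2)}{|F|}$. *)

theory Defs
  imports "HOL-Algebra.Module" "HOL-Algebra.AbelCoset" "HOL-Algebra.IntRing"
    Complex_Main "HOL-Library.Extended_Nonnegative_Real"
begin

hide_const (open) Multiset.mult \<comment> \<open>it shadows the record field\<close>

text \<open>
  The locale \<^locale>\<open>module\<close> of HOL-Algebra asks for a commutative ring of scalars. The records
  and the notion of a submodule are reused; the \<open>mult\<close> and \<open>one\<close> fields of a module record
  carry no meaning.
\<close>

locale left_module = R?: ring R + M?: abelian_group M for R (structure) and M (structure) +
  assumes smult_closed [simp, intro]:
      "\<lbrakk>a \<in> carrier R; x \<in> carrier M\<rbrakk> \<Longrightarrow> a \<odot>\<^bsub>M\<^esub> x \<in> carrier M"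
    and smult_l_distr:
      "\<lbrakk>a \<in> carrier R; b \<in> carrier R; x \<in> carrier M\<rbrakk> \<Longrightarrow>
       (a \<oplus> b) \<odot>\<^bsub>M\<^esub> x = a \<odot>\<^bsub>M\<^esub> x \<oplus>\<^bsub>M\<^esub> b \<odot>\<^bsub>M\<^esub> x"
    and smult_r_distr:
      "\<lbrakk>a \<in> carrier R; x \<in> carrier M; y \<in> carrier M\<rbrakk> \<Longrightarrow>
       a \<odot>\<^bsub>M\<^esub> (x \<oplus>\<^bsub>M\<^esub> y) = a \<odot>\<^bsub>M\<^esub> x \<oplus>\<^bsub>M\<^esub> a \<odot>\<^bsub>M\<^esub> y"
    and smult_assoc1:
      "\<lbrakk>a \<in> carrier R; b \<in> carrier R; x \<in> carrier M\<rbrakk> \<Longrightarrow>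
       (a \<otimes> b) \<odot>\<^bsub>M\<^esub> x = a \<odot>\<^bsub>M\<^esub> (b \<odot>\<^bsub>M\<^esub> x)"
    and smult_one [simp]:
      "x \<in> carrier M \<Longrightarrow> \<one> \<odot>\<^bsub>M\<^esub> x = x"

definition module_hom ::
    "('r, 'a) ring_scheme \<Rightarrow> ('r, 'm) module \<Rightarrow> ('r, 'n) module \<Rightarrow> ('m \<Rightarrow> 'n) set" where
  "module_hom R M N = {f \<in> hom (add_monoid M) (add_monoid N).
     \<forall>a \<in> carrier R. \<forall>x \<in> carrier M. f (a \<odot>\<^bsub>M\<^esub> x) = a \<odot>\<^bsub>N\<^esub> f x}"

definition module_iso ::
    "('r, 'a) ring_scheme \<Rightarrow> ('r, 'm) module \<Rightarrow> ('r, 'n) module \<Rightarrow> ('m \<Rightarrow> 'n) set" where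
  "module_iso R M N = {f \<in> module_hom R M N. bij_betw f (carrier M) (carrier N)}"

definition short_exact ::
    "('r, 'a) ring_scheme \<Rightarrow> ('r, 'm) module \<Rightarrow> ('m \<Rightarrow> 'n) \<Rightarrow> ('r, 'n) module \<Rightarrow>
     ('n \<Rightarrow> 'p) \<Rightarrow> ('r, 'p) module \<Rightarrow> bool" where
  "short_exact R M1 f M2 g M3 \<longleftrightarrow>
     left_module R M1 \<and> left_module R M2 \<and> left_module R M3 \<and>
     f \<in> module_hom R M1 M2 \<and> g \<in> module_hom R M2 M3 \<and>
     inj_on f (carrier M1) \<and> f ` carrier M1 = a_kernel M2 M3 g \<and> g ` carrier M2 = carrier M3"

abbreviation submod :: "('r, 'm) module \<Rightarrow> 'm set \<Rightarrow> ('r, 'm) module" where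
  "submod M H \<equiv> M\<lparr>carrier := H\<rparr>"

definition module_span :: "('r, 'a) ring_scheme \<Rightarrow> ('r, 'm) module \<Rightarrow> 'm set \<Rightarrow> 'm set" where
  "module_span R M A = (\<lambda>H. submodule H R M) hull A"

definition fg_submodule :: "'m set \<Rightarrow> ('r, 'a) ring_scheme \<Rightarrow> ('r, 'm) module \<Rightarrow> bool" where
  "fg_submodule H R M \<longleftrightarrow>
     submodule H R M \<and> (\<exists>A. finite A \<and> A \<subseteq> carrier M \<and> H = module_span R M A)"

text \<open>
  A length or rank function lives on modules whose carriers are subsets of one fixed type, so
  the quotient is built on the type of the given module: each coset is replaced by a chosen
  element of it. The choice depends on the coset only, whence for \<open>H \<subseteq> K \<subseteq> M\<close> the
  quotient of \<open>K\<close> by \<open>H\<close> is literally a submodule of the quotient of \<open>M\<close> by \<open>H\<close>.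
\<close>

definition coset_rep :: "('r, 'm) module \<Rightarrow> 'm set \<Rightarrow> 'm \<Rightarrow> 'm" where
  "coset_rep M H x = (SOME y. y \<in> H +>\<^bsub>M\<^esub> x)"

definition quotient_module :: "('r, 'm) module \<Rightarrow> 'm set \<Rightarrow> ('r, 'm) module" where
  "quotient_module M H =
     \<lparr>carrier = coset_rep M H ` carrier M, mult = undefined, one = undefined,
      zero = coset_rep M H \<zero>\<^bsub>M\<^esub>,
      add = (\<lambda>x y. coset_rep M H (x \<oplus>\<^bsub>M\<^esub> y)),
      smult = (\<lambda>a x. coset_rep M H (a \<odot>\<^bsub>M\<^esub> x))\<rparr>"

definition direct_sum_module ::
    "('r, 'm) module \<Rightarrow> ('r, 'n) module \<Rightarrow> ('r, 'm \<times> 'n) module" where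
  "direct_sum_module M N =
     \<lparr>carrier = carrier M \<times> carrier N, mult = undefined, one = undefined,
      zero = (\<zero>\<^bsub>M\<^esub>, \<zero>\<^bsub>N\<^esub>),
      add = (\<lambda>(x, y) (x', y'). (x \<oplus>\<^bsub>M\<^esub> x', y \<oplus>\<^bsub>N\<^esub> y')),
      smult = (\<lambda>a (x, y). (a \<odot>\<^bsub>M\<^esub> x, a \<odot>\<^bsub>N\<^esub> y))\<rparr>"

definition regular_module :: "('r, 'a) ring_scheme \<Rightarrow> ('r, 'r) module" where
  "regular_module R =
     \<lparr>carrier = carrier R, mult = undefined, one = undefined,
      zero = zero R, add = add R, smult = mult R\<rparr>"

definition group_ring ::
    "('r, 'a) ring_scheme \<Rightarrow> ('g, 'b) monoid_scheme \<Rightarrow> ('g \<Rightarrow> 'r) ring" where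
  "group_ring R G =
     \<lparr>carrier = {f \<in> carrier G \<rightarrow>\<^sub>E carrier R. finite {g \<in> carrier G. f g \<noteq> \<zero>\<^bsub>R\<^esub>}},
      mult = (\<lambda>f h. \<lambda>g\<in>carrier G.
        \<Oplus>\<^bsub>R\<^esub>x\<in>{x \<in> carrier G. f x \<noteq> \<zero>\<^bsub>R\<^esub>}. f x \<otimes>\<^bsub>R\<^esub> h (inv\<^bsub>G\<^esub> x \<otimes>\<^bsub>G\<^esub> g)),
      one = (\<lambda>g\<in>carrier G. if g = \<one>\<^bsub>G\<^esub> then \<one>\<^bsub>R\<^esub> else \<zero>\<^bsub>R\<^esub>),
      zero = (\<lambda>g\<in>carrier G. \<zero>\<^bsub>R\<^esub>),
      add = (\<lambda>f h. \<lambda>g\<in>carrier G. f g \<oplus>\<^bsub>R\<^esub> h g)\<rparr>"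

text \<open>The element \<open>r s\<close> of the group ring.\<close>

definition gr_monom ::
    "('r, 'a) ring_scheme \<Rightarrow> ('g, 'b) monoid_scheme \<Rightarrow> 'r \<Rightarrow> 'g \<Rightarrow> ('g \<Rightarrow> 'r)" where
  "gr_monom R G r s = (\<lambda>g\<in>carrier G. if g = s then r else \<zero>\<^bsub>R\<^esub>)"

definition restrict_scalars ::
    "('r, 'a) ring_scheme \<Rightarrow> ('g, 'b) monoid_scheme \<Rightarrow> ('g \<Rightarrow> 'r, 'm) module \<Rightarrow> ('r, 'm) module" where
  "restrict_scalars R G M =
     \<lparr>carrier = carrier M, mult = mult M, one = one M, zero = zero M, add = add M,
      smult = (\<lambda>r x. gr_monom R G r \<one>\<^bsub>G\<^esub> \<odot>\<^bsub>M\<^esub> x)\<rparr>"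

definition nonempty_finite_subsets :: "'a set \<Rightarrow> 'a set set" where
  "nonempty_finite_subsets S = {F. finite F \<and> F \<noteq> {} \<and> F \<subseteq> S}"

definition zero_finite_subsets :: "('r, 'm) module \<Rightarrow> 'm set \<Rightarrow> 'm set set" where
  "zero_finite_subsets M H = {A. finite A \<and> \<zero>\<^bsub>M\<^esub> \<in> A \<and> A \<subseteq> H}"

definition invariant_set :: "('g, 'b) monoid_scheme \<Rightarrow> 'g set \<Rightarrow> real \<Rightarrow> 'g set \<Rightarrow> bool" where
  "invariant_set G K \<delta> F \<longleftrightarrow>
     F \<in> nonempty_finite_subsets (carrier G) \<and>
     real (card {s \<in> F. K #>\<^bsub>G\<^esub> s \<subseteq> F}) \<ge> (1 - \<delta>) * real (card F)"

definition amenable :: "('g, 'b) monoid_scheme \<Rightarrow> bool" where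
  "amenable G \<longleftrightarrow>
     (\<forall>K \<in> nonempty_finite_subsets (carrier G). \<forall>\<delta>>0. \<exists>F. invariant_set G K \<delta> F)"

text \<open>
  Convergence along this filter is the convergence written \<open>lim\<^sub>F\<close>, see \<open>eventually_folner\<close>.
\<close>

definition folner :: "('g, 'b) monoid_scheme \<Rightarrow> 'g set filter" where
  "folner G = (INF K \<in> nonempty_finite_subsets (carrier G). INF \<delta> \<in> {0<..}.
     principal {F. invariant_set G K \<delta> F})"

lemma invariant_set_mono:
  assumes "invariant_set G K \<delta> F" "K' \<subseteq> K" "\<delta> \<le> \<delta>'"
  shows "invariant_set G K' \<delta>' F"
proof -
  have fin: "finite F" using assms(1) by (auto simp: invariant_set_def nonempty_finite_subsets_def)
  have "{s \<in> F. K #>\<^bsub>G\<^esub> s \<subseteq> F} \<subseteq> {s \<in> F. K' #>\<^bsub>G\<^esub> s \<subseteq> F}"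
    using assms(2) by (auto simp: r_coset_def)
  then have "card {s \<in> F. K #>\<^bsub>G\<^esub> s \<subseteq> F} \<le> card {s \<in> F. K' #>\<^bsub>G\<^esub> s \<subseteq> F}"
    using fin by (intro card_mono) auto
  moreover have "(1 - \<delta>') * real (card F) \<le> (1 - \<delta>) * real (card F)"
    using assms(3) by (intro mult_right_mono) auto
  ultimately show ?thesis using assms(1) unfolding invariant_set_def by linarith
qed

lemma eventually_folner:
  assumes "group G"
  shows "eventually P (folner G) \<longleftrightarrow>
    (\<exists>K \<in> nonempty_finite_subsets (carrier G). \<exists>\<delta>>0. \<forall>F. invariant_set G K \<delta> F \<longrightarrow> P F)"
proof -
  let ?I = "nonempty_finite_subsets (carrier G) \<times> {0::real<..}"
  interpret group G by fact
  have "({\<one>\<^bsub>G\<^esub>}, 1) \<in> ?I" by (auto simp: nonempty_finite_subsets_def)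
  then have ne: "?I \<noteq> {}" by blast
  have eq: "folner G = (INF p \<in> ?I. principal {F. invariant_set G (fst p) (snd p) F})"
    unfolding folner_def
    by (rule antisym) (force intro!: INF_greatest INF_lower2 intro: order_trans[OF INF_lower])+
  show ?thesis unfolding eq
  proof (subst eventually_INF_base[OF ne], goal_cases)
    case (1 a b)
    then have "(fst a \<union> fst b, min (snd a) (snd b)) \<in> ?I"
      by (auto simp: nonempty_finite_subsets_def)
    then show ?case
      by (rule bexI[rotated]) (auto elim: invariant_set_mono)
  qed (auto simp: eventually_principal)
qed

text \<open>The set \<open>A\<^sup>[\<^sup>F\<^sup>]\<close>, the sum over \<open>s \<in> F\<close> of the sets \<open>s\<inverse> A\<close>.\<close>

definition translate_sum ::
    "('r, 'a) ring_scheme \<Rightarrow> ('g, 'b) monoid_scheme \<Rightarrow> ('g \<Rightarrow> 'r, 'm) module \<Rightarrow>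
     'm set \<Rightarrow> 'g set \<Rightarrow> 'm set" where
  "translate_sum R G M A F =
     {\<Oplus>\<^bsub>M\<^esub>s\<in>F. gr_monom R G \<one>\<^bsub>R\<^esub> (inv\<^bsub>G\<^esub> s) \<odot>\<^bsub>M\<^esub> a s | a. a \<in> F \<rightarrow> A}"

definition algebraic_entropy ::
    "('g, 'b) monoid_scheme \<Rightarrow> ('g \<Rightarrow> int, 'm) module \<Rightarrow> ennreal" where
  "algebraic_entropy G M =
     (SUP A \<in> zero_finite_subsets M (carrier M).
        ennreal (Lim (folner G)
          (\<lambda>F. ln (real (card (translate_sum int_ring G M A F))) / real (card F))))"

text \<open>
  The type \<open>'u\<close> plays the role of the universe: a length function assigns a value to every
  left \<open>R\<close>-module whose carrier is a set of elements of \<open>'u\<close>. Invariance under isomorphism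
  follows from additivity, applied to sequences with a zero module as first term.
\<close>

locale length_function = ring R for R :: "('r, 'a) ring_scheme" (structure) +
  fixes L :: "('r, 'u) module \<Rightarrow> ennreal"
  assumes length_zero: "\<lbrakk>left_module R M; carrier M = {\<zero>\<^bsub>M\<^esub>}\<rbrakk> \<Longrightarrow> L M = 0"
    and length_additive: "short_exact R M1 f M2 g M3 \<Longrightarrow> L M2 = L M1 + L M3"
    and length_continuous:
      "left_module R M \<Longrightarrow> L M = (SUP H \<in> {H. fg_submodule H R M}. L (submod M H))"

definition locally_length_finite ::
    "('r, 'a) ring_scheme \<Rightarrow> (('r, 'u) module \<Rightarrow> ennreal) \<Rightarrow> ('r, 'u) module \<Rightarrow> bool" where
  "locally_length_finite R L M \<longleftrightarrow> (\<forall>H. fg_submodule H R M \<longrightarrow> L (submod M H) < \<infinity>)"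

definition mean_length ::
    "('r, 'a) ring_scheme \<Rightarrow> ('g, 'b) monoid_scheme \<Rightarrow> (('r, 'u) module \<Rightarrow> ennreal) \<Rightarrow>
     ('g \<Rightarrow> 'r, 'u) module \<Rightarrow> ennreal" where
  "mean_length R G L N =
     (SUP A \<in> zero_finite_subsets N (carrier N).
        Lim (folner G) (\<lambda>F.
          L (submod (restrict_scalars R G N)
               (module_span R (restrict_scalars R G N) (translate_sum R G N A F)))
          / of_nat (card F)))"

text \<open>
  \<open>rk H M\<close> stands for the value at the pair \<open>H \<subseteq> M\<close>. Again \<open>'u\<close> is the universe; since the
  axioms speak of \<open>R\<close> and of direct sums of modules, \<open>'u\<close> has to be infinite and to contain a
  copy of \<open>R\<close>. Direct sums and \<open>R\<close> itself enter through their isomorphic copies inside \<open>'u\<close>.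
\<close>

locale bivariant_sylvester_rank = ring R for R :: "('r, 'a) ring_scheme" (structure) +
  fixes rk :: "'u set \<Rightarrow> ('r, 'u) module \<Rightarrow> ennreal"
  assumes rk_iso:
      "\<lbrakk>left_module R M; left_module R M'; submodule H R M; \<phi> \<in> module_iso R M M'\<rbrakk> \<Longrightarrow>
       rk (\<phi> ` H) M' = rk H M"
    and rk_zero: "\<lbrakk>left_module R M; carrier M = {\<zero>\<^bsub>M\<^esub>}\<rbrakk> \<Longrightarrow> rk (carrier M) M = 0"
    and rk_ring:
      "\<lbrakk>left_module R M; \<psi> \<in> module_iso R (regular_module R) M\<rbrakk> \<Longrightarrow> rk (carrier M) M = 1"
    and rk_direct_sum:
      "\<lbrakk>left_module R M; left_module R M'; left_module R N; submodule H R M; submodule H' R M';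
        \<sigma> \<in> module_iso R (direct_sum_module M M') N\<rbrakk> \<Longrightarrow>
       rk (\<sigma> ` (H \<times> H')) N = rk H M + rk H' M'"
    and rk_sup:
      "\<lbrakk>left_module R M; submodule H R M\<rbrakk> \<Longrightarrow>
       rk H M = (SUP H' \<in> {H'. fg_submodule H' R M \<and> H' \<subseteq> H}. rk H' M)"
    and rk_inf:
      "\<lbrakk>left_module R M; fg_submodule H R M\<rbrakk> \<Longrightarrow>
       rk H M = (INF K \<in> {K. fg_submodule K R M \<and> H \<subseteq> K}. rk H (submod M K))"
    and rk_quotient:
      "\<lbrakk>left_module R M; submodule H R M\<rbrakk> \<Longrightarrow>
       rk (carrier M) M =
         rk H M + rk (carrier (quotient_module M H)) (quotient_module M H)"

definition mean_rank ::
    "('r, 'a) ring_scheme \<Rightarrow> ('g, 'b) monoid_scheme \<Rightarrow> ('u set \<Rightarrow> ('r, 'u) module \<Rightarrow> ennreal) \<Rightarrow>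
     'u set \<Rightarrow> ('g \<Rightarrow> 'r, 'u) module \<Rightarrow> ennreal" where
  "mean_rank R G rk H M =
     (SUP A \<in> zero_finite_subsets M H.
        Lim (folner G) (\<lambda>F.
          rk (module_span R (restrict_scalars R G M) (translate_sum R G M A F))
              (restrict_scalars R G M)
          / of_nat (card F)))"

end

theory Submission
  imports Defs
begin

text \<open>
  The three addition formulas are instances of one. Let \<open>\<phi>\<close> be a monotone, subadditive and
  translation invariant real function on the finite subsets of a module \<open>M\<close> that contain \<open>0\<close>,
  and let \<open>\<psi>\<close> be such a function on \<open>M/W\<close>: the logarithm of the cardinality, the length of the
  \<open>R\<close>-span, or the rank of the \<open>R\<close>-span relative to the ambient module. The supremum of the rates
  \<open>lim \<phi> (A\<^sup>[\<^sup>F\<^sup>]) / |F|\<close> over all \<open>A \<subseteq> M\<close> is the sum of the suprema for \<open>W\<close> and for \<open>M/W\<close> as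
  soon as the following two properties hold, where \<open>A'\<close> denotes the image of \<open>A\<close> in \<open>M/W\<close>:

  \<^item> \<open>\<phi> A + \<psi> B' \<le> \<phi> (A + B)\<close> if \<open>A \<subseteq> W\<close>;
  \<^item> for every \<open>A\<close> and \<open>\<epsilon> > 0\<close> there is a finite \<open>B \<subseteq> W\<close> such that
    \<open>\<phi> (A + D) \<le> \<psi> A' + \<epsilon> + \<phi> (B + D)\<close> for all \<open>D\<close>.

  The first property gives the inequality \<open>\<ge>\<close>. For \<open>\<le>\<close>, a very invariant set \<open>F\<close> is covered, up
  to a small proportion, by almost disjoint translates of finitely many tiles \<open>T\<close> for which
  \<open>\<psi> (A'\<^sup>[\<^sup>T\<^sup>])\<close> is nearly \<open>|T|\<close> times the rate of \<open>A'\<close> (\<open>quasi_tiling_exists\<close>). The second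
  property, applied to \<open>A\<^sup>[\<^sup>T\<^sup>]\<close>, replaces the translates by translates of finite subsets of \<open>W\<close>,
  one at a time, with \<open>D\<close> standing for all the others. What remains is bounded by
  \<open>\<phi> (B\<^sup>[\<^sup>F\<^sup>])\<close> for one finite \<open>B \<subseteq> W\<close>, and hence by the supremum for \<open>W\<close>
  (\<open>valuation_entropy_add\<close>). The same tilings prove that the rates exist (\<open>Ornstein_Weiss\<close>).

  For cardinalities the second property needs no \<open>\<epsilon>\<close>: with a section \<open>\<sigma>\<close> of \<open>A \<rightarrow> A'\<close>, the set
  \<open>A\<close> lies in \<open>\<sigma> A' + B\<close>, where \<open>B\<close> consists of the differences \<open>a - \<sigma> a'\<close>. For lengths and ranks
  it follows from submodularity and from a comparison of \<open>X + Y\<close> with \<open>Y\<close> for a large finitely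
  generated \<open>Y \<subseteq> W\<close> (\<open>mean_value_add\<close>). Lengths are submodular by additivity. The rank relative to
  a finitely generated module \<open>K\<close> is \<open>dim K - dim (K/X)\<close>, so its submodularity amounts to an
  inequality between ranks of quotients, which the diagonal map \<open>K \<rightarrow> K/U \<oplus> K/V\<close> provides
  (\<open>codim_submodular\<close>); general ambient modules are reached by approximation from finitely
  generated ones.
\<close>

section \<open>Quasi-tilings of amenable groups\<close>

context group
begin

lemma card_r_coset:
  assumes "T \<subseteq> carrier G" "c \<in> carrier G"
  shows "card (T #> c) = card T"
proof -
  have "T #> c = (\<lambda>t. t \<otimes> c) ` T" by (auto simp: r_coset_def)
  moreover have "inj_on (\<lambda>t. t \<otimes> c) T"
    using assms by (intro inj_onI) (auto simp: subset_iff)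
  ultimately show ?thesis by (simp add: card_image)
qed

lemma finite_r_coset: "finite T \<Longrightarrow> finite (T #> c)"
  by (auto simp: r_coset_def)

lemma invariant_setD:
  assumes "invariant_set G K \<delta> F"
  shows "finite F" "F \<noteq> {}" "F \<subseteq> carrier G"
    and "real (card {s \<in> F. \<not> K #> s \<subseteq> F}) \<le> \<delta> * real (card F)"
proof -
  show fin: "finite F" and "F \<noteq> {}" "F \<subseteq> carrier G"
    using assms by (auto simp: invariant_set_def nonempty_finite_subsets_def)
  have "card F = card {s \<in> F. K #> s \<subseteq> F} + card {s \<in> F. \<not> K #> s \<subseteq> F}"
    using fin by (subst card_Un_disjoint[symmetric]) (auto intro: arg_cong[where f = card])
  with assms show "real (card {s \<in> F. \<not> K #> s \<subseteq> F}) \<le> \<delta> * real (card F)"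
    by (simp add: invariant_set_def algebra_simps)
qed

lemma invariant_setI:
  assumes "finite F" "F \<noteq> {}" "F \<subseteq> carrier G"
    and "real (card {s \<in> F. \<not> K #> s \<subseteq> F}) \<le> \<delta> * real (card F)"
  shows "invariant_set G K \<delta> F"
proof -
  have "card F = card {s \<in> F. K #> s \<subseteq> F} + card {s \<in> F. \<not> K #> s \<subseteq> F}"
    using assms(1) by (subst card_Un_disjoint[symmetric]) (auto intro: arg_cong[where f = card])
  with assms show ?thesis
    by (simp add: invariant_set_def nonempty_finite_subsets_def algebra_simps)
qed

text \<open>
  A largest family of translates whose overlaps cost at most the proportion \<open>\<epsilon>\<close> meets every
  admissible translate in at least \<open>\<epsilon> |T|\<close> points, since otherwise that translate could be added.
  As a point lies in exactly \<open>|T|\<close> translates of \<open>T\<close>, summing over all centres shows that the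
  family covers a fixed proportion of the centres.
\<close>

lemma greedy_translates:
  assumes F: "finite F" "F \<subseteq> carrier G" and T: "finite T" "T \<noteq> {}" "T \<subseteq> carrier G"
    and eps: "0 \<le> \<epsilon>" "\<epsilon> \<le> 1"
  obtains C where "C \<subseteq> {c \<in> F. T #> c \<subseteq> F}"
    and "(1 - \<epsilon>) * (real (card C) * real (card T)) \<le> real (card (\<Union>c\<in>C. T #> c))"
    and "\<epsilon> * real (card {c \<in> F. T #> c \<subseteq> F}) \<le> real (card (\<Union>c\<in>C. T #> c))"
proof -
  define D where "D = {c \<in> F. T #> c \<subseteq> F}"
  define U where "U C = (\<Union>c\<in>C. T #> c)" for C
  define valid where "valid C \<longleftrightarrow> C \<subseteq> D \<and>
    (1 - \<epsilon>) * (real (card C) * real (card T)) \<le> real (card (U C))" for C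
  have finD: "finite D" using F by (simp add: D_def)
  have "valid {}" by (simp add: valid_def)
  moreover have "\<forall>C. valid C \<longrightarrow> card C \<le> card D"
    using finD by (auto simp: valid_def intro: card_mono)
  ultimately obtain C where C: "valid C" and max: "\<And>C'. valid C' \<Longrightarrow> card C' \<le> card C"
    using ex_has_greatest_nat[of valid "{}" card "Suc (card D)"] by (metis le_imp_less_Suc)
  have CD: "C \<subseteq> D" using C by (simp add: valid_def)
  have finU: "finite (U C)"
    using finite_subset[OF CD finD] T by (auto simp: U_def finite_r_coset)
  have UF: "U C \<subseteq> F" using CD by (auto simp: U_def D_def)
  have meet: "\<epsilon> * real (card T) \<le> real (card ((T #> c) \<inter> U C))" if c: "c \<in> D" for c
  proof (cases "c \<in> C")
    case True
    then have "(T #> c) \<inter> U C = T #> c" by (auto simp: U_def)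
    moreover have "card (T #> c) = card T"
      using c F T by (intro card_r_coset) (auto simp: D_def)
    ultimately show ?thesis using eps by (simp add: mult_left_le_one_le)
  next
    case False
    show ?thesis
    proof (rule ccontr)
      assume neg: "\<not> ?thesis"
      have cT: "card (T #> c) = card T"
        using c F T by (intro card_r_coset) (auto simp: D_def)
      have "U (insert c C) = U C \<union> (T #> c)" by (auto simp: U_def)
      then have "card (U (insert c C)) + card ((T #> c) \<inter> U C) = card (U C) + card T"
        using card_Un_Int[OF finU finite_r_coset[OF T(1)], of c] cT by (simp add: Int_commute)
      then have "real (card (U (insert c C))) + real (card ((T #> c) \<inter> U C))
          = real (card (U C)) + real (card T)" by linarith
      moreover have "card (insert c C) = Suc (card C)"
        using False finite_subset[OF CD finD] by simp
      ultimately have "valid (insert c C)"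
        using C c neg by (simp add: valid_def algebra_simps)
      then show False
        using max \<open>card (insert c C) = Suc (card C)\<close> by fastforce
    qed
  qed
  have "(\<Sum>c\<in>D. card ((T #> c) \<inter> U C)) \<le> (\<Sum>c\<in>D. card {t \<in> T. t \<otimes> c \<in> U C})"
  proof (rule sum_mono)
    fix c assume "c \<in> D"
    have "(T #> c) \<inter> U C = (\<lambda>t. t \<otimes> c) ` {t \<in> T. t \<otimes> c \<in> U C}" by (auto simp: r_coset_def)
    then show "card ((T #> c) \<inter> U C) \<le> card {t \<in> T. t \<otimes> c \<in> U C}"
      using T by (simp add: card_image_le)
  qed
  also have "\<dots> = (\<Sum>t\<in>T. card {c \<in> D. t \<otimes> c \<in> U C})"
    using sum_multicount_gen[OF finD T(1), of "\<lambda>c t. t \<otimes> c \<in> U C" "\<lambda>t. card {c \<in> D. t \<otimes> c \<in> U C}"]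
    by simp
  also have "\<dots> \<le> (\<Sum>t\<in>T. card (U C))"
  proof (rule sum_mono)
    fix t assume t: "t \<in> T"
    have "inj_on (\<lambda>c. t \<otimes> c) {c \<in> D. t \<otimes> c \<in> U C}"
      using t T F by (intro inj_onI) (auto simp: D_def subset_iff)
    then show "card {c \<in> D. t \<otimes> c \<in> U C} \<le> card (U C)"
      by (rule card_inj_on_le) (use finU in auto)
  qed
  finally have "(\<Sum>c\<in>D. card ((T #> c) \<inter> U C)) \<le> card T * card (U C)" by simp
  then have "(\<Sum>c\<in>D. real (card ((T #> c) \<inter> U C))) \<le> real (card T) * real (card (U C))"
    by (simp flip: of_nat_sum of_nat_mult)
  moreover have "(\<Sum>c\<in>D. \<epsilon> * real (card T)) \<le> (\<Sum>c\<in>D. real (card ((T #> c) \<inter> U C)))"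
    by (rule sum_mono) (rule meet)
  ultimately have "real (card T) * (\<epsilon> * real (card D)) \<le> real (card T) * real (card (U C))"
    by (simp add: mult_ac)
  moreover have "card T > 0" using T by (simp add: card_gt_0_iff)
  ultimately have "\<epsilon> * real (card D) \<le> real (card (U C))" by simp
  with that[of C] C show thesis by (simp add: valid_def D_def U_def)
qed

text \<open>
  Removing translates of an almost \<open>K\<close>-invariant set \<open>T\<close> spoils the \<open>K\<close>-invariance only near
  the boundary of those translates.
\<close>

lemma bad_points_of_remainder:
  assumes F: "invariant_set G K \<delta> F" and T: "invariant_set G K \<delta> T"
    and K: "finite K" "K \<subseteq> carrier G"
    and C: "C \<subseteq> F" "\<And>c. c \<in> C \<Longrightarrow> T #> c \<subseteq> F"
  defines "F' \<equiv> F - (\<Union>c\<in>C. T #> c)"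
  shows "real (card {s \<in> F'. \<not> K #> s \<subseteq> F'})
    \<le> \<delta> * real (card F) + real (card K) * \<delta> * (real (card C) * real (card T))"
proof -
  note Fs = invariant_setD[OF F] and Ts = invariant_setD[OF T]
  \<comment> \<open>\<open>N k\<close> consists of the points outside \<open>T\<close> that \<open>k\<close> moves into \<open>T\<close>; since \<open>T\<close> and \<open>k T\<close>
    are equally large, there are as many of them as points of \<open>T\<close> that \<open>k\<close> moves out of \<open>T\<close>\<close>
  define N where "N k = {x \<in> carrier G. k \<otimes> x \<in> T \<and> x \<notin> T}" for k
  have N: "finite (N k)" "real (card (N k)) \<le> \<delta> * real (card T)" if k: "k \<in> K" for k
  proof -
    have kc: "k \<in> carrier G" using k K by auto
    have im: "(\<lambda>x. k \<otimes> x) ` N k = T - (\<lambda>x. k \<otimes> x) ` T"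
    proof (intro equalityI subsetI)
      fix y assume y: "y \<in> T - (\<lambda>x. k \<otimes> x) ` T"
      then have yc: "y \<in> carrier G" using Ts by auto
      then have e: "y = k \<otimes> (inv k \<otimes> y)" using kc by (simp add: m_assoc[symmetric])
      then have "inv k \<otimes> y \<in> N k" using y kc yc by (auto simp: N_def)
      with e show "y \<in> (\<lambda>x. k \<otimes> x) ` N k" by blast
    next
      fix y assume "y \<in> (\<lambda>x. k \<otimes> x) ` N k"
      then obtain x where x: "x \<in> N k" "y = k \<otimes> x" by auto
      moreover have "y \<notin> (\<lambda>x. k \<otimes> x) ` T"
      proof
        assume "y \<in> (\<lambda>x. k \<otimes> x) ` T"
        then obtain x' where "x' \<in> T" "k \<otimes> x = k \<otimes> x'" using x by auto
        then show False using x kc Ts by (auto simp: N_def)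
      qed
      ultimately show "y \<in> T - (\<lambda>x. k \<otimes> x) ` T" by (auto simp: N_def)
    qed
    have inj: "inj_on (\<lambda>x. k \<otimes> x) (N k)" "inj_on (\<lambda>x. k \<otimes> x) T"
      by (rule inj_on_subset[OF inj_on_cmult[OF kc]]; use Ts(3) in \<open>auto simp: N_def\<close>)+
    show "finite (N k)" using finite_imageD[OF _ inj(1)] im Ts by simp
    have "card (N k) = card (T - (\<lambda>x. k \<otimes> x) ` T)" using card_image[OF inj(1)] im by simp
    also have "\<dots> = card ((\<lambda>x. k \<otimes> x) ` T - T)"
    proof -
      have "card T = card (T \<inter> (\<lambda>x. k \<otimes> x) ` T) + card (T - (\<lambda>x. k \<otimes> x) ` T)"
        using Ts by (simp add: card_Diff_subset_Int card_mono)
      moreover have "card ((\<lambda>x. k \<otimes> x) ` T)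
          = card (T \<inter> (\<lambda>x. k \<otimes> x) ` T) + card ((\<lambda>x. k \<otimes> x) ` T - T)"
        using Ts by (simp add: card_Diff_subset_Int card_mono Int_commute)
      ultimately show ?thesis using card_image[OF inj(2)] by simp
    qed
    also have "\<dots> \<le> card {s \<in> T. \<not> K #> s \<subseteq> T}"
    proof -
      have "(\<lambda>x. k \<otimes> x) ` T - T \<subseteq> (\<lambda>x. k \<otimes> x) ` {s \<in> T. \<not> K #> s \<subseteq> T}"
        using k by (auto simp: r_coset_def)
      then show ?thesis
        by (rule order_trans[OF card_mono card_image_le, rotated]) (use Ts in auto)
    qed
    finally show "real (card (N k)) \<le> \<delta> * real (card T)" using Ts(4) by linarith
  qed
  have finC: "finite C" using C(1) Fs(1) finite_subset by blast
  have sub: "{s \<in> F'. \<not> K #> s \<subseteq> F'}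
      \<subseteq> {s \<in> F. \<not> K #> s \<subseteq> F} \<union> (\<Union>(k, c)\<in>K \<times> C. N k #> c)"
  proof
    fix s assume s: "s \<in> {s \<in> F'. \<not> K #> s \<subseteq> F'}"
    show "s \<in> {s \<in> F. \<not> K #> s \<subseteq> F} \<union> (\<Union>(k, c)\<in>K \<times> C. N k #> c)"
    proof (cases "K #> s \<subseteq> F")
      case False
      then show ?thesis using s by (auto simp: F'_def)
    next
      case True
      then obtain k c where kc: "k \<in> K" "c \<in> C" "k \<otimes> s \<in> T #> c"
        using s by (auto simp: F'_def r_coset_def)
      then obtain t where t: "t \<in> T" "k \<otimes> s = t \<otimes> c" by (auto simp: r_coset_def)
      have car: "k \<in> carrier G" "c \<in> carrier G" "s \<in> carrier G" "t \<in> carrier G"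
        using kc t K C Fs Ts s by (auto simp: F'_def)
      have se: "s = (s \<otimes> inv c) \<otimes> c" using car by (simp add: m_assoc)
      have "k \<otimes> (s \<otimes> inv c) = t"
        using car t by (simp add: m_assoc[symmetric]) (simp add: m_assoc)
      moreover have "s \<otimes> inv c \<notin> T"
        using s kc se by (auto simp: F'_def r_coset_def)
      ultimately have "s \<otimes> inv c \<in> N k" using car t by (auto simp: N_def)
      then have "s \<in> N k #> c" using se by (auto simp: r_coset_def)
      then show ?thesis using kc by blast
    qed
  qed
  have "card {s \<in> F'. \<not> K #> s \<subseteq> F'}
      \<le> card ({s \<in> F. \<not> K #> s \<subseteq> F} \<union> (\<Union>(k, c)\<in>K \<times> C. N k #> c))"
    by (rule card_mono[OF _ sub]) (use Fs K finC N in \<open>auto simp: finite_r_coset\<close>)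
  also have "\<dots> \<le> card {s \<in> F. \<not> K #> s \<subseteq> F} + card (\<Union>(k, c)\<in>K \<times> C. N k #> c)"
    by (rule card_Un_le)
  also have "card (\<Union>(k, c)\<in>K \<times> C. N k #> c) \<le> (\<Sum>(k, c)\<in>K \<times> C. card (N k #> c))"
    using card_UN_le[of "K \<times> C" "\<lambda>(k, c). N k #> c"] K finC by (simp add: case_prod_unfold)
  finally have "real (card {s \<in> F'. \<not> K #> s \<subseteq> F'})
      \<le> real (card {s \<in> F. \<not> K #> s \<subseteq> F}) + real (\<Sum>(k, c)\<in>K \<times> C. card (N k #> c))"
    unfolding of_nat_add[symmetric] of_nat_le_iff by simp
  also have "real (\<Sum>(k, c)\<in>K \<times> C. card (N k #> c)) = (\<Sum>(k, c)\<in>K \<times> C. real (card (N k #> c)))"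
    by (simp add: case_prod_unfold)
  also have "\<dots> \<le> (\<Sum>(k, c)\<in>K \<times> C. \<delta> * real (card T))"
  proof (rule sum_mono, clarsimp)
    fix k c assume kc: "k \<in> K" "c \<in> C"
    then have "card (N k #> c) = card (N k)"
      using C Fs by (intro card_r_coset) (auto simp: N_def)
    then show "real (card (N k #> c)) \<le> \<delta> * real (card T)" using N kc by simp
  qed
  also have "\<dots> = real (card K) * \<delta> * (real (card C) * real (card T))"
    by (simp add: card_cartesian_product)
  finally show ?thesis using Fs(4) by linarith
qed

text \<open>
  The tiles \<open>T j\<close> have the centres \<open>C j\<close>. That translates overlap little is expressed by their
  total size, which is the only consequence of almost disjointness that the limit theorems use.
\<close>

definition quasi_tiling :: "real \<Rightarrow> (nat \<Rightarrow> 'a set) \<Rightarrow> nat \<Rightarrow> (nat \<Rightarrow> 'a set) \<Rightarrow> 'a set \<Rightarrow> bool" where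
  "quasi_tiling \<epsilon> T n C F \<longleftrightarrow>
     (\<forall>j<n. C j \<subseteq> F \<and> (\<forall>c\<in>C j. T j #> c \<subseteq> F)) \<and>
     (\<Sum>j<n. real (card (C j)) * real (card (T j)))
        \<le> (1 + \<epsilon>) * real (card (\<Union>j<n. \<Union>c\<in>C j. T j #> c))"

lemma quasi_tiling_Suc:
  assumes F: "finite F"
    and Cn: "Cn \<subseteq> F" "\<And>c. c \<in> Cn \<Longrightarrow> Tn #> c \<subseteq> F"
    and le: "real (card Cn) * real (card Tn) \<le> (1 + \<epsilon>) * real (card (\<Union>c\<in>Cn. Tn #> c))"
    and qt: "quasi_tiling \<epsilon> T n C (F - (\<Union>c\<in>Cn. Tn #> c))"
  shows "quasi_tiling \<epsilon> (T(n := Tn)) (Suc n) (C(n := Cn)) F"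
    and "F - (\<Union>j<Suc n. \<Union>c\<in>(C(n := Cn)) j. (T(n := Tn)) j #> c)
      = F - (\<Union>c\<in>Cn. Tn #> c) - (\<Union>j<n. \<Union>c\<in>C j. T j #> c)"
proof -
  let ?U = "\<Union>c\<in>Cn. Tn #> c"
  let ?V = "\<Union>j<n. \<Union>c\<in>C j. T j #> c"
  have cov: "(\<Union>j<Suc n. \<Union>c\<in>(C(n := Cn)) j. (T(n := Tn)) j #> c) = ?U \<union> ?V"
    by (simp add: lessThan_Suc)
  show "F - (\<Union>j<Suc n. \<Union>c\<in>(C(n := Cn)) j. (T(n := Tn)) j #> c) = F - ?U - ?V"
    unfolding cov by blast
  have U: "?U \<subseteq> F" using Cn by blast
  have V: "?V \<subseteq> F - ?U"
    using qt unfolding quasi_tiling_def by (intro UN_least) (simp add: UN_subset_iff)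
  have "finite ?U" using U F by (rule finite_subset)
  moreover have "finite ?V" by (rule finite_subset[OF V]) (use F in simp)
  moreover have "?U \<inter> ?V = {}" using V by blast
  ultimately have "card (?U \<union> ?V) = card ?U + card ?V" by (rule card_Un_disjoint)
  then have card: "(1 + \<epsilon>) * real (card (?U \<union> ?V))
      = (1 + \<epsilon>) * real (card ?U) + (1 + \<epsilon>) * real (card ?V)"
    by (simp add: algebra_simps)
  have "(\<Sum>j<n. real (card ((C(n := Cn)) j)) * real (card ((T(n := Tn)) j)))
      = (\<Sum>j<n. real (card (C j)) * real (card (T j)))"
    by (rule sum.cong) auto
  then have "(\<Sum>j<Suc n. real (card ((C(n := Cn)) j)) * real (card ((T(n := Tn)) j)))
      \<le> (1 + \<epsilon>) * real (card (?U \<union> ?V))"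
    using le qt unfolding card by (simp add: quasi_tiling_def)
  moreover have "(C(n := Cn)) j \<subseteq> F \<and> (\<forall>c\<in>(C(n := Cn)) j. (T(n := Tn)) j #> c \<subseteq> F)" if "j < Suc n" for j
  proof (cases "j = n")
    case False
    then have "C j \<subseteq> F - ?U \<and> (\<forall>c\<in>C j. T j #> c \<subseteq> F - ?U)"
      using that qt by (simp add: quasi_tiling_def)
    then show ?thesis using False by auto
  qed (use Cn in simp)
  ultimately show "quasi_tiling \<epsilon> (T(n := Tn)) (Suc n) (C(n := Cn)) F"
    unfolding quasi_tiling_def cov by blast
qed

lemma quasi_tilingD:
  assumes qt: "quasi_tiling \<epsilon> T n C F" and F: "finite F" and eps: "0 \<le> \<epsilon>"
  shows "(\<Union>j<n. \<Union>c\<in>C j. T j #> c) \<subseteq> F"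
    and "(\<Sum>j<n. real (card (C j)) * real (card (T j))) \<le> (1 + \<epsilon>) * real (card F)"
proof -
  show sub: "(\<Union>j<n. \<Union>c\<in>C j. T j #> c) \<subseteq> F"
    using qt unfolding quasi_tiling_def by (intro UN_least) auto
  have "(1 + \<epsilon>) * real (card (\<Union>j<n. \<Union>c\<in>C j. T j #> c)) \<le> (1 + \<epsilon>) * real (card F)"
    using card_mono[OF F sub] eps by (intro mult_left_mono) auto
  then show "(\<Sum>j<n. real (card (C j)) * real (card (T j))) \<le> (1 + \<epsilon>) * real (card F)"
    using qt by (simp add: quasi_tiling_def)
qed

lemma frequently_folner:
  "frequently P (folner G) \<longleftrightarrow>
    (\<forall>K \<in> nonempty_finite_subsets (carrier G). \<forall>\<delta>>0. \<exists>F. invariant_set G K \<delta> F \<and> P F)"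
  unfolding frequently_def eventually_folner[OF is_group] by blast

lemma eventually_invariant:
  "K \<in> nonempty_finite_subsets (carrier G) \<Longrightarrow> \<delta> > 0 \<Longrightarrow> eventually (invariant_set G K \<delta>) (folner G)"
  using eventually_folner[OF is_group, of "invariant_set G K \<delta>"] by blast

lemma eventually_folner_finite:
  "eventually (\<lambda>F. finite F \<and> F \<noteq> {} \<and> F \<subseteq> carrier G) (folner G)"
  by (rule eventually_mono[OF eventually_invariant[of "{\<one>}" 1]])
    (auto dest: invariant_setD simp: nonempty_finite_subsets_def)

text \<open>
  Every further tile covers a fixed proportion of what is still uncovered. The tile added last is
  the first to be used, and is chosen so invariant that what it leaves over, unless negligible,
  can be treated by the tiles found before.
\<close>

lemma quasi_tiling_decay:
  assumes P: "frequently P (folner G)" and eps: "0 < \<epsilon>" "\<epsilon> \<le> 1"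
  shows "\<exists>T. (\<forall>j<n. P (T j) \<and> T j \<in> nonempty_finite_subsets (carrier G)) \<and>
     eventually (\<lambda>F. \<exists>C. quasi_tiling \<epsilon> T n C F \<and>
        real (card (F - (\<Union>j<n. \<Union>c\<in>C j. T j #> c))) \<le> max \<epsilon> ((1 - \<epsilon> / 4) ^ n) * real (card F))
      (folner G)"
proof (induction n)
  case 0
  show ?case by (auto simp: quasi_tiling_def eps)
next
  case (Suc n)
  then obtain T where T: "\<forall>j<n. P (T j) \<and> T j \<in> nonempty_finite_subsets (carrier G)"
    and ev: "eventually (\<lambda>F. \<exists>C. quasi_tiling \<epsilon> T n C F \<and>
        real (card (F - (\<Union>j<n. \<Union>c\<in>C j. T j #> c))) \<le> max \<epsilon> ((1 - \<epsilon> / 4) ^ n) * real (card F))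
      (folner G)" by blast
  then obtain K \<delta>' where K: "K \<in> nonempty_finite_subsets (carrier G)" and \<delta>': "\<delta>' > 0"
    and tiled: "\<And>F. invariant_set G K \<delta>' F \<Longrightarrow> \<exists>C. quasi_tiling \<epsilon> T n C F \<and>
        real (card (F - (\<Union>j<n. \<Union>c\<in>C j. T j #> c))) \<le> max \<epsilon> ((1 - \<epsilon> / 4) ^ n) * real (card F)"
    unfolding eventually_folner[OF is_group] by blast
  \<comment> \<open>the boundary of \<open>F\<close> and of the translates of the new tile, at most \<open>\<delta> (1 + 2 |K|) |F|\<close> points,
    must not exceed \<open>\<delta>'\<close> times the size of what the new tile leaves over, which is more than
    \<open>\<epsilon> |F|\<close> in the only case of interest\<close>
  define \<delta> where "\<delta> = \<delta>' * \<epsilon> / (1 + 2 * real (card K))"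
  have \<delta>: "\<delta> > 0" using \<delta>' eps by (simp add: \<delta>_def add_pos_nonneg)
  obtain Tn where Tn: "invariant_set G K \<delta> Tn" "P Tn"
    using P K \<delta> unfolding frequently_folner by blast
  note Tns = invariant_setD[OF Tn(1)]
  have Tn': "Tn \<in> nonempty_finite_subsets (carrier G)"
    using Tns by (simp add: nonempty_finite_subsets_def)
  show ?case
  proof (intro exI conjI)
    show "\<forall>j<Suc n. P ((T(n := Tn)) j) \<and> (T(n := Tn)) j \<in> nonempty_finite_subsets (carrier G)"
      using T Tn Tn' by (auto simp: less_Suc_eq)
    have "eventually (invariant_set G K \<delta>) (folner G)"
      "eventually (invariant_set G Tn (1/2)) (folner G)"
      using K \<delta> Tn' by (auto intro: eventually_invariant)
    then show "eventually (\<lambda>F. \<exists>C. quasi_tiling \<epsilon> (T(n := Tn)) (Suc n) C F \<and>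
        real (card (F - (\<Union>j<Suc n. \<Union>c\<in>C j. (T(n := Tn)) j #> c)))
          \<le> max \<epsilon> ((1 - \<epsilon> / 4) ^ Suc n) * real (card F)) (folner G)"
    proof eventually_elim
      case (elim F)
      note Fs = invariant_setD[OF elim(1)]
      \<comment> \<open>the admissible overlap is \<open>\<epsilon> / 2\<close>, as \<open>1 / (1 - \<epsilon> / 2) \<le> 1 + \<epsilon>\<close>\<close>
      obtain Cn where Cn: "Cn \<subseteq> {c \<in> F. Tn #> c \<subseteq> F}"
        and le: "(1 - \<epsilon> / 2) * (real (card Cn) * real (card Tn))
            \<le> real (card (\<Union>c\<in>Cn. Tn #> c))"
        and ge: "\<epsilon> / 2 * real (card {c \<in> F. Tn #> c \<subseteq> F}) \<le> real (card (\<Union>c\<in>Cn. Tn #> c))"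
        using greedy_translates[OF Fs(1,3) Tns(1-3), of "\<epsilon> / 2"] eps by auto
      let ?U = "\<Union>c\<in>Cn. Tn #> c"
      let ?F = "F - ?U"
      have UF: "?U \<subseteq> F" using Cn by auto
      have cF: "real (card ?F) = real (card F) - real (card ?U)"
        using UF Fs(1) by (simp add: card_Diff_subset finite_subset card_mono of_nat_diff)
      have "1 \<le> (1 + \<epsilon>) * (1 - \<epsilon> / 2)" using eps by (simp add: algebra_simps)
      then have "1 * (real (card Cn) * real (card Tn))
          \<le> (1 + \<epsilon>) * (1 - \<epsilon> / 2) * (real (card Cn) * real (card Tn))"
        by (rule mult_right_mono) simp
      also have "\<dots> \<le> (1 + \<epsilon>) * real (card ?U)"
        using mult_left_mono[OF le, of "1 + \<epsilon>"] eps by (simp add: mult.assoc)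
      finally have sum: "real (card Cn) * real (card Tn) \<le> (1 + \<epsilon>) * real (card ?U)" by simp
      have "(1 - 1/2) * real (card F) \<le> real (card {c \<in> F. Tn #> c \<subseteq> F})"
        using elim(2) by (simp add: invariant_set_def)
      then have "\<epsilon> / 2 * (1/2 * real (card F)) \<le> \<epsilon> / 2 * real (card {c \<in> F. Tn #> c \<subseteq> F})"
        using eps by (intro mult_left_mono) auto
      then have big: "\<epsilon> / 4 * real (card F) \<le> real (card ?U)" using ge by simp
      have "\<exists>C. quasi_tiling \<epsilon> T n C ?F \<and>
        real (card (?F - (\<Union>j<n. \<Union>c\<in>C j. T j #> c)))
          \<le> max \<epsilon> ((1 - \<epsilon> / 4) ^ Suc n) * real (card F)"
      proof (cases "real (card ?F) \<le> \<epsilon> * real (card F)")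
        case True
        then have "real (card ?F) \<le> max \<epsilon> ((1 - \<epsilon> / 4) ^ Suc n) * real (card F)"
          by (meson max.cobounded1 mult_right_mono of_nat_0_le_iff order_trans)
        then show ?thesis
          by (intro exI[of _ "\<lambda>_. {}"]) (simp add: quasi_tiling_def)
      next
        case False
        have "invariant_set G K \<delta>' ?F"
        proof (rule invariant_setI)
          show "?F \<noteq> {}" using False eps by fastforce
          have "real (card Cn) * real (card Tn) \<le> 2 * real (card F)"
          proof -
            have "(1 + \<epsilon>) * real (card ?U) \<le> 2 * real (card F)"
              using eps UF Fs(1) by (intro mult_mono) (auto intro: card_mono)
            then show ?thesis using sum by linarith
          qed
          then have "real (card K) * \<delta> * (real (card Cn) * real (card Tn))
              \<le> real (card K) * \<delta> * (2 * real (card F))"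
            using \<delta> by (intro mult_left_mono) auto
          moreover have "real (card {s \<in> ?F. \<not> K #> s \<subseteq> ?F})
             \<le> \<delta> * real (card F) + real (card K) * \<delta> * (real (card Cn) * real (card Tn))"
            using bad_points_of_remainder[OF elim(1) Tn(1), of Cn] K Cn
            by (auto simp: nonempty_finite_subsets_def)
          ultimately have "real (card {s \<in> ?F. \<not> K #> s \<subseteq> ?F})
              \<le> \<delta> * (1 + 2 * real (card K)) * real (card F)"
            by (simp add: algebra_simps)
          also have "\<delta> * (1 + 2 * real (card K)) = \<delta>' * \<epsilon>"
            by (simp add: \<delta>_def add_nonneg_eq_0_iff)
          also have "\<delta>' * \<epsilon> * real (card F) \<le> \<delta>' * real (card ?F)"
            using False \<delta>' by (simp add: mult.assoc)
          finally show "real (card {s \<in> ?F. \<not> K #> s \<subseteq> ?F}) \<le> \<delta>' * real (card ?F)" .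
        qed (use Fs in auto)
        then obtain C where C: "quasi_tiling \<epsilon> T n C ?F"
          and left: "real (card (?F - (\<Union>j<n. \<Union>c\<in>C j. T j #> c)))
            \<le> max \<epsilon> ((1 - \<epsilon> / 4) ^ n) * real (card ?F)"
          using tiled by blast
        note left
        also have "max \<epsilon> ((1 - \<epsilon> / 4) ^ n) * real (card ?F)
            \<le> max \<epsilon> ((1 - \<epsilon> / 4) ^ n) * ((1 - \<epsilon> / 4) * real (card F))"
          using big eps by (intro mult_left_mono) (auto simp: cF algebra_simps max_def)
        also have "\<dots> \<le> max \<epsilon> ((1 - \<epsilon> / 4) ^ Suc n) * real (card F)"
        proof -
          have "max \<epsilon> ((1 - \<epsilon> / 4) ^ n) * (1 - \<epsilon> / 4)
              = max (\<epsilon> * (1 - \<epsilon> / 4)) ((1 - \<epsilon> / 4) ^ n * (1 - \<epsilon> / 4))"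
            using eps by (intro max_mult_distrib_right[THEN trans]) auto
          also have "\<dots> \<le> max \<epsilon> ((1 - \<epsilon> / 4) ^ Suc n)"
            using eps by (intro max.mono) (auto simp: mult_left_le)
          finally have "max \<epsilon> ((1 - \<epsilon> / 4) ^ n) * (1 - \<epsilon> / 4)
              \<le> max \<epsilon> ((1 - \<epsilon> / 4) ^ Suc n)" .
          from mult_right_mono[OF this, of "real (card F)"] show ?thesis by (simp add: mult.assoc)
        qed
        finally show ?thesis using C by blast
      qed
      then obtain C where C: "quasi_tiling \<epsilon> T n C ?F"
        and left: "real (card (?F - (\<Union>j<n. \<Union>c\<in>C j. T j #> c)))
          \<le> max \<epsilon> ((1 - \<epsilon> / 4) ^ Suc n) * real (card F)" by blast
      show ?case
      proof (intro exI conjI)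
        have CnF: "Cn \<subseteq> F" "\<And>c. c \<in> Cn \<Longrightarrow> Tn #> c \<subseteq> F" using Cn by auto
        note step = quasi_tiling_Suc[OF Fs(1) CnF sum C]
        show "quasi_tiling \<epsilon> (T(n := Tn)) (Suc n) (C(n := Cn)) F" by (rule step(1))
        show "real (card (F - (\<Union>j<Suc n. \<Union>c\<in>(C(n := Cn)) j. (T(n := Tn)) j #> c)))
            \<le> max \<epsilon> ((1 - \<epsilon> / 4) ^ Suc n) * real (card F)"
          by (rule ord_eq_le_trans[OF arg_cong[OF step(2), of "\<lambda>X. real (card X)"] left])
      qed
    qed
  qed
qed

text \<open>
  The tiles may be taken from any family that contains arbitrarily invariant sets. It need not
  contain all of them, which matters when the tiles are to realize a lower limit.
\<close>

theorem quasi_tiling_exists: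
  assumes P: "frequently P (folner G)" and eps: "0 < \<epsilon>" "\<epsilon> \<le> 1"
  shows "\<exists>T n. (\<forall>j<n. P (T j) \<and> T j \<in> nonempty_finite_subsets (carrier G)) \<and>
     eventually (\<lambda>F. \<exists>C. quasi_tiling \<epsilon> T n C F \<and>
        real (card (F - (\<Union>j<n. \<Union>c\<in>C j. T j #> c))) \<le> \<epsilon> * real (card F)) (folner G)"
proof -
  have "(\<lambda>n. (1 - \<epsilon> / 4) ^ n) \<longlonglongrightarrow> 0" using eps by (intro LIMSEQ_realpow_zero) auto
  then obtain n where "(1 - \<epsilon> / 4) ^ n < \<epsilon>"
    using eps by (metis eventually_sequentially order_tendstoD(2) order_refl)
  then have "max \<epsilon> ((1 - \<epsilon> / 4) ^ n) = \<epsilon>" by simp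
  then show ?thesis using quasi_tiling_decay[OF P eps, of n] by auto
qed


lemma folner_nontrivial: "amenable G \<Longrightarrow> folner G \<noteq> bot"
  unfolding amenable_def trivial_limit_def eventually_folner[OF is_group] by blast

lemma subadditive_UN_le:
  fixes f :: "'a set \<Rightarrow> real"
  assumes I: "finite I" and X: "\<And>i. i \<in> I \<Longrightarrow> finite (X i) \<and> X i \<subseteq> carrier G"
    and empty: "f {} \<le> 0"
    and subadd: "\<And>E F. finite E \<Longrightarrow> E \<subseteq> carrier G \<Longrightarrow> finite F \<Longrightarrow> F \<subseteq> carrier G \<Longrightarrow>
      f (E \<union> F) \<le> f E + f F"
  shows "f (\<Union>i\<in>I. X i) \<le> (\<Sum>i\<in>I. f (X i))"
  using I X
proof (induction I rule: finite_induct)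
  case (insert i I)
  have "f (\<Union>i\<in>insert i I. X i) = f (X i \<union> (\<Union>i\<in>I. X i))" by simp
  also have "\<dots> \<le> f (X i) + f (\<Union>i\<in>I. X i)"
    using insert by (intro subadd) auto
  finally show ?case using insert by fastforce
qed (use empty in simp)

lemma subadditive_le_card:
  fixes f :: "'a set \<Rightarrow> real"
  assumes empty: "f {} \<le> 0"
    and subadd: "\<And>E F. finite E \<Longrightarrow> E \<subseteq> carrier G \<Longrightarrow> finite F \<Longrightarrow> F \<subseteq> carrier G \<Longrightarrow>
      f (E \<union> F) \<le> f E + f F"
    and inv: "\<And>F c. finite F \<Longrightarrow> F \<subseteq> carrier G \<Longrightarrow> c \<in> carrier G \<Longrightarrow> f (F #> c) = f F"
    and F: "finite F" "F \<subseteq> carrier G"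
  shows "f F \<le> f {\<one>} * real (card F)"
proof -
  have "f (\<Union>c\<in>F. {c}) \<le> (\<Sum>c\<in>F. f {c})"
    using F empty subadd by (intro subadditive_UN_le) auto
  also have "\<dots> = (\<Sum>c\<in>F. f {\<one>})"
  proof (rule sum.cong)
    fix c assume "c \<in> F"
    moreover have "{\<one>} #> c = {c}" if "c \<in> carrier G" using that by (auto simp: r_coset_def)
    ultimately show "f {c} = f {\<one>}" using inv[of "{\<one>}" c] F by auto
  qed simp
  finally show ?thesis by (simp add: mult.commute)
qed

text \<open>
  The Ornstein--Weiss lemma. If \<open>\<mu>\<close> is the lower limit of \<open>f F / |F|\<close>, there are arbitrarily
  invariant tiles with \<open>f T \<le> (\<mu> + \<epsilon>) |T|\<close>; a quasi-tiling by them carries this bound, up to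
  \<open>\<epsilon>\<close>, over to all sufficiently invariant sets.
\<close>

theorem Ornstein_Weiss:
  fixes f :: "'a set \<Rightarrow> real"
  assumes amen: "amenable G"
    and empty: "f {} = 0"
    and mono: "\<And>E F. E \<subseteq> F \<Longrightarrow> finite F \<Longrightarrow> F \<subseteq> carrier G \<Longrightarrow> f E \<le> f F"
    and subadd: "\<And>E F. finite E \<Longrightarrow> E \<subseteq> carrier G \<Longrightarrow> finite F \<Longrightarrow> F \<subseteq> carrier G \<Longrightarrow>
      f (E \<union> F) \<le> f E + f F"
    and inv: "\<And>F c. finite F \<Longrightarrow> F \<subseteq> carrier G \<Longrightarrow> c \<in> carrier G \<Longrightarrow> f (F #> c) = f F"
  shows "\<exists>l\<ge>0. ((\<lambda>F. f F / real (card F)) \<longlongrightarrow> l) (folner G)"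
proof -
  define a where "a F = f F / real (card F)" for F
  define M where "M = f {\<one>}"
  have nonneg: "0 \<le> f F" if "finite F" "F \<subseteq> carrier G" for F
    using mono[OF empty_subsetI that] empty by simp
  have M0: "0 \<le> M" unfolding M_def by (rule nonneg) auto
  have linear: "f F \<le> M * real (card F)" if F: "finite F" "F \<subseteq> carrier G" for F
    unfolding M_def using empty by (intro subadditive_le_card subadd inv F) auto
  have range: "eventually (\<lambda>F. 0 \<le> a F \<and> a F \<le> M) (folner G)"
    using eventually_folner_finite
  proof eventually_elim
    case (elim F)
    then have "card F > 0" by (simp add: card_gt_0_iff)
    then show ?case using elim linear[of F] nonneg[of F] by (simp add: a_def field_simps)
  qed
  have nontriv: "folner G \<noteq> bot" using amen by (rule folner_nontrivial)
  define l where "l = Liminf (folner G) (\<lambda>F. ereal (a F))"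
  have "0 \<le> l" "l \<le> ereal M" unfolding l_def
    using range nontriv
    by (auto intro!: Liminf_bounded Liminf_le elim!: eventually_mono)
  then obtain \<mu> where \<mu>: "l = ereal \<mu>" "0 \<le> \<mu>" by (cases l) auto
  have low: "eventually (\<lambda>F. x < a F) (folner G)" if "x < \<mu>" for x
    using less_LiminfD[of "ereal x" "folner G" "\<lambda>F. ereal (a F)"] that by (simp add: \<mu> flip: l_def)
  have upp: "eventually (\<lambda>F. a F < x) (folner G)" if x: "\<mu> < x" for x
  proof -
    define \<epsilon> where "\<epsilon> = min 1 ((x - \<mu>) / (2 * (\<mu> + M + 3)))"
    have eps: "0 < \<epsilon>" "\<epsilon> \<le> 1" using x M0 \<mu>(2) by (auto simp: \<epsilon>_def)
    have "\<epsilon> \<le> (x - \<mu>) / (2 * (\<mu> + M + 3))" by (simp add: \<epsilon>_def)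
    then have "\<epsilon> * (2 * (\<mu> + M + 3)) \<le> x - \<mu>" using M0 \<mu>(2) by (simp add: field_simps)
    then have "2 * (\<epsilon> * \<mu>) + 2 * (\<epsilon> * M) + 6 * \<epsilon> \<le> x - \<mu>" by (simp add: algebra_simps)
    moreover have "\<epsilon> * \<epsilon> \<le> \<epsilon>" using eps by (simp add: mult_left_le)
    moreover have "0 \<le> \<epsilon> * \<mu>" "0 \<le> \<epsilon> * M" using eps \<mu>(2) M0 by auto
    ultimately have "\<mu> + \<epsilon> + \<epsilon> * M + \<epsilon> * \<epsilon> + \<epsilon> * \<mu> < x"
      using eps by linarith
    then have small: "(\<mu> + \<epsilon>) * (1 + \<epsilon>) + M * \<epsilon> < x"
      by (simp add: algebra_simps)
    have "frequently (\<lambda>F. a F < \<mu> + \<epsilon>) (folner G)"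
    proof (rule ccontr)
      assume "\<not> ?thesis"
      then have "eventually (\<lambda>F. ereal (\<mu> + \<epsilon>) \<le> ereal (a F)) (folner G)"
        by (simp add: not_frequently not_less)
      then have "ereal (\<mu> + \<epsilon>) \<le> l" unfolding l_def by (rule Liminf_bounded)
      then show False using eps by (simp add: \<mu>)
    qed
    from quasi_tiling_exists[OF this eps] obtain T n
      where tiles: "\<forall>j<n. a (T j) < \<mu> + \<epsilon> \<and> T j \<in> nonempty_finite_subsets (carrier G)"
        and ev: "eventually (\<lambda>F. \<exists>C. quasi_tiling \<epsilon> T n C F \<and>
        real (card (F - (\<Union>j<n. \<Union>c\<in>C j. T j #> c))) \<le> \<epsilon> * real (card F)) (folner G)"
      by (elim exE conjE)
    have T: "a (T j) < \<mu> + \<epsilon>" "T j \<in> nonempty_finite_subsets (carrier G)" if "j < n" for j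
      using tiles that by auto
    show ?thesis
      using ev eventually_folner_finite
    proof eventually_elim
      case (elim F)
      then obtain C where C: "quasi_tiling \<epsilon> T n C F"
        and left: "real (card (F - (\<Union>j<n. \<Union>c\<in>C j. T j #> c))) \<le> \<epsilon> * real (card F)" by blast
      let ?V = "\<Union>j<n. \<Union>c\<in>C j. T j #> c"
      have CF: "C j \<subseteq> F" "\<And>c. c \<in> C j \<Longrightarrow> T j #> c \<subseteq> F" if "j < n" for j
        using C that by (auto simp: quasi_tiling_def)
      note qt = quasi_tilingD[OF C _ less_imp_le[OF eps(1)]]
      have VF: "?V \<subseteq> F" using qt(1) elim by blast
      have fin: "finite (C j)" if "j < n" for j
        using CF(1)[OF that] elim by (meson finite_subset)
      have "f F = f ((F - ?V) \<union> ?V)" using VF by (simp add: Un_absorb2)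
      also have "\<dots> \<le> f (F - ?V) + f ?V"
      proof (rule subadd)
        show "finite ?V" using VF elim by (meson finite_subset)
        show "?V \<subseteq> carrier G" using VF elim by (meson order_trans)
      qed (use elim in auto)
      also have "f (F - ?V) \<le> M * (\<epsilon> * real (card F))"
      proof -
        have "f (F - ?V) \<le> M * real (card (F - ?V))" using elim by (intro linear) auto
        also have "\<dots> \<le> M * (\<epsilon> * real (card F))" using left M0 by (rule mult_left_mono)
        finally show ?thesis .
      qed
      also have "f ?V \<le> (\<Sum>j<n. f (\<Union>c\<in>C j. T j #> c))"
      proof (rule subadditive_UN_le[OF _ _ _ subadd])
        fix j assume "j \<in> {..<n}"
        then have "(\<Union>c\<in>C j. T j #> c) \<subseteq> F" using CF by blast
        then show "finite (\<Union>c\<in>C j. T j #> c) \<and> (\<Union>c\<in>C j. T j #> c) \<subseteq> carrier G"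
          using elim by (meson finite_subset order_trans)
      qed (use empty in auto)
      also have "\<dots> \<le> (\<Sum>j<n. (\<mu> + \<epsilon>) * (real (card (C j)) * real (card (T j))))"
      proof (rule sum_mono)
        fix j assume "j \<in> {..<n}"
        then have j: "j < n" by simp
        have Tj: "finite (T j)" "T j \<noteq> {}" "T j \<subseteq> carrier G"
          using T(2)[OF j] by (auto simp: nonempty_finite_subsets_def)
        have Cj: "C j \<subseteq> carrier G" using CF(1)[OF j] elim by blast
        have "f (\<Union>c\<in>C j. T j #> c) \<le> (\<Sum>c\<in>C j. f (T j #> c))"
        proof (rule subadditive_UN_le[OF fin[OF j] _ _ subadd])
          fix c assume "c \<in> C j"
          then show "finite (T j #> c) \<and> T j #> c \<subseteq> carrier G"
            using Tj Cj r_coset_subset_G finite_r_coset by blast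
        qed (use empty in auto)
        also have "\<dots> = real (card (C j)) * f (T j)"
          using Tj Cj by (simp add: inv subset_iff)
        also have "\<dots> \<le> real (card (C j)) * ((\<mu> + \<epsilon>) * real (card (T j)))"
        proof (rule mult_left_mono)
          show "f (T j) \<le> (\<mu> + \<epsilon>) * real (card (T j))"
            using T(1)[OF j] Tj by (simp add: a_def field_simps card_gt_0_iff)
        qed simp
        also have "\<dots> = (\<mu> + \<epsilon>) * (real (card (C j)) * real (card (T j)))" by simp
        finally show "f (\<Union>c\<in>C j. T j #> c) \<le> (\<mu> + \<epsilon>) * (real (card (C j)) * real (card (T j)))" .
      qed
      also have "\<dots> = (\<mu> + \<epsilon>) * (\<Sum>j<n. real (card (C j)) * real (card (T j)))"
        by (simp add: sum_distrib_left)
      also have "\<dots> \<le> (\<mu> + \<epsilon>) * ((1 + \<epsilon>) * real (card F))"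
        using qt(2) elim eps \<mu>(2) by (intro mult_left_mono) auto
      finally have "f F \<le> ((\<mu> + \<epsilon>) * (1 + \<epsilon>) + M * \<epsilon>) * real (card F)"
        by (simp add: algebra_simps)
      moreover have "card F > 0" using elim by (simp add: card_gt_0_iff)
      ultimately have "a F \<le> (\<mu> + \<epsilon>) * (1 + \<epsilon>) + M * \<epsilon>" by (simp add: a_def field_simps)
      then show "a F < x" using small by simp
    qed
  qed
  have "(a \<longlongrightarrow> \<mu>) (folner G)" using low upp by (rule order_tendstoI)
  then show ?thesis using \<mu>(2) unfolding a_def by blast
qed

end

section \<open>Modules, submodules and translates\<close>

lemma set_add_iff: "x \<in> A <+>\<^bsub>M\<^esub> B \<longleftrightarrow> (\<exists>a\<in>A. \<exists>b\<in>B. x = a \<oplus>\<^bsub>M\<^esub> b)"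
  by (auto simp: set_add_def set_mult_def)

lemma set_addI: "a \<in> A \<Longrightarrow> b \<in> B \<Longrightarrow> a \<oplus>\<^bsub>M\<^esub> b \<in> A <+>\<^bsub>M\<^esub> B"
  by (auto simp: set_add_iff)

lemma set_add_mono: "A \<subseteq> A' \<Longrightarrow> B \<subseteq> B' \<Longrightarrow> A <+>\<^bsub>M\<^esub> B \<subseteq> A' <+>\<^bsub>M\<^esub> B'"
  unfolding subset_iff set_add_iff by blast

lemma set_add_image: "A <+>\<^bsub>M\<^esub> B = (\<lambda>(a, b). a \<oplus>\<^bsub>M\<^esub> b) ` (A \<times> B)"
  by (force simp: set_add_iff)

lemma set_add_images: "f ` A <+>\<^bsub>M\<^esub> g ` B = (\<lambda>(a, b). f a \<oplus>\<^bsub>M\<^esub> g b) ` (A \<times> B)"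
proof -
  have "f ` A \<times> g ` B = (\<lambda>(a, b). (f a, g b)) ` (A \<times> B)" by (rule image_paired_Times[symmetric])
  then show ?thesis by (simp add: set_add_image image_image case_prod_unfold)
qed

lemma finite_set_add: "finite A \<Longrightarrow> finite B \<Longrightarrow> finite (A <+>\<^bsub>M\<^esub> B)"
  by (simp add: set_add_image)

context abelian_group
begin

lemma set_add_commute:
  assumes "A \<subseteq> carrier G" "B \<subseteq> carrier G"
  shows "A <+>\<^bsub>G\<^esub> B = B <+>\<^bsub>G\<^esub> A"
proof -
  have "X <+>\<^bsub>G\<^esub> Y \<subseteq> Y <+>\<^bsub>G\<^esub> X" if "X \<subseteq> carrier G" "Y \<subseteq> carrier G" for X Y
  proof
    fix z assume "z \<in> X <+>\<^bsub>G\<^esub> Y"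
    then obtain x y where xy: "x \<in> X" "y \<in> Y" "z = x \<oplus> y" by (auto simp: set_add_iff)
    then have "z = y \<oplus> x" using that a_comm by blast
    then show "z \<in> Y <+>\<^bsub>G\<^esub> X" using xy by (simp add: set_addI)
  qed
  then show ?thesis using assms by blast
qed

lemma set_add_assoc:
  assumes "A \<subseteq> carrier G" "B \<subseteq> carrier G" "C \<subseteq> carrier G"
  shows "A <+>\<^bsub>G\<^esub> B <+>\<^bsub>G\<^esub> C = A <+>\<^bsub>G\<^esub> (B <+>\<^bsub>G\<^esub> C)"
  using group.set_mult_assoc[OF a_group, of A B C] assms by (simp add: set_add_def)

lemma set_add_left_commute:
  assumes "A \<subseteq> carrier G" "B \<subseteq> carrier G" "C \<subseteq> carrier G"
  shows "A <+>\<^bsub>G\<^esub> (B <+>\<^bsub>G\<^esub> C) = B <+>\<^bsub>G\<^esub> (A <+>\<^bsub>G\<^esub> C)"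
  using assms by (metis set_add_assoc set_add_commute)

lemma set_add_zero: "A \<subseteq> carrier G \<Longrightarrow> {\<zero>} <+>\<^bsub>G\<^esub> A = A" "A \<subseteq> carrier G \<Longrightarrow> A <+>\<^bsub>G\<^esub> {\<zero>} = A"
  by (force simp: set_add_iff subset_iff)+

lemma subset_set_add:
  assumes "A \<subseteq> carrier G" "B \<subseteq> carrier G"
  shows "\<zero> \<in> B \<Longrightarrow> A \<subseteq> A <+>\<^bsub>G\<^esub> B" "\<zero> \<in> A \<Longrightarrow> B \<subseteq> A <+>\<^bsub>G\<^esub> B"
  using assms by (force simp: set_add_iff subset_iff)+

end

lemma zero_finite_subsetsD:
  assumes "A \<in> zero_finite_subsets M V"
  shows "finite A" "\<zero>\<^bsub>M\<^esub> \<in> A" "A \<subseteq> V"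
  using assms by (auto simp: zero_finite_subsets_def)

lemma zero_finite_subsetsI:
  "finite A \<Longrightarrow> \<zero>\<^bsub>M\<^esub> \<in> A \<Longrightarrow> A \<subseteq> V \<Longrightarrow> A \<in> zero_finite_subsets M V"
  by (auto simp: zero_finite_subsets_def)

text \<open>The locale of left modules, at the record type to which submodules and quotients belong.\<close>

locale lmodule = left_module R M
  for R :: "('r, 'a) ring_scheme" (structure) and M :: "('r, 'm) module" (structure)
begin

lemma smult_r_null: "a \<in> carrier R \<Longrightarrow> a \<odot>\<^bsub>M\<^esub> \<zero>\<^bsub>M\<^esub> = \<zero>\<^bsub>M\<^esub>"
  using smult_r_distr[of a "\<zero>\<^bsub>M\<^esub>" "\<zero>\<^bsub>M\<^esub>"] M.add.r_cancel_one'[of "a \<odot>\<^bsub>M\<^esub> \<zero>\<^bsub>M\<^esub>" "a \<odot>\<^bsub>M\<^esub> \<zero>\<^bsub>M\<^esub>"]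
  by simp

lemma smult_l_null: "x \<in> carrier M \<Longrightarrow> \<zero> \<odot>\<^bsub>M\<^esub> x = \<zero>\<^bsub>M\<^esub>"
  using smult_l_distr[of "\<zero>" "\<zero>" x] M.add.r_cancel_one'[of "\<zero> \<odot>\<^bsub>M\<^esub> x" "\<zero> \<odot>\<^bsub>M\<^esub> x"]
  by simp

lemma smult_minus_one: "x \<in> carrier M \<Longrightarrow> (\<ominus> \<one>) \<odot>\<^bsub>M\<^esub> x = \<ominus>\<^bsub>M\<^esub> x"
  using smult_l_distr[of "\<ominus> \<one>" \<one> x] smult_l_null[of x]
  by (simp add: R.l_neg M.minus_equality)

lemma submoduleI:
  assumes "H \<subseteq> carrier M" "\<zero>\<^bsub>M\<^esub> \<in> H"
    and "\<And>x y. x \<in> H \<Longrightarrow> y \<in> H \<Longrightarrow> x \<oplus>\<^bsub>M\<^esub> y \<in> H"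
    and "\<And>a x. a \<in> carrier R \<Longrightarrow> x \<in> H \<Longrightarrow> a \<odot>\<^bsub>M\<^esub> x \<in> H"
  shows "submodule H R M"
proof -
  have "\<ominus>\<^bsub>M\<^esub> x \<in> H" if "x \<in> H" for x
    using assms(4)[of "\<ominus> \<one>" x] smult_minus_one[of x] assms(1) that by auto
  then show ?thesis
    using assms by (auto intro!: submodule.intro subgroup.intro
        simp: submodule_axioms_def simp flip: a_inv_def)
qed

lemma submoduleD:
  assumes "submodule H R M"
  shows "H \<subseteq> carrier M" "\<zero>\<^bsub>M\<^esub> \<in> H"
    and "\<And>x y. x \<in> H \<Longrightarrow> y \<in> H \<Longrightarrow> x \<oplus>\<^bsub>M\<^esub> y \<in> H"
    and "\<And>x. x \<in> H \<Longrightarrow> \<ominus>\<^bsub>M\<^esub> x \<in> H"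
    and "\<And>x y. x \<in> H \<Longrightarrow> y \<in> H \<Longrightarrow> x \<ominus>\<^bsub>M\<^esub> y \<in> H"
    and "\<And>a x. a \<in> carrier R \<Longrightarrow> x \<in> H \<Longrightarrow> a \<odot>\<^bsub>M\<^esub> x \<in> H"
proof -
  interpret H: submodule H R M by fact
  show "H \<subseteq> carrier M" "\<zero>\<^bsub>M\<^esub> \<in> H" using H.subset H.one_closed by auto
  show add: "x \<oplus>\<^bsub>M\<^esub> y \<in> H" if "x \<in> H" "y \<in> H" for x y using H.m_closed that by auto
  show inv: "\<ominus>\<^bsub>M\<^esub> x \<in> H" if "x \<in> H" for x using H.m_inv_closed[OF that] by (simp add: a_inv_def)
  show "x \<ominus>\<^bsub>M\<^esub> y \<in> H" if "x \<in> H" "y \<in> H" for x y using that add inv by (simp add: a_minus_def)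
  show "a \<odot>\<^bsub>M\<^esub> x \<in> H" if "a \<in> carrier R" "x \<in> H" for a x using that by auto
qed

lemma carrier_submodule: "submodule (carrier M) R M"
  by (rule submoduleI) auto

lemma zero_submodule: "submodule {\<zero>\<^bsub>M\<^esub>} R M"
  by (rule submoduleI) (auto simp: smult_r_null)

lemma submod_left_module:
  assumes H: "submodule H R M"
  shows "left_module R (submod M H)"
proof -
  note HD = submoduleD[OF H]
  have "abelian_group (submod M H)"
  proof (rule abelian_groupI)
    fix x assume "x \<in> carrier (submod M H)"
    then show "\<exists>y\<in>carrier (submod M H). y \<oplus>\<^bsub>submod M H\<^esub> x = \<zero>\<^bsub>submod M H\<^esub>"
      using HD by (auto intro!: bexI[of _ "\<ominus>\<^bsub>M\<^esub> x"] simp: M.l_neg subset_iff)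
  qed (use HD in \<open>auto simp: subset_iff M.a_ac\<close>)
  then show ?thesis
    using HD by (intro left_module.intro left_module_axioms.intro R.ring_axioms)
      (auto simp: subset_iff smult_l_distr smult_r_distr smult_assoc1)
qed

lemma submodule_submod_iff:
  assumes H: "submodule H R M"
  shows "submodule K R (submod M H) \<longleftrightarrow> submodule K R M \<and> K \<subseteq> H"
proof -
  interpret H: lmodule R "submod M H" using submod_left_module[OF H] by (rule lmodule.intro)
  show ?thesis
  proof
    assume "submodule K R (submod M H)"
    note KD = H.submoduleD[OF this]
    show "submodule K R M \<and> K \<subseteq> H"
      using KD submoduleD(1)[OF H] by (intro conjI submoduleI) auto
  next
    assume K: "submodule K R M \<and> K \<subseteq> H"
    then have "submodule K R M" by blast
    note KD = submoduleD[OF this]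
    show "submodule K R (submod M H)" using KD K by (intro H.submoduleI) auto
  qed
qed

lemma Int_submodule: "submodule H R M \<Longrightarrow> submodule K R M \<Longrightarrow> submodule (H \<inter> K) R M"
  by (rule submoduleI) (auto dest: submoduleD)

lemma set_add_submodule:
  assumes H: "submodule H R M" and K: "submodule K R M"
  shows "submodule (H <+>\<^bsub>M\<^esub> K) R M"
proof -
  note HD = submoduleD[OF H] and KD = submoduleD[OF K]
  show ?thesis
  proof (rule submoduleI)
    show "H <+>\<^bsub>M\<^esub> K \<subseteq> carrier M" using HD(1) KD(1) by (rule M.set_add_closed)
    show "\<zero>\<^bsub>M\<^esub> \<in> H <+>\<^bsub>M\<^esub> K" using set_addI[OF HD(2) KD(2), of M] by simp
  next
    fix x y assume "x \<in> H <+>\<^bsub>M\<^esub> K" "y \<in> H <+>\<^bsub>M\<^esub> K"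
    then obtain h k h' k' where *: "h \<in> H" "k \<in> K" "x = h \<oplus>\<^bsub>M\<^esub> k" "h' \<in> H" "k' \<in> K" "y = h' \<oplus>\<^bsub>M\<^esub> k'"
      by (auto simp: set_add_iff)
    moreover have "h \<in> carrier M" "k \<in> carrier M" "h' \<in> carrier M" "k' \<in> carrier M"
      using * HD(1) KD(1) by auto
    ultimately have "x \<oplus>\<^bsub>M\<^esub> y = (h \<oplus>\<^bsub>M\<^esub> h') \<oplus>\<^bsub>M\<^esub> (k \<oplus>\<^bsub>M\<^esub> k')" by (simp add: M.a_ac)
    then show "x \<oplus>\<^bsub>M\<^esub> y \<in> H <+>\<^bsub>M\<^esub> K" using * HD(3) KD(3) by (simp add: set_addI)
  next
    fix a x assume a: "a \<in> carrier R" and "x \<in> H <+>\<^bsub>M\<^esub> K"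
    then obtain h k where *: "h \<in> H" "k \<in> K" "x = h \<oplus>\<^bsub>M\<^esub> k" by (auto simp: set_add_iff)
    moreover have "h \<in> carrier M" "k \<in> carrier M" using * HD(1) KD(1) by auto
    ultimately have "a \<odot>\<^bsub>M\<^esub> x = a \<odot>\<^bsub>M\<^esub> h \<oplus>\<^bsub>M\<^esub> a \<odot>\<^bsub>M\<^esub> k" using a by (simp add: smult_r_distr)
    then show "a \<odot>\<^bsub>M\<^esub> x \<in> H <+>\<^bsub>M\<^esub> K" using * a HD(6) KD(6) by (simp add: set_addI)
  qed
qed

end

definition translate ::
    "('r, 'a) ring_scheme \<Rightarrow> ('g, 'b) monoid_scheme \<Rightarrow> ('g \<Rightarrow> 'r, 'm) module \<Rightarrow> 'g \<Rightarrow> 'm \<Rightarrow> 'm" where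
  "translate R G M s x = gr_monom R G \<one>\<^bsub>R\<^esub> s \<odot>\<^bsub>M\<^esub> x"

lemma gr_monom_closed:
  assumes "ring R" "r \<in> carrier R"
  shows "gr_monom R G r s \<in> carrier (group_ring R G)"
proof -
  interpret ring R by fact
  have "finite {g \<in> carrier G. gr_monom R G r s g \<noteq> \<zero>\<^bsub>R\<^esub>}"
    by (rule finite_subset[of _ "{s}"]) (auto simp: gr_monom_def)
  moreover have "gr_monom R G r s \<in> carrier G \<rightarrow>\<^sub>E carrier R"
    using assms by (auto simp: gr_monom_def)
  ultimately show ?thesis by (simp add: group_ring_def)
qed

lemma gr_monom_add:
  assumes "ring R" "r \<in> carrier R" "r' \<in> carrier R"
  shows "gr_monom R G (r \<oplus>\<^bsub>R\<^esub> r') s = gr_monom R G r s \<oplus>\<^bsub>group_ring R G\<^esub> gr_monom R G r' s"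
proof -
  interpret ring R by fact
  show ?thesis using assms by (auto simp: gr_monom_def group_ring_def restrict_def fun_eq_iff)
qed

lemma gr_monom_mult:
  assumes "ring R" "group G" "r \<in> carrier R" "r' \<in> carrier R" "s \<in> carrier G" "t \<in> carrier G"
  shows "gr_monom R G r s \<otimes>\<^bsub>group_ring R G\<^esub> gr_monom R G r' t
    = gr_monom R G (r \<otimes>\<^bsub>R\<^esub> r') (s \<otimes>\<^bsub>G\<^esub> t)"
proof (rule ext)
  fix g
  interpret R: ring R by fact
  interpret G: group G by fact
  let ?S = "{x \<in> carrier G. gr_monom R G r s x \<noteq> \<zero>\<^bsub>R\<^esub>}"
  show "(gr_monom R G r s \<otimes>\<^bsub>group_ring R G\<^esub> gr_monom R G r' t) g
      = gr_monom R G (r \<otimes>\<^bsub>R\<^esub> r') (s \<otimes>\<^bsub>G\<^esub> t) g"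
  proof (cases "g \<in> carrier G")
    case False
    then show ?thesis by (simp add: group_ring_def gr_monom_def)
  next
    case g: True
    have S: "?S = (if r = \<zero>\<^bsub>R\<^esub> then {} else {s})" using assms by (auto simp: gr_monom_def)
    have iff: "inv\<^bsub>G\<^esub> s \<otimes>\<^bsub>G\<^esub> g = t \<longleftrightarrow> g = s \<otimes>\<^bsub>G\<^esub> t"
      using assms g G.inv_solve_left'[of t s g] by auto
    have "(gr_monom R G r s \<otimes>\<^bsub>group_ring R G\<^esub> gr_monom R G r' t) g
      = (\<Oplus>\<^bsub>R\<^esub>x\<in>?S. gr_monom R G r s x \<otimes>\<^bsub>R\<^esub> gr_monom R G r' t (inv\<^bsub>G\<^esub> x \<otimes>\<^bsub>G\<^esub> g))"
      using g by (simp add: group_ring_def)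
    also have "\<dots> = gr_monom R G (r \<otimes>\<^bsub>R\<^esub> r') (s \<otimes>\<^bsub>G\<^esub> t) g"
    proof (cases "r = \<zero>\<^bsub>R\<^esub>")
      case True
      then show ?thesis using g assms unfolding S by (simp add: gr_monom_def)
    next
      case False
      then show ?thesis using g assms iff unfolding S by (simp add: gr_monom_def)
    qed
    finally show ?thesis .
  qed
qed

locale group_ring_module = R: ring R + G: group G + M: lmodule "group_ring R G" M
  for R :: "('r, 'a) ring_scheme" and G :: "('g, 'b) monoid_scheme" and M :: "('g \<Rightarrow> 'r, 'm) module"
begin

abbreviation "tr \<equiv> translate R G M"
abbreviation "ts \<equiv> translate_sum R G M"

lemma monom_closed: "gr_monom R G \<one>\<^bsub>R\<^esub> s \<in> carrier (group_ring R G)"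
  by (rule gr_monom_closed[OF R.ring_axioms R.one_closed])

lemma translate_closed: "x \<in> carrier M \<Longrightarrow> tr s x \<in> carrier M"
  using M.smult_closed monom_closed by (simp add: translate_def)

lemma translate_image_closed: "A \<subseteq> carrier M \<Longrightarrow> tr s ` A \<subseteq> carrier M"
  using translate_closed by blast

lemma translate_add:
  "x \<in> carrier M \<Longrightarrow> y \<in> carrier M \<Longrightarrow> tr s (x \<oplus>\<^bsub>M\<^esub> y) = tr s x \<oplus>\<^bsub>M\<^esub> tr s y"
  using M.smult_r_distr monom_closed by (simp add: translate_def)

lemma translate_zero: "tr s \<zero>\<^bsub>M\<^esub> = \<zero>\<^bsub>M\<^esub>"
  using M.smult_r_null monom_closed by (simp add: translate_def)

lemma translate_mult:
  "s \<in> carrier G \<Longrightarrow> t \<in> carrier G \<Longrightarrow> x \<in> carrier M \<Longrightarrow> tr (s \<otimes>\<^bsub>G\<^esub> t) x = tr s (tr t x)"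
  using M.smult_assoc1[of "gr_monom R G \<one>\<^bsub>R\<^esub> s" "gr_monom R G \<one>\<^bsub>R\<^esub> t" x]
    monom_closed
    gr_monom_mult[OF R.ring_axioms G.group_axioms, of "\<one>\<^bsub>R\<^esub>" "\<one>\<^bsub>R\<^esub>" s t]
  by (simp add: translate_def)

lemma translate_one: "x \<in> carrier M \<Longrightarrow> tr \<one>\<^bsub>G\<^esub> x = x"
proof -
  have "gr_monom R G \<one>\<^bsub>R\<^esub> \<one>\<^bsub>G\<^esub> = \<one>\<^bsub>group_ring R G\<^esub>"
    by (simp add: gr_monom_def group_ring_def)
  then show "x \<in> carrier M \<Longrightarrow> tr \<one>\<^bsub>G\<^esub> x = x" by (simp add: translate_def)
qed

lemma translate_inv:
  assumes "s \<in> carrier G" "x \<in> carrier M"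
  shows "tr s (tr (inv\<^bsub>G\<^esub> s) x) = x" "tr (inv\<^bsub>G\<^esub> s) (tr s x) = x"
  using assms translate_mult[of s "inv\<^bsub>G\<^esub> s" x] translate_mult[of "inv\<^bsub>G\<^esub> s" s x]
  by (simp_all add: translate_one)

lemma translate_submodule: "submodule V (group_ring R G) M \<Longrightarrow> x \<in> V \<Longrightarrow> tr s x \<in> V"
  using M.submoduleD(6) monom_closed by (simp add: translate_def)

lemma translate_set_add:
  assumes "A \<subseteq> carrier M" "B \<subseteq> carrier M"
  shows "tr s ` (A <+>\<^bsub>M\<^esub> B) = tr s ` A <+>\<^bsub>M\<^esub> tr s ` B"
proof -
  have "tr s ` (A <+>\<^bsub>M\<^esub> B) = (\<lambda>(a, b). tr s (a \<oplus>\<^bsub>M\<^esub> b)) ` (A \<times> B)"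
    by (auto simp: set_add_image)
  also have "\<dots> = (\<lambda>(a, b). tr s a \<oplus>\<^bsub>M\<^esub> tr s b) ` (A \<times> B)"
    using assms by (intro image_cong) (auto simp: translate_add subset_iff)
  finally show ?thesis by (simp add: set_add_images)
qed

lemma zero_in_translate: "\<zero>\<^bsub>M\<^esub> \<in> A \<Longrightarrow> \<zero>\<^bsub>M\<^esub> \<in> tr s ` A"
  by (rule image_eqI[of _ _ "\<zero>\<^bsub>M\<^esub>"]) (simp_all add: translate_zero)

lemma translate_sum_empty: "ts A {} = {\<zero>\<^bsub>M\<^esub>}"
  by (auto simp: translate_sum_def)

text \<open>The recursion from which the other properties of \<open>A\<^sup>[\<^sup>F\<^sup>]\<close> follow by induction over \<open>F\<close>.\<close>

lemma translate_sum_insert: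
  assumes A: "A \<subseteq> carrier M" and F: "finite F" "s \<notin> F"
  shows "ts A (insert s F) = tr (inv\<^bsub>G\<^esub> s) ` A <+>\<^bsub>M\<^esub> ts A F"
proof -
  define v where "v a t = tr (inv\<^bsub>G\<^esub> t) (a t)" for a :: "'g \<Rightarrow> 'm" and t
  have ts: "ts A E = {\<Oplus>\<^bsub>M\<^esub>t\<in>E. v a t | a. a \<in> E \<rightarrow> A}" for E
    by (simp add: translate_sum_def v_def translate_def)
  have v: "v a \<in> E \<rightarrow> carrier M" if "a \<in> E \<rightarrow> A" for a E
    using that A translate_closed by (auto simp: v_def)
  show ?thesis
  proof (intro equalityI subsetI)
    fix x assume "x \<in> ts A (insert s F)"
    then obtain a where a: "a \<in> insert s F \<rightarrow> A" "x = (\<Oplus>\<^bsub>M\<^esub>t\<in>insert s F. v a t)"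
      unfolding ts by blast
    have vc: "v a \<in> F \<rightarrow> carrier M" "v a s \<in> carrier M" using v[OF a(1)] by auto
    have "x = v a s \<oplus>\<^bsub>M\<^esub> (\<Oplus>\<^bsub>M\<^esub>t\<in>F. v a t)"
      unfolding a(2) using F vc by (rule M.finsum_insert)
    moreover have "v a s \<in> tr (inv\<^bsub>G\<^esub> s) ` A" using a(1) by (auto simp: v_def)
    moreover have "(\<Oplus>\<^bsub>M\<^esub>t\<in>F. v a t) \<in> ts A F" using a(1) unfolding ts by auto
    ultimately show "x \<in> tr (inv\<^bsub>G\<^esub> s) ` A <+>\<^bsub>M\<^esub> ts A F" by (simp add: set_addI)
  next
    fix x assume "x \<in> tr (inv\<^bsub>G\<^esub> s) ` A <+>\<^bsub>M\<^esub> ts A F"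
    then obtain b a where b: "b \<in> A" and a: "a \<in> F \<rightarrow> A"
      and x: "x = tr (inv\<^bsub>G\<^esub> s) b \<oplus>\<^bsub>M\<^esub> (\<Oplus>\<^bsub>M\<^esub>t\<in>F. v a t)"
      unfolding ts set_add_iff by blast
    let ?a = "a(s := b)"
    have aA: "?a \<in> insert s F \<rightarrow> A" using a b by auto
    have vc: "v ?a \<in> F \<rightarrow> carrier M" "v ?a s \<in> carrier M" using v[OF aA] by auto
    have "(\<Oplus>\<^bsub>M\<^esub>t\<in>F. v ?a t) = (\<Oplus>\<^bsub>M\<^esub>t\<in>F. v a t)"
      by (rule M.finsum_cong') (use v[OF a] F in \<open>auto simp: v_def\<close>)
    moreover have "(\<Oplus>\<^bsub>M\<^esub>t\<in>insert s F. v ?a t) = v ?a s \<oplus>\<^bsub>M\<^esub> (\<Oplus>\<^bsub>M\<^esub>t\<in>F. v ?a t)"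
      using F vc by (rule M.finsum_insert)
    ultimately have "x = (\<Oplus>\<^bsub>M\<^esub>t\<in>insert s F. v ?a t)" by (simp add: x v_def)
    then show "x \<in> ts A (insert s F)" using aA unfolding ts by blast
  qed
qed

lemma translate_sum_closed:
  assumes A: "A \<in> zero_finite_subsets M V" and V: "submodule V (group_ring R G) M" and F: "finite F"
  shows "ts A F \<in> zero_finite_subsets M V"
  using F
proof (induction F rule: finite_induct)
  case empty
  then show ?case
    using M.submoduleD(2)[OF V] by (simp add: translate_sum_empty zero_finite_subsets_def)
next
  case (insert s F)
  note AD = zero_finite_subsetsD[OF A] and IH = zero_finite_subsetsD[OF insert.IH]
  have "\<zero>\<^bsub>M\<^esub> \<in> tr (inv\<^bsub>G\<^esub> s) ` A" using AD(2) by (rule zero_in_translate)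
  then have "\<zero>\<^bsub>M\<^esub> \<in> tr (inv\<^bsub>G\<^esub> s) ` A <+>\<^bsub>M\<^esub> ts A F"
    using set_addI[of "\<zero>\<^bsub>M\<^esub>" _ "\<zero>\<^bsub>M\<^esub>" "ts A F" M] IH(2) by simp
  moreover have "tr (inv\<^bsub>G\<^esub> s) ` A <+>\<^bsub>M\<^esub> ts A F \<subseteq> V"
    using IH(3) AD(3) M.submoduleD(3)[OF V] translate_submodule[OF V]
    by (auto simp: set_add_iff subset_iff)
  moreover have "A \<subseteq> carrier M" using AD(3) M.submoduleD(1)[OF V] by blast
  ultimately show ?case
    using IH AD insert.hyps
    by (simp add: translate_sum_insert zero_finite_subsetsI finite_set_add)
qed

lemma translate_sum_carrier: 
  assumes "A \<subseteq> carrier M" "finite F" shows "ts A F \<subseteq> carrier M"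
  using assms(2)
proof (induction F rule: finite_induct)
  case (insert s F)
  then show ?case using translate_image_closed[OF assms(1), of "inv\<^bsub>G\<^esub> s"]
    by (simp add: translate_sum_insert[OF assms(1)] M.set_add_closed)
qed (simp add: translate_sum_empty)

lemma translate_sum_mono:
  assumes A: "A \<subseteq> carrier M" "\<zero>\<^bsub>M\<^esub> \<in> A" and F: "finite F" "E \<subseteq> F"
  shows "ts A E \<subseteq> ts A F"
proof -
  have "ts A E \<subseteq> ts A (E \<union> D)" if "finite D" for D
    using that
  proof (induction D rule: finite_induct)
    case (insert s D)
    show ?case
    proof (cases "s \<in> E")
      case True
      then show ?thesis using insert by (simp add: insert_absorb)
    next
      case False
      have fin: "finite (E \<union> D)" using F insert.hyps finite_subset by auto
      have "ts A (E \<union> D) \<subseteq> tr (inv\<^bsub>G\<^esub> s) ` A <+>\<^bsub>M\<^esub> ts A (E \<union> D)"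
      proof (rule M.subset_set_add(2))
        show "\<zero>\<^bsub>M\<^esub> \<in> tr (inv\<^bsub>G\<^esub> s) ` A" using A(2) by (rule zero_in_translate)
      qed (use A fin translate_image_closed translate_sum_carrier in auto)
      also have "\<dots> = ts A (E \<union> insert s D)"
        using False insert.hyps fin A(1) translate_sum_insert[of A "E \<union> D" s] by simp
      finally show ?thesis using insert.IH by blast
    qed
  qed simp
  from this[of "F - E"] F show ?thesis by (simp add: Un_absorb1)
qed

lemma translate_sum_Un_disjoint:
  assumes A: "A \<subseteq> carrier M" and F: "finite E" "finite F" "E \<inter> F = {}"
  shows "ts A (E \<union> F) = ts A E <+>\<^bsub>M\<^esub> ts A F"
  using F(1,3)
proof (induction E rule: finite_induct)
  case empty
  then show ?case
    using translate_sum_carrier[OF A F(2)] by (simp add: translate_sum_empty M.set_add_zero)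
next
  case (insert s E)
  then have "ts A (insert s E \<union> F) = tr (inv\<^bsub>G\<^esub> s) ` A <+>\<^bsub>M\<^esub> ts A (E \<union> F)"
    using F(2) translate_sum_insert[OF A, of "E \<union> F" s] by simp
  also have "\<dots> = (tr (inv\<^bsub>G\<^esub> s) ` A <+>\<^bsub>M\<^esub> ts A E) <+>\<^bsub>M\<^esub> ts A F"
    using insert F(2) A
    by (subst M.set_add_assoc) (simp_all add: translate_image_closed translate_sum_carrier)
  finally show ?case using insert A by (simp add: translate_sum_insert)
qed

lemma translate_sum_Un:
  assumes A: "A \<subseteq> carrier M" "\<zero>\<^bsub>M\<^esub> \<in> A" and F: "finite E" "finite F"
  shows "ts A (E \<union> F) \<subseteq> ts A E <+>\<^bsub>M\<^esub> ts A F"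
proof -
  have "ts A (E \<union> F) = ts A (E \<union> (F - E))" by simp
  also have "\<dots> = ts A E <+>\<^bsub>M\<^esub> ts A (F - E)"
    using F by (intro translate_sum_Un_disjoint A(1)) auto
  also have "\<dots> \<subseteq> ts A E <+>\<^bsub>M\<^esub> ts A F"
    using F by (intro set_add_mono translate_sum_mono A) auto
  finally show ?thesis .
qed

lemma translate_sum_r_coset:
  assumes A: "A \<subseteq> carrier M" and F: "finite F" "F \<subseteq> carrier G" and c: "c \<in> carrier G"
  shows "ts A (F #>\<^bsub>G\<^esub> c) = tr (inv\<^bsub>G\<^esub> c) ` ts A F"
  using F
proof (induction F rule: finite_induct)
  case empty
  then show ?case by (simp add: r_coset_def translate_sum_empty translate_zero)
next
  case (insert s F)
  have eq: "insert s F #>\<^bsub>G\<^esub> c = insert (s \<otimes>\<^bsub>G\<^esub> c) (F #>\<^bsub>G\<^esub> c)" by (auto simp: r_coset_def)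
  have "s \<otimes>\<^bsub>G\<^esub> c \<notin> F #>\<^bsub>G\<^esub> c" using insert c by (auto simp: r_coset_def subset_iff)
  then have "ts A (insert s F #>\<^bsub>G\<^esub> c) = tr (inv\<^bsub>G\<^esub> (s \<otimes>\<^bsub>G\<^esub> c)) ` A <+>\<^bsub>M\<^esub> ts A (F #>\<^bsub>G\<^esub> c)"
    unfolding eq using insert.hyps by (intro translate_sum_insert A G.finite_r_coset)
  also have "tr (inv\<^bsub>G\<^esub> (s \<otimes>\<^bsub>G\<^esub> c)) ` A = tr (inv\<^bsub>G\<^esub> c) ` tr (inv\<^bsub>G\<^esub> s) ` A"
    using insert.prems c A by (auto simp: G.inv_mult_group translate_mult image_image subset_iff)
  finally show ?case
    using insert A c
    by (simp add: translate_sum_insert translate_set_add translate_image_closed translate_sum_carrier)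
qed

lemma translate_sum_set_add:
  assumes A: "A \<subseteq> carrier M" and B: "B \<subseteq> carrier M" and F: "finite F"
  shows "ts (A <+>\<^bsub>M\<^esub> B) F = ts A F <+>\<^bsub>M\<^esub> ts B F"
  using F
proof (induction F rule: finite_induct)
  case empty
  then show ?case by (simp add: translate_sum_empty M.set_add_zero)
next
  case (insert s F)
  let ?s = "inv\<^bsub>G\<^esub> s"
  have AB: "A <+>\<^bsub>M\<^esub> B \<subseteq> carrier M" using A B by (rule M.set_add_closed)
  note c = translate_image_closed[OF A] translate_image_closed[OF B]
    translate_sum_carrier[OF A insert.hyps(1)] translate_sum_carrier[OF B insert.hyps(1)]
  have "ts (A <+>\<^bsub>M\<^esub> B) (insert s F)
      = (tr ?s ` A <+>\<^bsub>M\<^esub> tr ?s ` B) <+>\<^bsub>M\<^esub> (ts A F <+>\<^bsub>M\<^esub> ts B F)"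
    using insert AB A B by (simp add: translate_sum_insert translate_set_add)
  also have "\<dots> = (tr ?s ` A <+>\<^bsub>M\<^esub> ts A F) <+>\<^bsub>M\<^esub> (tr ?s ` B <+>\<^bsub>M\<^esub> ts B F)"
    using c by (simp add: M.set_add_assoc M.set_add_closed M.set_add_left_commute[of "tr ?s ` B" "ts A F" "ts B F"])
  finally show ?case using insert A B by (simp add: translate_sum_insert)
qed

lemma translate_sum_image:
  assumes N: "group_ring_module R G N" and A: "A \<subseteq> carrier M" and F: "finite F"
    and add: "\<And>x y. x \<in> carrier M \<Longrightarrow> y \<in> carrier M \<Longrightarrow> p (x \<oplus>\<^bsub>M\<^esub> y) = p x \<oplus>\<^bsub>N\<^esub> p y"
    and tr: "\<And>s x. x \<in> carrier M \<Longrightarrow> p (tr s x) = translate R G N s (p x)"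
    and zero: "p \<zero>\<^bsub>M\<^esub> = \<zero>\<^bsub>N\<^esub>" and pM: "p ` carrier M \<subseteq> carrier N"
  shows "p ` ts A F = translate_sum R G N (p ` A) F"
  using F
proof (induction F rule: finite_induct)
  interpret N: group_ring_module R G N by fact
  have pA: "p ` A \<subseteq> carrier N" using A pM by blast
  {
    case empty
    then show ?case by (simp add: translate_sum_empty N.translate_sum_empty zero)
  next
    case (insert s F)
    let ?s = "inv\<^bsub>G\<^esub> s"
    have "p ` ts A (insert s F) = (\<lambda>(a, b). p (a \<oplus>\<^bsub>M\<^esub> b)) ` (tr ?s ` A \<times> ts A F)"
      using insert A by (auto simp: translate_sum_insert set_add_image)
    also have "\<dots> = (\<lambda>(a, b). p a \<oplus>\<^bsub>N\<^esub> p b) ` (tr ?s ` A \<times> ts A F)"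
    proof (intro image_cong refl, clarify)
      fix x b assume "x \<in> A" "b \<in> ts A F"
      then show "p (tr ?s x \<oplus>\<^bsub>M\<^esub> b) = p (tr ?s x) \<oplus>\<^bsub>N\<^esub> p b"
        using A translate_closed translate_sum_carrier[OF A insert.hyps(1)] by (intro add) auto
    qed
    also have "\<dots> = p ` tr ?s ` A <+>\<^bsub>N\<^esub> p ` ts A F" by (simp add: set_add_images)
    also have "p ` tr ?s ` A = translate R G N ?s ` p ` A"
      using A tr by (auto simp: image_image subset_iff)
    finally show ?case using insert pA by (simp add: N.translate_sum_insert)
  }
qed

end

section \<open>The addition theorem for translation invariant valuations\<close>

definition valuation_entropy ::
    "('r, 'a) ring_scheme \<Rightarrow> ('g, 'b) monoid_scheme \<Rightarrow> ('g \<Rightarrow> 'r, 'm) module \<Rightarrow>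
     'm set \<Rightarrow> ('m set \<Rightarrow> real) \<Rightarrow> ennreal" where
  "valuation_entropy R G M V \<phi> =
     (SUP A \<in> zero_finite_subsets M V.
        ennreal (Lim (folner G) (\<lambda>F. \<phi> (translate_sum R G M A F) / real (card F))))"

text \<open>
  The common frame of the three invariants: \<open>\<phi>\<close> is the logarithm of the cardinality, the length of
  the span or the relative rank of the span. The growth rate of \<open>\<phi>\<close> along \<open>A\<^sup>[\<^sup>F\<^sup>]\<close> exists by the
  Ornstein--Weiss lemma, and \<open>valuation_entropy\<close> is the supremum of these rates.
\<close>

locale translation_valuation = group_ring_module R G M
  for R :: "('r, 'a) ring_scheme" and G :: "('g, 'b) monoid_scheme" and M :: "('g \<Rightarrow> 'r, 'm) module" +
  fixes V :: "'m set" and \<phi> :: "'m set \<Rightarrow> real"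
  assumes V: "submodule V (group_ring R G) M"
    and zero: "\<phi> {\<zero>\<^bsub>M\<^esub>} = 0"
    and mono: "\<lbrakk>A \<in> zero_finite_subsets M V; B \<in> zero_finite_subsets M V; A \<subseteq> B\<rbrakk> \<Longrightarrow> \<phi> A \<le> \<phi> B"
    and subadd: "\<lbrakk>A \<in> zero_finite_subsets M V; B \<in> zero_finite_subsets M V\<rbrakk> \<Longrightarrow>
      \<phi> (A <+>\<^bsub>M\<^esub> B) \<le> \<phi> A + \<phi> B"
    and invariant: "\<lbrakk>A \<in> zero_finite_subsets M V; s \<in> carrier G\<rbrakk> \<Longrightarrow>
      \<phi> (translate R G M s ` A) = \<phi> A"
begin

abbreviation "rate A \<equiv> Lim (folner G) (\<lambda>F. \<phi> (ts A F) / real (card F))"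

lemma zfs_carrier: "A \<in> zero_finite_subsets M V \<Longrightarrow> A \<subseteq> carrier M"
  using M.submoduleD(1)[OF V] by (auto simp: zero_finite_subsets_def)

lemma zfs_set_add:
  assumes "A \<in> zero_finite_subsets M V" "B \<in> zero_finite_subsets M V"
  shows "A <+>\<^bsub>M\<^esub> B \<in> zero_finite_subsets M V"
proof (rule zero_finite_subsetsI)
  note D = zero_finite_subsetsD[OF assms(1)] zero_finite_subsetsD[OF assms(2)]
  show "finite (A <+>\<^bsub>M\<^esub> B)" using D by (intro finite_set_add)
  show "\<zero>\<^bsub>M\<^esub> \<in> A <+>\<^bsub>M\<^esub> B" using set_addI[OF D(2) D(5), of M] by simp
  show "A <+>\<^bsub>M\<^esub> B \<subseteq> V" using D M.submoduleD(3)[OF V] by (auto simp: set_add_iff subset_iff)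
qed

lemma valuation_zfs_props:
  assumes A: "A \<in> zero_finite_subsets M V"
  shows "\<phi> (ts A {}) = 0"
    and "E \<subseteq> F \<Longrightarrow> finite F \<Longrightarrow> \<phi> (ts A E) \<le> \<phi> (ts A F)"
    and "finite E \<Longrightarrow> finite F \<Longrightarrow> \<phi> (ts A (E \<union> F)) \<le> \<phi> (ts A E) + \<phi> (ts A F)"
    and "finite F \<Longrightarrow> F \<subseteq> carrier G \<Longrightarrow> c \<in> carrier G \<Longrightarrow> \<phi> (ts A (F #>\<^bsub>G\<^esub> c)) = \<phi> (ts A F)"
proof -
  note AD = zero_finite_subsetsD[OF A] and Ac = zfs_carrier[OF A]
  have ts: "ts A F \<in> zero_finite_subsets M V" if "finite F" for F
    using A V that by (rule translate_sum_closed)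
  show "\<phi> (ts A {}) = 0" by (simp add: translate_sum_empty zero)
  show "\<phi> (ts A E) \<le> \<phi> (ts A F)" if "E \<subseteq> F" "finite F"
    using that finite_subset[OF that] by (intro mono ts translate_sum_mono Ac AD)
  show "\<phi> (ts A (E \<union> F)) \<le> \<phi> (ts A E) + \<phi> (ts A F)" if "finite E" "finite F"
    using mono[OF ts zfs_set_add[OF ts ts] translate_sum_Un[OF Ac AD(2)]]
      subadd[OF ts ts] that by (meson finite_Un order_trans)
  show "\<phi> (ts A (F #>\<^bsub>G\<^esub> c)) = \<phi> (ts A F)" if "finite F" "F \<subseteq> carrier G" "c \<in> carrier G"
    using invariant[OF ts, of F "inv\<^bsub>G\<^esub> c"] that by (simp add: translate_sum_r_coset[OF Ac])
qed

lemma valuation_limit: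
  assumes amen: "amenable G" and A: "A \<in> zero_finite_subsets M V"
  shows "((\<lambda>F. \<phi> (ts A F) / real (card F)) \<longlongrightarrow> rate A) (folner G)" and "0 \<le> rate A"
proof -
  obtain l where l: "l \<ge> 0" "((\<lambda>F. \<phi> (ts A F) / real (card F)) \<longlongrightarrow> l) (folner G)"
    using G.Ornstein_Weiss[OF amen, of "\<lambda>F. \<phi> (ts A F)"] valuation_zfs_props[OF A] by blast
  moreover have "rate A = l"
    using G.folner_nontrivial[OF amen] l(2) by (rule tendsto_Lim)
  ultimately show "((\<lambda>F. \<phi> (ts A F) / real (card F)) \<longlongrightarrow> rate A) (folner G)" "0 \<le> rate A" by auto
qed

lemma valuation_submodule:
  assumes W: "submodule W (group_ring R G) M" "W \<subseteq> V"
  shows "translation_valuation R G M W \<phi>"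
proof -
  have sub: "A \<in> zero_finite_subsets M V" if "A \<in> zero_finite_subsets M W" for A
    using that W(2) by (auto simp: zero_finite_subsets_def)
  show ?thesis
    by (intro translation_valuation.intro translation_valuation_axioms.intro
        group_ring_module_axioms W(1) zero)
      (blast intro: sub mono subadd invariant)+
qed

text \<open>
  The tiles of a quasi-tiling enter one translate at a time: replacing a translate of
  \<open>A\<^sup>[\<^sup>T\<^sup>]\<close> by the corresponding translate of \<open>B\<close> costs \<open>\<gamma>\<close>, whatever else is added.
\<close>

lemma replace_translates:
  assumes A: "A \<in> zero_finite_subsets M V" and B: "B \<in> zero_finite_subsets M V"
    and T: "finite T" "T \<subseteq> carrier G" and C: "finite C" "C \<subseteq> carrier G"
    and cost: "\<And>D. D \<in> zero_finite_subsets M V \<Longrightarrow>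
      \<phi> (ts A T <+>\<^bsub>M\<^esub> D) \<le> \<gamma> + \<phi> (B <+>\<^bsub>M\<^esub> D)"
    and D: "D \<in> zero_finite_subsets M V"
  shows "\<phi> (ts A (\<Union>c\<in>C. T #>\<^bsub>G\<^esub> c) <+>\<^bsub>M\<^esub> D) \<le> real (card C) * \<gamma> + \<phi> (ts B C <+>\<^bsub>M\<^esub> D)"
  using C D
proof (induction C arbitrary: D rule: finite_induct)
  case empty
  then show ?case by (simp add: translate_sum_empty)
next
  case (insert c C)
  let ?U = "\<Union>c\<in>C. T #>\<^bsub>G\<^esub> c" and ?c = "inv\<^bsub>G\<^esub> c"
  note Ac = zfs_carrier[OF A] and Bc = zfs_carrier[OF B] and Dc = zfs_carrier[OF insert.prems(2)]
  have c: "c \<in> carrier G" and CG: "C \<subseteq> carrier G" using insert.prems by auto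
  have finU: "finite ?U" using insert.hyps T by (auto simp: G.finite_r_coset)
  have ts: "ts X F \<in> zero_finite_subsets M V" if "finite F" "X \<in> zero_finite_subsets M V" for F X
    using that V by (intro translate_sum_closed)
  have tr: "tr s ` X \<in> zero_finite_subsets M V" if "X \<in> zero_finite_subsets M V" for X s
    using that translate_submodule[OF V] zero_in_translate by (auto simp: zero_finite_subsets_def)
  note z = ts[OF finU A] ts[OF insert.hyps(1) B] ts[OF T(1) A] tr[OF ts[OF T(1) A]] tr[OF B]
    insert.prems(2)
  note cz = z[THEN zfs_carrier]
  let ?X = "ts A T" and ?Y = "ts B C"
  have shift: "\<phi> (tr ?c ` X <+>\<^bsub>M\<^esub> E) = \<phi> (X <+>\<^bsub>M\<^esub> tr c ` E)"
    if X: "X \<in> zero_finite_subsets M V" and E: "E \<in> zero_finite_subsets M V" for X E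
  proof -
    have "tr ?c ` (X <+>\<^bsub>M\<^esub> tr c ` E) = tr ?c ` X <+>\<^bsub>M\<^esub> tr ?c ` tr c ` E"
      using zfs_carrier[OF X] zfs_carrier[OF tr[OF E]] by (rule translate_set_add)
    also have "tr ?c ` tr c ` E = E"
      using zfs_carrier[OF E] c by (auto simp: image_image translate_inv subset_iff intro!: image_eqI)
    finally show ?thesis using invariant[OF zfs_set_add[OF X tr[OF E]], of ?c c] c by simp
  qed
  have "ts A (\<Union>c\<in>insert c C. T #>\<^bsub>G\<^esub> c) = ts A ((T #>\<^bsub>G\<^esub> c) \<union> ?U)" by simp
  also have "\<dots> \<subseteq> ts A (T #>\<^bsub>G\<^esub> c) <+>\<^bsub>M\<^esub> ts A ?U"
    using T finU by (intro translate_sum_Un Ac zero_finite_subsetsD(2)[OF A] G.finite_r_coset)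
  also have "ts A (T #>\<^bsub>G\<^esub> c) = tr ?c ` ?X" using T c by (intro translate_sum_r_coset Ac)
  finally have "ts A (\<Union>c\<in>insert c C. T #>\<^bsub>G\<^esub> c) <+>\<^bsub>M\<^esub> D
      \<subseteq> (tr ?c ` ?X <+>\<^bsub>M\<^esub> ts A ?U) <+>\<^bsub>M\<^esub> D" by (intro set_add_mono order_refl)
  then have "\<phi> (ts A (\<Union>c\<in>insert c C. T #>\<^bsub>G\<^esub> c) <+>\<^bsub>M\<^esub> D)
      \<le> \<phi> ((tr ?c ` ?X <+>\<^bsub>M\<^esub> ts A ?U) <+>\<^bsub>M\<^esub> D)"
    using insert.hyps T by (intro mono zfs_set_add z ts A) (auto simp: G.finite_r_coset)
  also have "(tr ?c ` ?X <+>\<^bsub>M\<^esub> ts A ?U) <+>\<^bsub>M\<^esub> D = tr ?c ` ?X <+>\<^bsub>M\<^esub> (ts A ?U <+>\<^bsub>M\<^esub> D)"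
    using cz by (intro M.set_add_assoc)
  also have "\<phi> \<dots> = \<phi> (?X <+>\<^bsub>M\<^esub> tr c ` (ts A ?U <+>\<^bsub>M\<^esub> D))"
    by (intro shift z zfs_set_add)
  also have "\<dots> \<le> \<gamma> + \<phi> (B <+>\<^bsub>M\<^esub> tr c ` (ts A ?U <+>\<^bsub>M\<^esub> D))"
    by (intro cost tr z zfs_set_add)
  also have "\<phi> (B <+>\<^bsub>M\<^esub> tr c ` (ts A ?U <+>\<^bsub>M\<^esub> D)) = \<phi> (tr ?c ` B <+>\<^bsub>M\<^esub> (ts A ?U <+>\<^bsub>M\<^esub> D))"
    by (intro shift[symmetric] z zfs_set_add B)
  also have "tr ?c ` B <+>\<^bsub>M\<^esub> (ts A ?U <+>\<^bsub>M\<^esub> D) = ts A ?U <+>\<^bsub>M\<^esub> (tr ?c ` B <+>\<^bsub>M\<^esub> D)"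
    using cz by (intro M.set_add_left_commute)
  also have "\<phi> \<dots> \<le> real (card C) * \<gamma> + \<phi> (?Y <+>\<^bsub>M\<^esub> (tr ?c ` B <+>\<^bsub>M\<^esub> D))"
    by (intro insert.IH zfs_set_add z CG)
  also have "?Y <+>\<^bsub>M\<^esub> (tr ?c ` B <+>\<^bsub>M\<^esub> D) = tr ?c ` B <+>\<^bsub>M\<^esub> (?Y <+>\<^bsub>M\<^esub> D)"
    using cz by (intro M.set_add_left_commute)
  also have "\<dots> = (tr ?c ` B <+>\<^bsub>M\<^esub> ?Y) <+>\<^bsub>M\<^esub> D"
    using cz by (intro M.set_add_assoc[symmetric])
  also have "tr ?c ` B <+>\<^bsub>M\<^esub> ?Y = ts B (insert c C)"
    using Bc insert.hyps by (intro translate_sum_insert[symmetric])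
  finally show ?case using insert.hyps by (simp add: algebra_simps)
qed

text \<open>
  Centres of different tiles may coincide. This does no harm, since the sets \<open>B j\<close> of the several
  tiles are added up.
\<close>

lemma replace_tiles:
  fixes n :: nat
  assumes A: "A \<in> zero_finite_subsets M V" and W: "submodule W (group_ring R G) M" "W \<subseteq> V"
    and T: "\<And>j. j < n \<Longrightarrow> finite (T j) \<and> T j \<subseteq> carrier G"
    and cost: "\<And>j. j < n \<Longrightarrow> \<exists>B \<in> zero_finite_subsets M W. \<forall>D \<in> zero_finite_subsets M V.
      \<phi> (ts A (T j) <+>\<^bsub>M\<^esub> D) \<le> \<gamma> j + \<phi> (B <+>\<^bsub>M\<^esub> D)"
  shows "\<exists>B \<in> zero_finite_subsets M W. \<forall>F C D. finite F \<longrightarrow> F \<subseteq> carrier G \<longrightarrow> (\<forall>j<n. C j \<subseteq> F) \<longrightarrow>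
      D \<in> zero_finite_subsets M V \<longrightarrow>
      \<phi> (ts A (\<Union>j<n. \<Union>c\<in>C j. T j #>\<^bsub>G\<^esub> c) <+>\<^bsub>M\<^esub> D)
        \<le> (\<Sum>j<n. real (card (C j)) * \<gamma> j) + \<phi> (ts B F <+>\<^bsub>M\<^esub> D)"
  using T cost
proof (induction n)
  case 0
  have "ts {\<zero>\<^bsub>M\<^esub>} F = {\<zero>\<^bsub>M\<^esub>}" if "finite F" for F
    using that
    by (induction F rule: finite_induct) (simp_all add: translate_sum_empty translate_sum_insert translate_zero M.set_add_zero)
  then show ?case
    using M.submoduleD(2)[OF W(1)]
    by (intro bexI[of _ "{\<zero>\<^bsub>M\<^esub>}"]) (auto simp: translate_sum_empty zero_finite_subsets_def)
next
  case (Suc n)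
  obtain B where B: "B \<in> zero_finite_subsets M W" and
    le: "\<forall>F C D. finite F \<longrightarrow> F \<subseteq> carrier G \<longrightarrow> (\<forall>j<n. C j \<subseteq> F) \<longrightarrow> D \<in> zero_finite_subsets M V \<longrightarrow>
      \<phi> (ts A (\<Union>j<n. \<Union>c\<in>C j. T j #>\<^bsub>G\<^esub> c) <+>\<^bsub>M\<^esub> D)
        \<le> (\<Sum>j<n. real (card (C j)) * \<gamma> j) + \<phi> (ts B F <+>\<^bsub>M\<^esub> D)"
    by (rule bexE[OF Suc.IH[OF Suc.prems(1)[OF less_SucI] Suc.prems(2)[OF less_SucI]]])
  from Suc.prems(2)[of n] obtain B' where B': "B' \<in> zero_finite_subsets M W" and
    cost: "\<And>D. D \<in> zero_finite_subsets M V \<Longrightarrow>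
      \<phi> (ts A (T n) <+>\<^bsub>M\<^esub> D) \<le> \<gamma> n + \<phi> (B' <+>\<^bsub>M\<^esub> D)" by auto
  have WV: "X \<in> zero_finite_subsets M V" if "X \<in> zero_finite_subsets M W" for X
    using that W(2) by (auto simp: zero_finite_subsets_def)
  interpret W: translation_valuation R G M W \<phi> using W by (rule valuation_submodule)
  show ?case
  proof (intro bexI[of _ "B' <+>\<^bsub>M\<^esub> B"] allI impI)
    show "B' <+>\<^bsub>M\<^esub> B \<in> zero_finite_subsets M W" using B' B by (rule W.zfs_set_add)
    fix F C D
    assume F: "finite F" "F \<subseteq> carrier G" and C: "\<forall>j<Suc n. C j \<subseteq> F" and D: "D \<in> zero_finite_subsets M V"
    let ?U = "\<Union>j<n. \<Union>c\<in>C j. T j #>\<^bsub>G\<^esub> c" and ?V = "\<Union>c\<in>C n. T n #>\<^bsub>G\<^esub> c"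
    have finC: "finite (C j)" if "j < Suc n" for j using C F that finite_subset by blast
    have fin: "finite ?U" "finite ?V" using finC Suc.prems(1) by (auto simp: G.finite_r_coset)
    have ts: "ts X E \<in> zero_finite_subsets M V" if "finite E" "X \<in> zero_finite_subsets M V" for E X
      using that V by (intro translate_sum_closed)
    note z = ts[OF fin(1) A] ts[OF fin(2) A] ts[OF F(1) WV[OF B]] ts[OF F(1) WV[OF B']] D
    note cz = z[THEN zfs_carrier]
    have "(\<Union>j<Suc n. \<Union>c\<in>C j. T j #>\<^bsub>G\<^esub> c) = ?U \<union> ?V" by (auto simp: lessThan_Suc)
    then have "ts A (\<Union>j<Suc n. \<Union>c\<in>C j. T j #>\<^bsub>G\<^esub> c) <+>\<^bsub>M\<^esub> D \<subseteq> (ts A ?U <+>\<^bsub>M\<^esub> ts A ?V) <+>\<^bsub>M\<^esub> D"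
      using translate_sum_Un[OF zfs_carrier[OF A] zero_finite_subsetsD(2)[OF A] fin]
      by (intro set_add_mono) auto
    then have "\<phi> (ts A (\<Union>j<Suc n. \<Union>c\<in>C j. T j #>\<^bsub>G\<^esub> c) <+>\<^bsub>M\<^esub> D)
        \<le> \<phi> ((ts A ?U <+>\<^bsub>M\<^esub> ts A ?V) <+>\<^bsub>M\<^esub> D)"
      using fin \<open>(\<Union>j<Suc n. \<Union>c\<in>C j. T j #>\<^bsub>G\<^esub> c) = ?U \<union> ?V\<close> by (intro mono zfs_set_add z ts A) auto
    also have "(ts A ?U <+>\<^bsub>M\<^esub> ts A ?V) <+>\<^bsub>M\<^esub> D = ts A ?U <+>\<^bsub>M\<^esub> (ts A ?V <+>\<^bsub>M\<^esub> D)"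
      using cz by (intro M.set_add_assoc)
    also have "\<phi> \<dots> \<le> (\<Sum>j<n. real (card (C j)) * \<gamma> j) + \<phi> (ts B F <+>\<^bsub>M\<^esub> (ts A ?V <+>\<^bsub>M\<^esub> D))"
      using C by (intro le[rule_format] F zfs_set_add z) auto
    also have "ts B F <+>\<^bsub>M\<^esub> (ts A ?V <+>\<^bsub>M\<^esub> D) = ts A ?V <+>\<^bsub>M\<^esub> (ts B F <+>\<^bsub>M\<^esub> D)"
      using cz by (intro M.set_add_left_commute)
    also have "\<phi> \<dots> \<le> real (card (C n)) * \<gamma> n + \<phi> (ts B' (C n) <+>\<^bsub>M\<^esub> (ts B F <+>\<^bsub>M\<^esub> D))"
      using Suc.prems(1)[of n] finC[of n] C F
      by (intro replace_translates[OF A WV[OF B']] cost zfs_set_add z) auto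
    also have "\<phi> (ts B' (C n) <+>\<^bsub>M\<^esub> (ts B F <+>\<^bsub>M\<^esub> D)) \<le> \<phi> (ts B' F <+>\<^bsub>M\<^esub> (ts B F <+>\<^bsub>M\<^esub> D))"
      using C F finC[of n]
      by (intro mono zfs_set_add z ts WV[OF B'] set_add_mono order_refl translate_sum_mono
          zfs_carrier[OF WV[OF B']] zero_finite_subsetsD(2)[OF B']) auto
    also have "ts B' F <+>\<^bsub>M\<^esub> (ts B F <+>\<^bsub>M\<^esub> D) = ts (B' <+>\<^bsub>M\<^esub> B) F <+>\<^bsub>M\<^esub> D"
      using cz F zfs_carrier[OF WV[OF B]] zfs_carrier[OF WV[OF B']]
      by (simp add: translate_sum_set_add M.set_add_assoc)
    finally show "\<phi> (ts A (\<Union>j<Suc n. \<Union>c\<in>C j. T j #>\<^bsub>G\<^esub> c) <+>\<^bsub>M\<^esub> D)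
        \<le> (\<Sum>j<Suc n. real (card (C j)) * \<gamma> j) + \<phi> (ts (B' <+>\<^bsub>M\<^esub> B) F <+>\<^bsub>M\<^esub> D)"
      by simp
  qed
qed

end

text \<open>
  The inequality \<open>\<ge>\<close> is \<open>lower\<close>, applied to \<open>A\<^sup>[\<^sup>F\<^sup>]\<close> and \<open>B\<^sup>[\<^sup>F\<^sup>]\<close>. For \<open>\<le>\<close>, fix \<open>A\<close>
  with image \<open>A'\<close>, and choose tiles \<open>T j\<close> for which \<open>\<psi> (A'\<^sup>[\<^sup>T\<^sup>]) / |T|\<close> is close to its limit.
  By \<open>upper\<close>, each \<open>A\<^sup>[\<^sup>T\<^sup>]\<close> is, at the cost of about \<open>\<psi> (A'\<^sup>[\<^sup>T\<^sup>])\<close>, replaced by a finite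
  subset of \<open>W\<close>. Carrying this out for all translates in a quasi-tiling of \<open>F\<close> bounds
  \<open>\<phi> (A\<^sup>[\<^sup>F\<^sup>])\<close> by about \<open>|F|\<close> times the rate of \<open>A'\<close>, plus \<open>\<phi> (B\<^sup>[\<^sup>F\<^sup>])\<close> for one finite
  \<open>B \<subseteq> W\<close>.
\<close>

theorem valuation_entropy_add:
  fixes R :: "('r, 'a) ring_scheme" and G :: "('g, 'b) monoid_scheme"
    and M :: "('g \<Rightarrow> 'r, 'm) module" and N :: "('g \<Rightarrow> 'r, 'n) module"
  assumes amen: "amenable G"
    and \<phi>: "translation_valuation R G M V \<phi>"
    and \<psi>: "translation_valuation R G N V' \<psi>"
    and W: "submodule W (group_ring R G) M" "W \<subseteq> V"
    and p: "\<And>x y. x \<in> carrier M \<Longrightarrow> y \<in> carrier M \<Longrightarrow> p (x \<oplus>\<^bsub>M\<^esub> y) = p x \<oplus>\<^bsub>N\<^esub> p y"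
      "\<And>s x. x \<in> carrier M \<Longrightarrow> p (translate R G M s x) = translate R G N s (p x)"
      "p \<zero>\<^bsub>M\<^esub> = \<zero>\<^bsub>N\<^esub>" "p ` carrier M \<subseteq> carrier N" "p ` V = V'"
    and lower: "\<And>A B. A \<in> zero_finite_subsets M W \<Longrightarrow> B \<in> zero_finite_subsets M V \<Longrightarrow>
      \<phi> A + \<psi> (p ` B) \<le> \<phi> (A <+>\<^bsub>M\<^esub> B)"
    and upper: "\<And>A e. A \<in> zero_finite_subsets M V \<Longrightarrow> e > 0 \<Longrightarrow>
      \<exists>B \<in> zero_finite_subsets M W. \<forall>D \<in> zero_finite_subsets M V.
        \<phi> (A <+>\<^bsub>M\<^esub> D) \<le> \<psi> (p ` A) + e + \<phi> (B <+>\<^bsub>M\<^esub> D)"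
  shows "valuation_entropy R G M V \<phi>
    = valuation_entropy R G M W \<phi> + valuation_entropy R G N V' \<psi>"
proof -
  interpret V: translation_valuation R G M V \<phi> by fact
  interpret V': translation_valuation R G N V' \<psi> by fact
  interpret W: translation_valuation R G M W \<phi> using W by (rule V.valuation_submodule)
  have WV: "A \<in> zero_finite_subsets M V" if "A \<in> zero_finite_subsets M W" for A
    using that W(2) by (auto simp: zero_finite_subsets_def)
  have img: "p ` A \<in> zero_finite_subsets N V'" if "A \<in> zero_finite_subsets M V" for A
    using that p(3,5) by (force simp: zero_finite_subsets_def)
  have pts: "p ` V.ts A F = V'.ts (p ` A) F" if "A \<in> zero_finite_subsets M V" "finite F" for A F
    using V'.group_ring_module_axioms V.zfs_carrier[OF that(1)] that(2) p(1-4)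
    by (rule V.translate_sum_image)
  have nontriv: "folner G \<noteq> bot" using amen by (rule V.G.folner_nontrivial)
  have zW: "{\<zero>\<^bsub>M\<^esub>} \<in> zero_finite_subsets M W" and zV': "{\<zero>\<^bsub>N\<^esub>} \<in> zero_finite_subsets N V'"
    using V.M.submoduleD(2)[OF W(1)] V'.M.submoduleD(2)[OF V'.V] by (auto simp: zero_finite_subsets_def)
  show ?thesis
  proof (rule antisym)
    have "ennreal (W.rate A) + ennreal (V'.rate B') \<le> valuation_entropy R G M V \<phi>"
      if A: "A \<in> zero_finite_subsets M W" and B': "B' \<in> zero_finite_subsets N V'" for A B'
    proof -
      have "B' \<subseteq> p ` V" "finite B'" using zero_finite_subsetsD[OF B'] p(5) by auto
      then obtain B0 where "B0 \<subseteq> V" "finite B0" "B' = p ` B0"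
        using finite_subset_image by metis
      then have B: "insert \<zero>\<^bsub>M\<^esub> B0 \<in> zero_finite_subsets M V" and pB: "p ` insert \<zero>\<^bsub>M\<^esub> B0 = B'"
        using V.M.submoduleD(2)[OF V.V] zero_finite_subsetsD(2)[OF B'] p(3)
        by (auto simp: zero_finite_subsets_def)
      let ?B = "insert \<zero>\<^bsub>M\<^esub> B0"
      note AB = V.zfs_set_add[OF WV[OF A] B]
      have "V.rate A + V'.rate B' \<le> V.rate (A <+>\<^bsub>M\<^esub> ?B)"
      proof (rule tendsto_le[OF nontriv])
        show "((\<lambda>F. \<phi> (V.ts A F) / real (card F) + \<psi> (V'.ts B' F) / real (card F))
            \<longlongrightarrow> V.rate A + V'.rate B') (folner G)"
          by (intro tendsto_add W.valuation_limit(1) V'.valuation_limit(1) amen A B')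
        show "eventually (\<lambda>F. \<phi> (V.ts A F) / real (card F) + \<psi> (V'.ts B' F) / real (card F)
            \<le> \<phi> (V.ts (A <+>\<^bsub>M\<^esub> ?B) F) / real (card F)) (folner G)"
          using V.G.eventually_folner_finite
        proof eventually_elim
          case (elim F)
          have "\<phi> (V.ts A F) + \<psi> (p ` V.ts ?B F) \<le> \<phi> (V.ts A F <+>\<^bsub>M\<^esub> V.ts ?B F)"
            using elim by (intro lower V.translate_sum_closed A B W(1) V.V) auto
          also have "V.ts A F <+>\<^bsub>M\<^esub> V.ts ?B F = V.ts (A <+>\<^bsub>M\<^esub> ?B) F"
            using elim
            by (intro V.translate_sum_set_add[symmetric] W.zfs_carrier A V.zfs_carrier B) auto
          also have "p ` V.ts ?B F = V'.ts B' F" using pts[OF B] pB elim by simp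
          finally show ?case by (simp add: divide_right_mono flip: add_divide_distrib)
        qed
      qed (rule V.valuation_limit(1)[OF amen AB])
      then have "ennreal (W.rate A) + ennreal (V'.rate B') \<le> ennreal (V.rate (A <+>\<^bsub>M\<^esub> ?B))"
        using W.valuation_limit(2)[OF amen A] V'.valuation_limit(2)[OF amen B']
        by (simp add: ennreal_leI flip: ennreal_plus)
      also have "\<dots> \<le> valuation_entropy R G M V \<phi>"
        unfolding valuation_entropy_def by (intro SUP_upper AB)
      finally show ?thesis .
    qed
    then have "ennreal (W.rate A) + valuation_entropy R G N V' \<psi> \<le> valuation_entropy R G M V \<phi>"
      if "A \<in> zero_finite_subsets M W" for A
      unfolding valuation_entropy_def[of R G N] using that zV'
      by (subst ennreal_SUP_add_right) (auto intro: SUP_least)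
    then show "valuation_entropy R G M W \<phi> + valuation_entropy R G N V' \<psi>
        \<le> valuation_entropy R G M V \<phi>"
      unfolding valuation_entropy_def[of R G M W] using zW
      by (subst ennreal_SUP_add_left[symmetric]) (auto intro: SUP_least)
  next
    show "valuation_entropy R G M V \<phi>
        \<le> valuation_entropy R G M W \<phi> + valuation_entropy R G N V' \<psi>"
      unfolding valuation_entropy_def[of R G M V]
    proof (rule SUP_least)
      fix A assume A: "A \<in> zero_finite_subsets M V"
      note A' = img[OF A]
      let ?l = "V'.rate (p ` A)" and ?m = "\<phi> (V.ts A {\<one>\<^bsub>G\<^esub>})"
      have "ennreal (V.rate A) \<le> valuation_entropy R G M W \<phi> + ennreal ?l"
      proof (cases "valuation_entropy R G M W \<phi>")
        case (real H)
        have bound: "V.rate A \<le> (1 + e) * (?l + 2 * e) + H + ?m * e" if e: "0 < e" "e \<le> 1" for e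
        proof -
          have "eventually (\<lambda>F. \<psi> (V'.ts (p ` A) F) / real (card F) < ?l + e) (folner G)"
            using V'.valuation_limit(1)[OF amen A'] e by (intro order_tendstoD(2)) auto
          then have "frequently (\<lambda>F. \<psi> (V'.ts (p ` A) F) / real (card F) < ?l + e) (folner G)"
            using nontriv by (rule eventually_frequently[rotated])
          from V.G.quasi_tiling_exists[OF this e] obtain T n
            where tiles: "\<forall>j<n. \<psi> (V'.ts (p ` A) (T j)) / real (card (T j)) < ?l + e \<and>
                T j \<in> nonempty_finite_subsets (carrier G)"
              and ev: "eventually (\<lambda>F. \<exists>C. V.G.quasi_tiling e T n C F \<and>
                real (card (F - (\<Union>j<n. \<Union>c\<in>C j. T j #>\<^bsub>G\<^esub> c))) \<le> e * real (card F)) (folner G)"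
            by (elim exE conjE)
          have T: "finite (T j)" "T j \<subseteq> carrier G" "card (T j) \<ge> 1"
            "\<psi> (V'.ts (p ` A) (T j)) \<le> (?l + e) * real (card (T j))" if j: "j < n" for j
          proof -
            have *: "finite (T j)" "T j \<noteq> {}" "T j \<subseteq> carrier G"
              "\<psi> (V'.ts (p ` A) (T j)) / real (card (T j)) < ?l + e"
              using tiles j by (auto simp: nonempty_finite_subsets_def)
            then show "finite (T j)" "T j \<subseteq> carrier G" by auto
            have "card (T j) > 0" using * by (simp add: card_gt_0_iff)
            then show "card (T j) \<ge> 1"
              "\<psi> (V'.ts (p ` A) (T j)) \<le> (?l + e) * real (card (T j))"
              using * by (auto simp: field_simps)
          qed
          define \<gamma> where "\<gamma> j = \<psi> (V'.ts (p ` A) (T j)) + e" for j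
          have \<gamma>: "\<gamma> j \<le> (?l + 2 * e) * real (card (T j))" if "j < n" for j
          proof -
            have "e * 1 \<le> e * real (card (T j))" using T(3)[OF that] e by (intro mult_left_mono) auto
            then show ?thesis using T(4)[OF that] by (simp add: \<gamma>_def algebra_simps)
          qed
          have "\<exists>B \<in> zero_finite_subsets M W. \<forall>F C D. finite F \<longrightarrow> F \<subseteq> carrier G \<longrightarrow>
              (\<forall>j<n. C j \<subseteq> F) \<longrightarrow> D \<in> zero_finite_subsets M V \<longrightarrow>
            \<phi> (V.ts A (\<Union>j<n. \<Union>c\<in>C j. T j #>\<^bsub>G\<^esub> c) <+>\<^bsub>M\<^esub> D)
              \<le> (\<Sum>j<n. real (card (C j)) * \<gamma> j) + \<phi> (V.ts B F <+>\<^bsub>M\<^esub> D)"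
          proof (rule V.replace_tiles[OF A W])
            fix j assume j: "j < n"
            then show "finite (T j) \<and> T j \<subseteq> carrier G" using T by simp
            show "\<exists>B \<in> zero_finite_subsets M W. \<forall>D \<in> zero_finite_subsets M V.
              \<phi> (V.ts A (T j) <+>\<^bsub>M\<^esub> D) \<le> \<gamma> j + \<phi> (B <+>\<^bsub>M\<^esub> D)"
              using upper[OF V.translate_sum_closed[OF A V.V T(1)[OF j]] e(1)]
              unfolding \<gamma>_def pts[OF A T(1)[OF j]] .
          qed
          then obtain B where B: "B \<in> zero_finite_subsets M W"
            and cover: "\<forall>F C D. finite F \<longrightarrow> F \<subseteq> carrier G \<longrightarrow>
              (\<forall>j<n. C j \<subseteq> F) \<longrightarrow> D \<in> zero_finite_subsets M V \<longrightarrow>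
            \<phi> (V.ts A (\<Union>j<n. \<Union>c\<in>C j. T j #>\<^bsub>G\<^esub> c) <+>\<^bsub>M\<^esub> D)
              \<le> (\<Sum>j<n. real (card (C j)) * \<gamma> j) + \<phi> (V.ts B F <+>\<^bsub>M\<^esub> D)"
            by (rule bexE)
          have l0: "0 \<le> ?l + 2 * e" using V'.valuation_limit(2)[OF amen A'] e by simp
          have "V.rate A \<le> (1 + e) * (?l + 2 * e) + W.rate B + ?m * e"
          proof (rule tendsto_le[OF nontriv])
            show "((\<lambda>F. (1 + e) * (?l + 2 * e) + \<phi> (V.ts B F) / real (card F) + ?m * e)
                \<longlongrightarrow> (1 + e) * (?l + 2 * e) + W.rate B + ?m * e) (folner G)"
              by (intro tendsto_add tendsto_const W.valuation_limit(1) amen B)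
            show "eventually (\<lambda>F. \<phi> (V.ts A F) / real (card F)
                \<le> (1 + e) * (?l + 2 * e) + \<phi> (V.ts B F) / real (card F) + ?m * e) (folner G)"
              using ev V.G.eventually_folner_finite
            proof eventually_elim
              case (elim F)
              then obtain C where C: "V.G.quasi_tiling e T n C F"
                and left: "real (card (F - (\<Union>j<n. \<Union>c\<in>C j. T j #>\<^bsub>G\<^esub> c))) \<le> e * real (card F)"
                by blast
              let ?U = "\<Union>j<n. \<Union>c\<in>C j. T j #>\<^bsub>G\<^esub> c"
              have F: "finite F" "F \<subseteq> carrier G" "card F > 0" using elim by (auto simp: card_gt_0_iff)
              have CF: "C j \<subseteq> F" "\<And>c. c \<in> C j \<Longrightarrow> T j #>\<^bsub>G\<^esub> c \<subseteq> F" if "j < n" for j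
                using C that by (auto simp: V.G.quasi_tiling_def)
              note qt = V.G.quasi_tilingD[OF C F(1) less_imp_le[OF e(1)]]
              have UF: "?U \<subseteq> F" by (rule qt(1))
              have fin: "finite ?U" "finite (F - ?U)" by (rule finite_subset[OF UF F(1)]) (use F(1) in simp)
              have ts: "V.ts X E \<in> zero_finite_subsets M V"
                if "finite E" "X \<in> zero_finite_subsets M V" for E X
                using that V.V by (intro V.translate_sum_closed)
              have "V.ts A F \<subseteq> V.ts A ?U <+>\<^bsub>M\<^esub> V.ts A (F - ?U)"
                using V.translate_sum_Un[OF V.zfs_carrier[OF A] zero_finite_subsetsD(2)[OF A] fin] UF
                by (simp add: Un_absorb1)
              then have "\<phi> (V.ts A F) \<le> \<phi> (V.ts A ?U <+>\<^bsub>M\<^esub> V.ts A (F - ?U))"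
                using F fin by (intro V.mono V.zfs_set_add ts A)
              also have "\<dots> \<le> (\<Sum>j<n. real (card (C j)) * \<gamma> j)
                  + \<phi> (V.ts B F <+>\<^bsub>M\<^esub> V.ts A (F - ?U))"
                using F fin CF by (intro cover[rule_format] ts A) auto
              also have "\<phi> (V.ts B F <+>\<^bsub>M\<^esub> V.ts A (F - ?U)) \<le> \<phi> (V.ts B F) + \<phi> (V.ts A (F - ?U))"
                using F fin by (intro V.subadd ts A WV B)
              also have "\<phi> (V.ts A (F - ?U)) \<le> ?m * real (card (F - ?U))"
                using F V.valuation_zfs_props[OF A] by (intro V.G.subadditive_le_card) auto
              also have "?m * real (card (F - ?U)) \<le> ?m * (e * real (card F))"
                using left V.valuation_zfs_props(2)[OF A, of "{}" "{\<one>\<^bsub>G\<^esub>}"] V.valuation_zfs_props(1)[OF A]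
                by (intro mult_left_mono) auto
              also have "(\<Sum>j<n. real (card (C j)) * \<gamma> j)
                  \<le> (\<Sum>j<n. (?l + 2 * e) * (real (card (C j)) * real (card (T j))))"
              proof (rule sum_mono)
                fix j assume "j \<in> {..<n}"
                then have "real (card (C j)) * \<gamma> j
                    \<le> real (card (C j)) * ((?l + 2 * e) * real (card (T j)))"
                  by (intro mult_left_mono \<gamma>) auto
                then show "real (card (C j)) * \<gamma> j
                    \<le> (?l + 2 * e) * (real (card (C j)) * real (card (T j)))"
                  by (simp add: mult_ac)
              qed
              also have "\<dots> = (?l + 2 * e) * (\<Sum>j<n. real (card (C j)) * real (card (T j)))"
                by (simp add: sum_distrib_left)
              also have "\<dots> \<le> (?l + 2 * e) * ((1 + e) * real (card F))"
                using qt(2) l0 by (rule mult_left_mono)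
              finally have "\<phi> (V.ts A F) \<le> (?l + 2 * e) * ((1 + e) * real (card F))
                  + (\<phi> (V.ts B F) + ?m * (e * real (card F)))" by simp
              then show ?case using F elim by (simp add: field_simps)
            qed
          qed (rule V.valuation_limit(1)[OF amen A])
          moreover have "W.rate B \<le> H"
          proof -
            have "ennreal (W.rate B) \<le> ennreal H"
              unfolding real(2)[symmetric] valuation_entropy_def by (intro SUP_upper B)
            then show ?thesis using real(1) by simp
          qed
          ultimately show ?thesis by linarith
        qed
        have "V.rate A \<le> ?l + H"
        proof (rule tendsto_lowerbound)
          show "((\<lambda>e. (1 + e) * (?l + 2 * e) + H + ?m * e) \<longlongrightarrow> ?l + H) (at_right 0)"
            by (rule tendsto_eq_intros refl | simp)+
          show "eventually (\<lambda>e. V.rate A \<le> (1 + e) * (?l + 2 * e) + H + ?m * e) (at_right 0)"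
            using bound unfolding eventually_at_right_field by (intro exI[of _ 1]) auto
        qed simp
        then have "ennreal (V.rate A) \<le> ennreal (?l + H)" by (rule ennreal_leI)
        then show ?thesis
          using real V'.valuation_limit(2)[OF amen A'] by (simp add: ennreal_plus add.commute)
      qed simp
      also have "\<dots> \<le> valuation_entropy R G M W \<phi> + valuation_entropy R G N V' \<psi>"
        unfolding valuation_entropy_def[of R G N] by (intro add_left_mono SUP_upper A')
      finally show "ennreal (V.rate A)
          \<le> valuation_entropy R G M W \<phi> + valuation_entropy R G N V' \<psi>" .
    qed
  qed
qed

section \<open>Quotient modules and submodules\<close>

context lmodule
begin

abbreviation "Q H \<equiv> quotient_module M H"
abbreviation "q H \<equiv> coset_rep M H"

lemma coset_rep_diff:
  assumes H: "submodule H R M" and x: "x \<in> carrier M"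
  shows "q H x \<in> carrier M" "q H x \<ominus>\<^bsub>M\<^esub> x \<in> H"
proof -
  note HD = submoduleD[OF H]
  have coset: "H +>\<^bsub>M\<^esub> x = {h \<oplus>\<^bsub>M\<^esub> x | h. h \<in> H}" by (auto simp: a_r_coset_def r_coset_def)
  have "\<zero>\<^bsub>M\<^esub> \<oplus>\<^bsub>M\<^esub> x \<in> H +>\<^bsub>M\<^esub> x" using HD(2) unfolding coset by blast
  then have "q H x \<in> H +>\<^bsub>M\<^esub> x" unfolding coset_rep_def by (rule someI)
  then obtain h where h: "h \<in> H" "q H x = h \<oplus>\<^bsub>M\<^esub> x" unfolding coset by blast
  then have hc: "h \<in> carrier M" using HD(1) by blast
  then show "q H x \<in> carrier M" using h x by simp
  have "q H x \<ominus>\<^bsub>M\<^esub> x = h"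
    using hc x h by (simp add: a_minus_def M.a_assoc M.r_neg)
  then show "q H x \<ominus>\<^bsub>M\<^esub> x \<in> H" using h by simp
qed

lemma coset_rep_eq_iff:
  assumes H: "submodule H R M" and x: "x \<in> carrier M" and y: "y \<in> carrier M"
  shows "q H x = q H y \<longleftrightarrow> x \<ominus>\<^bsub>M\<^esub> y \<in> H"
proof
  note HD = submoduleD[OF H]
  assume eq: "q H x = q H y"
  have "(q H y \<ominus>\<^bsub>M\<^esub> y) \<ominus>\<^bsub>M\<^esub> (q H x \<ominus>\<^bsub>M\<^esub> x) \<in> H"
    by (rule HD(5)[OF coset_rep_diff(2)[OF H y] coset_rep_diff(2)[OF H x]])
  also have "(q H y \<ominus>\<^bsub>M\<^esub> y) \<ominus>\<^bsub>M\<^esub> (q H x \<ominus>\<^bsub>M\<^esub> x) = x \<ominus>\<^bsub>M\<^esub> y"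
    using coset_rep_diff(1)[OF H y] x y unfolding eq
    by (simp add: a_minus_def M.minus_add M.a_ac M.r_neg2 M.r_neg1 M.r_neg)
  finally show "x \<ominus>\<^bsub>M\<^esub> y \<in> H" .
next
  note HD = submoduleD[OF H]
  assume d: "x \<ominus>\<^bsub>M\<^esub> y \<in> H"
  have "H +>\<^bsub>M\<^esub> x = H +>\<^bsub>M\<^esub> y"
  proof -
    have sub: "H +>\<^bsub>M\<^esub> u \<subseteq> H +>\<^bsub>M\<^esub> v" if uv: "u \<ominus>\<^bsub>M\<^esub> v \<in> H" "u \<in> carrier M" "v \<in> carrier M" for u v
    proof
      fix z assume "z \<in> H +>\<^bsub>M\<^esub> u"
      then obtain h where h: "h \<in> H" "z = h \<oplus>\<^bsub>M\<^esub> u" by (auto simp: a_r_coset_def r_coset_def)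
      have hc: "h \<in> carrier M" using h HD(1) by blast
      have "z = (h \<oplus>\<^bsub>M\<^esub> (u \<ominus>\<^bsub>M\<^esub> v)) \<oplus>\<^bsub>M\<^esub> v"
        using h hc uv by (simp add: a_minus_def M.a_assoc M.l_neg)
      moreover have "h \<oplus>\<^bsub>M\<^esub> (u \<ominus>\<^bsub>M\<^esub> v) \<in> H" using h uv by (intro HD(3))
      ultimately show "z \<in> H +>\<^bsub>M\<^esub> v" by (auto simp: a_r_coset_def r_coset_def)
    qed
    have "\<ominus>\<^bsub>M\<^esub> (x \<ominus>\<^bsub>M\<^esub> y) = y \<ominus>\<^bsub>M\<^esub> x" using x y by (simp add: a_minus_def M.minus_add M.a_comm)
    then have "y \<ominus>\<^bsub>M\<^esub> x \<in> H" using HD(4)[OF d] by simp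
    then show ?thesis using sub[OF d x y] sub[OF _ y x] by blast
  qed
  then show "q H x = q H y" by (simp add: coset_rep_def)
qed

lemma quotient_simps:
  assumes H: "submodule H R M"
  shows "carrier (Q H) = q H ` carrier M" "\<zero>\<^bsub>Q H\<^esub> = q H \<zero>\<^bsub>M\<^esub>"
    and "\<And>x y. x \<in> carrier M \<Longrightarrow> y \<in> carrier M \<Longrightarrow> q H x \<oplus>\<^bsub>Q H\<^esub> q H y = q H (x \<oplus>\<^bsub>M\<^esub> y)"
    and "\<And>a x. a \<in> carrier R \<Longrightarrow> x \<in> carrier M \<Longrightarrow> a \<odot>\<^bsub>Q H\<^esub> q H x = q H (a \<odot>\<^bsub>M\<^esub> x)"
proof -
  note HD = submoduleD[OF H] and qd = coset_rep_diff[OF H]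
  show "carrier (Q H) = q H ` carrier M" "\<zero>\<^bsub>Q H\<^esub> = q H \<zero>\<^bsub>M\<^esub>" by (simp_all add: quotient_module_def)
  show "q H x \<oplus>\<^bsub>Q H\<^esub> q H y = q H (x \<oplus>\<^bsub>M\<^esub> y)" if xy: "x \<in> carrier M" "y \<in> carrier M" for x y
  proof -
    have "(q H x \<ominus>\<^bsub>M\<^esub> x) \<oplus>\<^bsub>M\<^esub> (q H y \<ominus>\<^bsub>M\<^esub> y) \<in> H" using qd xy by (intro HD(3))
    also have "(q H x \<ominus>\<^bsub>M\<^esub> x) \<oplus>\<^bsub>M\<^esub> (q H y \<ominus>\<^bsub>M\<^esub> y) = (q H x \<oplus>\<^bsub>M\<^esub> q H y) \<ominus>\<^bsub>M\<^esub> (x \<oplus>\<^bsub>M\<^esub> y)"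
      using qd(1)[OF xy(1)] qd(1)[OF xy(2)] xy by (simp add: a_minus_def M.minus_add M.a_ac)
    finally show ?thesis using xy qd by (simp add: quotient_module_def coset_rep_eq_iff[OF H])
  qed
  show "a \<odot>\<^bsub>Q H\<^esub> q H x = q H (a \<odot>\<^bsub>M\<^esub> x)" if ax: "a \<in> carrier R" "x \<in> carrier M" for a x
  proof -
    have "a \<odot>\<^bsub>M\<^esub> (\<ominus>\<^bsub>M\<^esub> x) = \<ominus>\<^bsub>M\<^esub> (a \<odot>\<^bsub>M\<^esub> x)"
      using smult_r_distr[of a "\<ominus>\<^bsub>M\<^esub> x" x] ax
      by (intro M.minus_equality[symmetric]) (simp_all add: M.l_neg smult_r_null)
    then have "a \<odot>\<^bsub>M\<^esub> (q H x \<ominus>\<^bsub>M\<^esub> x) = a \<odot>\<^bsub>M\<^esub> q H x \<ominus>\<^bsub>M\<^esub> a \<odot>\<^bsub>M\<^esub> x"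
      using ax qd by (simp add: a_minus_def smult_r_distr)
    moreover have "a \<odot>\<^bsub>M\<^esub> (q H x \<ominus>\<^bsub>M\<^esub> x) \<in> H" using ax qd by (intro HD(6))
    ultimately show ?thesis using ax qd by (simp add: quotient_module_def coset_rep_eq_iff[OF H])
  qed
qed

lemma quotient_left_module:
  assumes H: "submodule H R M"
  shows "left_module R (Q H)"
proof -
  note qs = quotient_simps[OF H]
  have "abelian_group (Q H)"
  proof (rule abelian_groupI)
    fix x assume "x \<in> carrier (Q H)"
    then obtain x' where "x' \<in> carrier M" "x = q H x'" unfolding qs by blast
    then show "\<exists>y\<in>carrier (Q H). y \<oplus>\<^bsub>Q H\<^esub> x = \<zero>\<^bsub>Q H\<^esub>"
      by (intro bexI[of _ "q H (\<ominus>\<^bsub>M\<^esub> x')"]) (auto simp: qs M.l_neg)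
  qed (auto simp: qs M.a_ac)
  then show ?thesis
    by (intro left_module.intro left_module_axioms.intro R.ring_axioms)
      (auto simp: qs smult_l_distr smult_r_distr smult_assoc1)
qed

lemma coset_rep_zero_iff:
  assumes "submodule H R M" "x \<in> carrier M"
  shows "q H x = q H \<zero>\<^bsub>M\<^esub> \<longleftrightarrow> x \<in> H"
  using assms coset_rep_eq_iff[of H x "\<zero>\<^bsub>M\<^esub>"] M.minus_equality[of "\<zero>\<^bsub>M\<^esub>" "\<zero>\<^bsub>M\<^esub>"]
  by (simp add: a_minus_def)

lemma coset_rep_hom: "submodule H R M \<Longrightarrow> q H \<in> module_hom R M (Q H)"
  by (auto simp: module_hom_def hom_def quotient_simps)

lemma finsum_submod:
  assumes H: "submodule H R M" and f: "f \<in> F \<rightarrow> H"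
  shows "finsum (submod M H) f F = finsum M f F"
proof (cases "finite F")
  case True
  interpret H: lmodule R "submod M H" using submod_left_module[OF H] by (rule lmodule.intro)
  show ?thesis using True f
  proof (induction F rule: finite_induct)
    case (insert x F)
    then have "f \<in> F \<rightarrow> carrier M" "f x \<in> carrier M" using submoduleD(1)[OF H] by auto
    then show ?case using insert by (simp add: H.M.finsum_insert M.finsum_insert Pi_iff)
  qed (simp add: H.M.finsum_empty)
next
  case False
  then show ?thesis by (simp add: finsum_def finprod_def)
qed

end

lemma coset_rep_submod: "coset_rep (submod M K) H = coset_rep M H"
  by (simp add: coset_rep_def[abs_def] a_r_coset_def r_coset_def)

lemma quotient_submod: "quotient_module (submod M K) H = submod (quotient_module M H) (coset_rep M H ` K)"
  by (simp add: quotient_module_def coset_rep_submod)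

context group_ring_module
begin

lemma translate_sum_submod:
  assumes W: "submodule W (group_ring R G) M" and A: "A \<subseteq> W"
  shows "translate_sum R G (submod M W) A F = ts A F"
proof -
  have eq: "(\<Oplus>\<^bsub>submod M W\<^esub>s\<in>F. tr (inv\<^bsub>G\<^esub> s) (a s)) = (\<Oplus>\<^bsub>M\<^esub>s\<in>F. tr (inv\<^bsub>G\<^esub> s) (a s))" if "a \<in> F \<rightarrow> A" for a
    using that A translate_submodule[OF W] by (intro M.finsum_submod[OF W]) auto
  have "translate_sum R G (submod M W) A F
      = {\<Oplus>\<^bsub>submod M W\<^esub>s\<in>F. tr (inv\<^bsub>G\<^esub> s) (a s) | a. a \<in> F \<rightarrow> A}"
    by (simp add: translate_sum_def translate_def)
  also have "\<dots> = {\<Oplus>\<^bsub>M\<^esub>s\<in>F. tr (inv\<^bsub>G\<^esub> s) (a s) | a. a \<in> F \<rightarrow> A}"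
    unfolding Setcompr_eq_image by (rule image_cong[OF refl eq])
  finally show ?thesis by (simp add: translate_sum_def translate_def)
qed

lemma quotient_group_ring_module:
  assumes W: "submodule W (group_ring R G) M"
  shows "group_ring_module R G (quotient_module M W)"
  by (intro group_ring_module.intro R.ring_axioms G.group_axioms lmodule.intro M.quotient_left_module W)

lemma coset_rep_translate:
  assumes W: "submodule W (group_ring R G) M" and x: "x \<in> carrier M"
  shows "coset_rep M W (tr s x) = translate R G (quotient_module M W) s (coset_rep M W x)"
  using M.quotient_simps(4)[OF W monom_closed x] by (simp add: translate_def)

lemma quotient_submodule_image:
  assumes W: "submodule W (group_ring R G) M" and V: "submodule V (group_ring R G) M"
  shows "submodule (coset_rep M W ` V) (group_ring R G) (quotient_module M W)"
proof -
  interpret Q: group_ring_module R G "quotient_module M W" using W by (rule quotient_group_ring_module)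
  note VD = M.submoduleD[OF V] and qs = M.quotient_simps[OF W]
  show ?thesis
  proof (rule Q.M.submoduleI)
    fix x y assume "x \<in> coset_rep M W ` V" "y \<in> coset_rep M W ` V"
    then show "x \<oplus>\<^bsub>quotient_module M W\<^esub> y \<in> coset_rep M W ` V"
      using VD(1,3) qs(3) by (auto simp: subset_iff)
  next
    fix a x assume "a \<in> carrier (group_ring R G)" "x \<in> coset_rep M W ` V"
    then show "a \<odot>\<^bsub>quotient_module M W\<^esub> x \<in> coset_rep M W ` V"
      using VD(1,6) qs(4) by (auto simp: subset_iff)
  qed (use VD qs in auto)
qed

theorem valuation_entropy_quotient:
  assumes amen: "amenable G"
    and \<phi>: "translation_valuation R G M V \<phi>"
    and \<psi>: "translation_valuation R G (quotient_module M W) (coset_rep M W ` V) \<psi>"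
    and W: "submodule W (group_ring R G) M" "W \<subseteq> V"
    and lower: "\<And>A B. A \<in> zero_finite_subsets M W \<Longrightarrow> B \<in> zero_finite_subsets M V \<Longrightarrow>
      \<phi> A + \<psi> (coset_rep M W ` B) \<le> \<phi> (A <+>\<^bsub>M\<^esub> B)"
    and upper: "\<And>A e. A \<in> zero_finite_subsets M V \<Longrightarrow> e > 0 \<Longrightarrow>
      \<exists>B \<in> zero_finite_subsets M W. \<forall>D \<in> zero_finite_subsets M V.
        \<phi> (A <+>\<^bsub>M\<^esub> D) \<le> \<psi> (coset_rep M W ` A) + e + \<phi> (B <+>\<^bsub>M\<^esub> D)"
  shows "valuation_entropy R G M V \<phi> = valuation_entropy R G M W \<phi>
      + valuation_entropy R G (quotient_module M W) (coset_rep M W ` V) \<psi>"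
  using M.quotient_simps[OF W(1)] coset_rep_translate[OF W(1)]
  by (intro valuation_entropy_add[OF amen \<phi> \<psi> W _ _ _ _ refl lower upper]) auto

end

section \<open>Algebraic entropy\<close>

lemma algebraic_entropy_eq:
  "algebraic_entropy G M = valuation_entropy int_ring G M (carrier M) (\<lambda>A. ln (real (card A)))"
  by (simp add: algebraic_entropy_def valuation_entropy_def)

lemma ln_le_add_ln:
  fixes a b c :: nat
  assumes "a \<le> b * c" "a > 0"
  shows "ln (real a) \<le> ln (real b) + ln (real c)"
proof -
  have "b * c > 0" using assms by linarith
  then have pos: "real b > 0" "real c > 0" by auto
  have "real a \<le> real b * real c" using assms(1) by (simp flip: of_nat_mult)
  then have "ln (real a) \<le> ln (real b * real c)" using assms(2) pos by (subst ln_le_cancel_iff) auto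
  then show ?thesis using pos by (simp add: ln_mult)
qed

lemma add_ln_le_ln:
  fixes a b c :: nat
  assumes "b * c \<le> a" "b > 0" "c > 0"
  shows "ln (real b) + ln (real c) \<le> ln (real a)"
proof -
  have "real b * real c \<le> real a" using assms(1) by (simp flip: of_nat_mult)
  moreover have "a > 0" using assms by (metis less_le_trans nat_0_less_mult_iff)
  ultimately have "ln (real b * real c) \<le> ln (real a)" using assms by (subst ln_le_cancel_iff) auto
  then show ?thesis using assms by (simp add: ln_mult)
qed

lemma card_zero_finite_subset: "A \<in> zero_finite_subsets M V \<Longrightarrow> card A > 0"
  by (auto simp: zero_finite_subsets_def card_gt_0_iff)

context group_ring_module
begin

lemma ln_card_valuation: "translation_valuation R G M (carrier M) (\<lambda>A. ln (real (card A)))"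
proof (intro translation_valuation.intro translation_valuation_axioms.intro group_ring_module_axioms
    M.carrier_submodule)
  fix A B assume A: "A \<in> zero_finite_subsets M (carrier M)" and B: "B \<in> zero_finite_subsets M (carrier M)"
  note AD = zero_finite_subsetsD[OF A] and BD = zero_finite_subsetsD[OF B]
  have pos: "card A > 0" "card B > 0" using A B by (simp_all add: card_zero_finite_subset)
  show "ln (real (card A)) \<le> ln (real (card B))" if "A \<subseteq> B"
    using that pos BD(1) by (simp add: card_mono)
  have "card (A <+>\<^bsub>M\<^esub> B) \<le> card A * card B"
    using card_image_le[of "A \<times> B"] AD BD by (simp add: set_add_image card_cartesian_product)
  moreover have "card (A <+>\<^bsub>M\<^esub> B) > 0"
    using set_addI[OF AD(2) BD(2), of M] finite_set_add[OF AD(1) BD(1), of M] by (auto simp: card_gt_0_iff)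
  ultimately show "ln (real (card (A <+>\<^bsub>M\<^esub> B))) \<le> ln (real (card A)) + ln (real (card B))"
    by (rule ln_le_add_ln)
next
  fix A s assume A: "A \<in> zero_finite_subsets M (carrier M)" and s: "s \<in> carrier G"
  have "inj_on (tr s) A"
    using zero_finite_subsetsD(3)[OF A] translate_inv(2)[OF s]
    by (intro inj_on_inverseI[of _ "tr (inv\<^bsub>G\<^esub> s)"]) blast
  then show "ln (real (card (tr s ` A))) = ln (real (card A))" by (simp add: card_image)
qed simp

text \<open>With representatives \<open>\<sigma> c \<in> B\<close> of the classes of \<open>B\<close>, the sums \<open>a + \<sigma> c\<close> are all distinct.\<close>

lemma ln_card_lower:
  assumes W: "submodule W (group_ring R G) M"
    and A: "A \<in> zero_finite_subsets M W" and B: "B \<in> zero_finite_subsets M (carrier M)"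
  shows "ln (real (card A)) + ln (real (card (coset_rep M W ` B))) \<le> ln (real (card (A <+>\<^bsub>M\<^esub> B)))"
proof -
  let ?q = "coset_rep M W"
  define \<sigma> where "\<sigma> = inv_into B ?q"
  have \<sigma>: "\<sigma> c \<in> B" "?q (\<sigma> c) = c" if "c \<in> ?q ` B" for c
    using that by (simp_all add: \<sigma>_def inv_into_into f_inv_into_f)
  note AD = zero_finite_subsetsD[OF A] and BD = zero_finite_subsetsD[OF B]
  have AM: "A \<subseteq> carrier M" using AD(3) M.submoduleD(1)[OF W] by blast
  have q: "?q (a \<oplus>\<^bsub>M\<^esub> \<sigma> c) = c" if "a \<in> A" "c \<in> ?q ` B" for a c
  proof -
    have c: "a \<in> carrier M" "\<sigma> c \<in> carrier M" using that \<sigma> AM BD by auto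
    have "(a \<oplus>\<^bsub>M\<^esub> \<sigma> c) \<ominus>\<^bsub>M\<^esub> \<sigma> c = a" using c by (simp add: a_minus_def M.M.a_assoc M.M.r_neg)
    then have "?q (a \<oplus>\<^bsub>M\<^esub> \<sigma> c) = ?q (\<sigma> c)" using c that AD by (simp add: M.coset_rep_eq_iff[OF W] subset_iff)
    then show ?thesis using \<sigma> that by simp
  qed
  have inj: "inj_on (\<lambda>(a, c). a \<oplus>\<^bsub>M\<^esub> \<sigma> c) (A \<times> ?q ` B)"
  proof (rule inj_onI, clarsimp)
    fix a b a' b'
    assume *: "a \<in> A" "b \<in> B" "a' \<in> A" "b' \<in> B"
      "a \<oplus>\<^bsub>M\<^esub> \<sigma> (?q b) = a' \<oplus>\<^bsub>M\<^esub> \<sigma> (?q b')"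
    then have eq: "?q b = ?q b'" using q[of a "?q b"] q[of a' "?q b'"] by simp
    have "\<sigma> (?q b') \<in> carrier M" using \<sigma> * BD by blast
    then have "a = a'" using * AM unfolding eq by (simp add: subset_iff)
    with eq show "a = a' \<and> ?q b = ?q b'" by simp
  qed
  have "card A * card (?q ` B) = card (A \<times> ?q ` B)" by (simp add: card_cartesian_product)
  also have "\<dots> \<le> card (A <+>\<^bsub>M\<^esub> B)"
    using AD BD \<sigma> by (intro card_inj_on_le[OF inj] finite_set_add) (auto simp: set_addI)
  finally have le: "card A * card (?q ` B) \<le> card (A <+>\<^bsub>M\<^esub> B)" .
  show ?thesis
    by (rule add_ln_le_ln[OF le card_zero_finite_subset[OF A]]) (use BD in \<open>auto simp: card_gt_0_iff\<close>)
qed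

text \<open>
  With a section \<open>\<sigma>\<close> of \<open>A \<rightarrow> A / W\<close>, the set \<open>A\<close> lies in \<open>\<sigma> (A / W) + B\<close> for the finite
  set \<open>B\<close> of differences \<open>a - \<sigma> a\<close> in \<open>W\<close>.
\<close>

lemma ln_card_upper:
  assumes W: "submodule W (group_ring R G) M" and A: "A \<in> zero_finite_subsets M (carrier M)"
  shows "\<exists>B \<in> zero_finite_subsets M W. \<forall>D \<in> zero_finite_subsets M (carrier M).
    ln (real (card (A <+>\<^bsub>M\<^esub> D)))
      \<le> ln (real (card (coset_rep M W ` A))) + ln (real (card (B <+>\<^bsub>M\<^esub> D)))"
proof -
  let ?q = "coset_rep M W"
  define \<sigma> where "\<sigma> = inv_into A ?q"
  have \<sigma>: "\<sigma> c \<in> A" "?q (\<sigma> c) = c" if "c \<in> ?q ` A" for c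
    using that by (simp_all add: \<sigma>_def inv_into_into f_inv_into_f)
  note AD = zero_finite_subsetsD[OF A] and WD = M.submoduleD[OF W]
  define B where "B = insert \<zero>\<^bsub>M\<^esub> ((\<lambda>a. a \<ominus>\<^bsub>M\<^esub> \<sigma> (?q a)) ` A)"
  have BW: "a \<ominus>\<^bsub>M\<^esub> \<sigma> (?q a) \<in> W" if "a \<in> A" for a
  proof -
    have "a \<in> carrier M" "\<sigma> (?q a) \<in> carrier M" "?q (\<sigma> (?q a)) = ?q a"
      using that \<sigma> AD by (blast, blast, simp)
    then show ?thesis by (metis M.coset_rep_eq_iff[OF W])
  qed
  show ?thesis
  proof (intro bexI[of _ B] ballI)
    show B: "B \<in> zero_finite_subsets M W"
      using AD WD(2) BW by (auto simp: B_def zero_finite_subsets_def)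
    fix D assume D: "D \<in> zero_finite_subsets M (carrier M)"
    note DD = zero_finite_subsetsD[OF D] and BD = zero_finite_subsetsD[OF B]
    have BDM: "B <+>\<^bsub>M\<^esub> D \<subseteq> carrier M" using BD(3) WD(1) DD(3) by (intro M.M.set_add_closed) auto
    have "A <+>\<^bsub>M\<^esub> D \<subseteq> \<sigma> ` ?q ` A <+>\<^bsub>M\<^esub> (B <+>\<^bsub>M\<^esub> D)"
    proof
      fix x assume "x \<in> A <+>\<^bsub>M\<^esub> D"
      then obtain a d where x: "a \<in> A" "d \<in> D" "x = a \<oplus>\<^bsub>M\<^esub> d" by (auto simp: set_add_iff)
      have c: "a \<in> carrier M" "d \<in> carrier M" "\<sigma> (?q a) \<in> carrier M"
        using x AD DD \<sigma> by blast+
      have "x = \<sigma> (?q a) \<oplus>\<^bsub>M\<^esub> ((a \<ominus>\<^bsub>M\<^esub> \<sigma> (?q a)) \<oplus>\<^bsub>M\<^esub> d)"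
        using c by (simp add: x a_minus_def M.M.a_ac M.M.r_neg2 M.M.r_neg)
      moreover have "(a \<ominus>\<^bsub>M\<^esub> \<sigma> (?q a)) \<oplus>\<^bsub>M\<^esub> d \<in> B <+>\<^bsub>M\<^esub> D"
        using x by (intro set_addI) (auto simp: B_def)
      ultimately show "x \<in> \<sigma> ` ?q ` A <+>\<^bsub>M\<^esub> (B <+>\<^bsub>M\<^esub> D)" using x by (auto intro: set_addI)
    qed
    then have "card (A <+>\<^bsub>M\<^esub> D) \<le> card (\<sigma> ` ?q ` A <+>\<^bsub>M\<^esub> (B <+>\<^bsub>M\<^esub> D))"
      using AD DD BD by (intro card_mono finite_set_add) auto
    also have "\<dots> \<le> card (\<sigma> ` ?q ` A) * card (B <+>\<^bsub>M\<^esub> D)"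
      using card_image_le[of "\<sigma> ` ?q ` A \<times> (B <+>\<^bsub>M\<^esub> D)" "\<lambda>(a, b). a \<oplus>\<^bsub>M\<^esub> b"] AD BD DD
      by (simp add: set_add_image[of _ "\<sigma> ` ?q ` A"] card_cartesian_product finite_set_add)
    also have "\<dots> \<le> card (?q ` A) * card (B <+>\<^bsub>M\<^esub> D)"
      using AD by (intro mult_right_mono card_image_le) auto
    finally have le: "card (A <+>\<^bsub>M\<^esub> D) \<le> card (?q ` A) * card (B <+>\<^bsub>M\<^esub> D)" .
    have "card (A <+>\<^bsub>M\<^esub> D) > 0"
      using AD DD set_addI[OF AD(2) DD(2), of M] by (auto simp: card_gt_0_iff finite_set_add)
    with le show "ln (real (card (A <+>\<^bsub>M\<^esub> D)))
        \<le> ln (real (card (?q ` A))) + ln (real (card (B <+>\<^bsub>M\<^esub> D)))"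
      by (rule ln_le_add_ln)
  qed
qed

end

theorem algebraic_entropy_add:
  assumes amen: "amenable G" and G: "group G" and M: "left_module (group_ring int_ring G) M"
    and W: "submodule W (group_ring int_ring G) M"
  shows "algebraic_entropy G M = algebraic_entropy G (submod M W) + algebraic_entropy G (quotient_module M W)"
proof -
  interpret group_ring_module int_ring G M
    using G M by (intro group_ring_module.intro lmodule.intro int.ring_axioms)
  interpret Q: group_ring_module int_ring G "quotient_module M W"
    using W by (rule quotient_group_ring_module)
  let ?\<phi> = "\<lambda>A. ln (real (card A))"
  have Qc: "coset_rep M W ` carrier M = carrier (quotient_module M W)"
    using M.quotient_simps(1)[OF W] by simp
  have "algebraic_entropy G (submod M W) = valuation_entropy int_ring G M W ?\<phi>"
    unfolding algebraic_entropy_eq valuation_entropy_def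
    using translate_sum_submod[OF W]
    by (intro SUP_cong) (auto simp: zero_finite_subsets_def)
  moreover have "valuation_entropy int_ring G M (carrier M) ?\<phi> = valuation_entropy int_ring G M W ?\<phi>
      + valuation_entropy int_ring G (quotient_module M W) (coset_rep M W ` carrier M) ?\<phi>"
  proof (rule valuation_entropy_quotient[OF amen ln_card_valuation _ W M.submoduleD(1)[OF W]])
    show "translation_valuation int_ring G (quotient_module M W) (coset_rep M W ` carrier M) ?\<phi>"
      unfolding Qc by (rule Q.ln_card_valuation)
    fix A and e :: real
    assume A: "A \<in> zero_finite_subsets M (carrier M)" and e: "e > 0"
    show "\<exists>B \<in> zero_finite_subsets M W. \<forall>D \<in> zero_finite_subsets M (carrier M).
        ?\<phi> (A <+>\<^bsub>M\<^esub> D) \<le> ?\<phi> (coset_rep M W ` A) + e + ?\<phi> (B <+>\<^bsub>M\<^esub> D)"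
      using ln_card_upper[OF W A] e by (meson add_increasing2 add_mono less_imp_le order_refl order_trans)
  qed (rule ln_card_lower[OF W])
  ultimately show ?thesis unfolding algebraic_entropy_eq Qc by simp
qed

section \<open>Spans and homomorphisms\<close>

context lmodule
begin

abbreviation "lspan \<equiv> module_span R M"

lemma span_least: "submodule H R M \<Longrightarrow> A \<subseteq> H \<Longrightarrow> lspan A \<subseteq> H"
  unfolding module_span_def by (rule hull_minimal)

lemma span_superset: "A \<subseteq> lspan A"
  unfolding module_span_def by (rule hull_subset)

lemma span_submodule:
  assumes "A \<subseteq> carrier M"
  shows "submodule (lspan A) R M"
proof (rule submoduleI)
  show "lspan A \<subseteq> carrier M" using carrier_submodule assms by (rule span_least)
qed (auto simp: module_span_def hull_def dest: submoduleD)

lemma span_mono: "A \<subseteq> B \<Longrightarrow> lspan A \<subseteq> lspan B"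
  unfolding module_span_def by (rule hull_mono)

lemma span_of_submodule: "submodule H R M \<Longrightarrow> lspan H = H"
  unfolding module_span_def by (rule hull_same)

lemma span_set_add:
  assumes A: "A \<subseteq> carrier M" "\<zero>\<^bsub>M\<^esub> \<in> A" and B: "B \<subseteq> carrier M" "\<zero>\<^bsub>M\<^esub> \<in> B"
  shows "lspan (A <+>\<^bsub>M\<^esub> B) = lspan A <+>\<^bsub>M\<^esub> lspan B"
proof
  note sA = span_submodule[OF A(1)] and sB = span_submodule[OF B(1)]
  have AB: "A <+>\<^bsub>M\<^esub> B \<subseteq> carrier M" using A(1) B(1) by (rule M.set_add_closed)
  note sAB = submoduleD[OF span_submodule[OF AB]]
  show "lspan (A <+>\<^bsub>M\<^esub> B) \<subseteq> lspan A <+>\<^bsub>M\<^esub> lspan B"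
    using sA sB span_superset by (intro span_least set_add_submodule set_add_mono)
  have "lspan A \<subseteq> lspan (A <+>\<^bsub>M\<^esub> B)" "lspan B \<subseteq> lspan (A <+>\<^bsub>M\<^esub> B)"
    using M.subset_set_add(1)[OF A(1) B(1) B(2)] M.subset_set_add(2)[OF A(1) B(1) A(2)]
    by (intro span_mono; simp)+
  then show "lspan A <+>\<^bsub>M\<^esub> lspan B \<subseteq> lspan (A <+>\<^bsub>M\<^esub> B)"
    using sAB(3) by (auto simp: set_add_iff subset_iff)
qed

lemma span_insert_zero:
  assumes "A \<subseteq> carrier M"
  shows "lspan (insert \<zero>\<^bsub>M\<^esub> A) = lspan A"
proof
  show "lspan (insert \<zero>\<^bsub>M\<^esub> A) \<subseteq> lspan A"
    using span_submodule[OF assms] span_superset[of A] submoduleD(2) by (intro span_least) auto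
  show "lspan A \<subseteq> lspan (insert \<zero>\<^bsub>M\<^esub> A)" by (rule span_mono) blast
qed

lemma fg_submoduleI: "finite A \<Longrightarrow> A \<subseteq> carrier M \<Longrightarrow> fg_submodule (lspan A) R M"
  using span_submodule by (auto simp: fg_submodule_def)

lemma fg_submoduleE:
  assumes "fg_submodule H R M"
  obtains A where "A \<in> zero_finite_subsets M H" "H = lspan A"
proof -
  obtain A where A: "finite A" "A \<subseteq> carrier M" "H = lspan A"
    using assms by (auto simp: fg_submodule_def)
  have "insert \<zero>\<^bsub>M\<^esub> A \<in> zero_finite_subsets M H"
    using A span_superset[of A] submoduleD(2)[OF span_submodule[OF A(2)]]
    by (auto simp: zero_finite_subsets_def)
  then show thesis using that A span_insert_zero by blast
qed

lemma fg_submodule_submodule: "fg_submodule H R M \<Longrightarrow> submodule H R M"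
  by (simp add: fg_submodule_def)

lemma fg_set_add:
  assumes H: "fg_submodule H R M" and K: "fg_submodule K R M"
  shows "fg_submodule (H <+>\<^bsub>M\<^esub> K) R M"
proof -
  obtain A where A: "A \<in> zero_finite_subsets M H" "H = lspan A" using H by (rule fg_submoduleE)
  obtain B where B: "B \<in> zero_finite_subsets M K" "K = lspan B" using K by (rule fg_submoduleE)
  have AB: "A \<subseteq> carrier M" "B \<subseteq> carrier M"
    using A B submoduleD(1)[OF fg_submodule_submodule] H K by (auto simp: zero_finite_subsets_def)
  then have "H <+>\<^bsub>M\<^esub> K = lspan (A <+>\<^bsub>M\<^esub> B)"
    using A B by (simp add: span_set_add zero_finite_subsets_def)
  moreover have "fg_submodule (lspan (A <+>\<^bsub>M\<^esub> B)) R M"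
    using A B AB by (intro fg_submoduleI finite_set_add M.set_add_closed) (auto simp: zero_finite_subsets_def)
  ultimately show ?thesis by simp
qed

lemma fg_zero: "fg_submodule {\<zero>\<^bsub>M\<^esub>} R M"
  using fg_submoduleI[of "{\<zero>\<^bsub>M\<^esub>}"] span_of_submodule[OF zero_submodule] by simp

lemma set_add_absorb:
  assumes "submodule H R M" "submodule K R M" "K \<subseteq> H"
  shows "H <+>\<^bsub>M\<^esub> K = H"
proof
  show "H <+>\<^bsub>M\<^esub> K \<subseteq> H" using submoduleD(3)[OF assms(1)] assms(3) by (auto simp: set_add_iff subset_iff)
  show "H \<subseteq> H <+>\<^bsub>M\<^esub> K"
    using submoduleD[OF assms(1)] submoduleD[OF assms(2)] by (intro M.subset_set_add)
qed

lemma span_submod: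
  assumes W: "submodule W R M" and A: "A \<subseteq> W"
  shows "module_span R (submod M W) A = lspan A"
proof
  interpret W: lmodule R "submod M W" using submod_left_module[OF W] by (rule lmodule.intro)
  have AM: "A \<subseteq> carrier M" using A submoduleD(1)[OF W] by blast
  show "module_span R (submod M W) A \<subseteq> lspan A"
    using span_superset span_least[OF W A] span_submodule[OF AM]
    by (intro W.span_least) (auto simp: submodule_submod_iff[OF W])
  have "submodule (module_span R (submod M W) A) R (submod M W)"
    using A by (intro W.span_submodule) simp
  then show "lspan A \<subseteq> module_span R (submod M W) A"
    using W.span_superset by (intro span_least) (auto simp: submodule_submod_iff[OF W])
qed

lemma fg_submodule_submod_iff:
  assumes W: "submodule W R M"
  shows "fg_submodule H R (submod M W) \<longleftrightarrow> fg_submodule H R M \<and> H \<subseteq> W"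
proof -
  have "(\<exists>A. finite A \<and> A \<subseteq> W \<and> H = module_span R (submod M W) A)
      \<longleftrightarrow> (\<exists>A. finite A \<and> A \<subseteq> carrier M \<and> H = lspan A) \<and> H \<subseteq> W"
    using span_submod[OF W] span_least[OF W] span_superset submoduleD(1)[OF W]
    by (metis order_trans)
  then show ?thesis
    unfolding fg_submodule_def submodule_submod_iff[OF W] by auto
qed

end

lemma module_homD:
  assumes M: "left_module R M" and N: "left_module R N" and f: "f \<in> module_hom R M N"
  shows "x \<in> carrier M \<Longrightarrow> f x \<in> carrier N"
    and "x \<in> carrier M \<Longrightarrow> y \<in> carrier M \<Longrightarrow> f (x \<oplus>\<^bsub>M\<^esub> y) = f x \<oplus>\<^bsub>N\<^esub> f y"
    and "a \<in> carrier R \<Longrightarrow> x \<in> carrier M \<Longrightarrow> f (a \<odot>\<^bsub>M\<^esub> x) = a \<odot>\<^bsub>N\<^esub> f x"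
    and "f \<zero>\<^bsub>M\<^esub> = \<zero>\<^bsub>N\<^esub>"
    and "x \<in> carrier M \<Longrightarrow> y \<in> carrier M \<Longrightarrow> f (x \<ominus>\<^bsub>M\<^esub> y) = f x \<ominus>\<^bsub>N\<^esub> f y"
proof -
  interpret M: lmodule R M using M by (rule lmodule.intro)
  interpret N: lmodule R N using N by (rule lmodule.intro)
  show c: "f x \<in> carrier N" if "x \<in> carrier M" for x
    using f that by (auto simp: module_hom_def hom_def)
  show a: "f (x \<oplus>\<^bsub>M\<^esub> y) = f x \<oplus>\<^bsub>N\<^esub> f y" if "x \<in> carrier M" "y \<in> carrier M" for x y
    using f that by (auto simp: module_hom_def hom_def)
  show s: "f (a \<odot>\<^bsub>M\<^esub> x) = a \<odot>\<^bsub>N\<^esub> f x" if "a \<in> carrier R" "x \<in> carrier M" for a x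
    using f that by (auto simp: module_hom_def)
  show "f \<zero>\<^bsub>M\<^esub> = \<zero>\<^bsub>N\<^esub>"
    using s[of "\<zero>\<^bsub>R\<^esub>" "\<zero>\<^bsub>M\<^esub>"] c[of "\<zero>\<^bsub>M\<^esub>"] by (simp add: M.smult_l_null N.smult_l_null)
  show "f (x \<ominus>\<^bsub>M\<^esub> y) = f x \<ominus>\<^bsub>N\<^esub> f y" if "x \<in> carrier M" "y \<in> carrier M"
    using s[of "\<ominus>\<^bsub>R\<^esub> \<one>\<^bsub>R\<^esub>" y] a c that by (simp add: a_minus_def M.smult_minus_one N.smult_minus_one)
qed

lemma module_hom_image_submodule:
  assumes M: "left_module R M" and N: "left_module R N" and f: "f \<in> module_hom R M N"
    and H: "submodule H R M"
  shows "submodule (f ` H) R N"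
proof -
  interpret M: lmodule R M using M by (rule lmodule.intro)
  interpret N: lmodule R N using N by (rule lmodule.intro)
  note HD = M.submoduleD[OF H] and fD = module_homD[OF M N f]
  show ?thesis
  proof (rule N.submoduleI)
    show "f ` H \<subseteq> carrier N" using HD(1) fD(1) by blast
    show "\<zero>\<^bsub>N\<^esub> \<in> f ` H" using HD(2) fD(4) by (metis image_eqI)
    fix x y assume "x \<in> f ` H" "y \<in> f ` H"
    then obtain x' y' where *: "x' \<in> H" "y' \<in> H" "x = f x'" "y = f y'" by blast
    then have "x \<oplus>\<^bsub>N\<^esub> y = f (x' \<oplus>\<^bsub>M\<^esub> y')" using fD(2) HD(1) by (simp add: subset_iff)
    then show "x \<oplus>\<^bsub>N\<^esub> y \<in> f ` H" using HD(3) * by blast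
  next
    fix a x assume a: "a \<in> carrier R" and "x \<in> f ` H"
    then obtain x' where *: "x' \<in> H" "x = f x'" by blast
    then have "a \<odot>\<^bsub>N\<^esub> x = f (a \<odot>\<^bsub>M\<^esub> x')" using a fD(3) HD(1) by (simp add: subset_iff)
    then show "a \<odot>\<^bsub>N\<^esub> x \<in> f ` H" using HD(6) a * by blast
  qed
qed

lemma module_hom_vimage_submodule:
  assumes M: "left_module R M" and N: "left_module R N" and f: "f \<in> module_hom R M N"
    and H: "submodule H R N"
  shows "submodule {x \<in> carrier M. f x \<in> H} R M"
proof -
  interpret M: lmodule R M using M by (rule lmodule.intro)
  interpret N: lmodule R N using N by (rule lmodule.intro)
  show ?thesis
    using module_homD[OF M N f] N.submoduleD[OF H] by (intro M.submoduleI) auto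
qed

lemma module_hom_span:
  assumes M: "left_module R M" and N: "left_module R N" and f: "f \<in> module_hom R M N"
    and A: "A \<subseteq> carrier M"
  shows "f ` module_span R M A = module_span R N (f ` A)"
proof
  interpret M: lmodule R M using M by (rule lmodule.intro)
  interpret N: lmodule R N using N by (rule lmodule.intro)
  have fA: "f ` A \<subseteq> carrier N" using A module_homD(1)[OF M N f] by blast
  have "module_span R M A \<subseteq> {x \<in> carrier M. f x \<in> module_span R N (f ` A)}"
    using N.span_superset[of "f ` A"] A
    by (intro M.span_least module_hom_vimage_submodule[OF M N f] N.span_submodule fA) auto
  then show "f ` module_span R M A \<subseteq> module_span R N (f ` A)" by blast
  show "module_span R N (f ` A) \<subseteq> f ` module_span R M A"
    using M.span_superset
    by (intro N.span_least module_hom_image_submodule[OF M N f] M.span_submodule A image_mono)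
qed

lemma fg_submodule_image:
  assumes M: "left_module R M" and N: "left_module R N" and f: "f \<in> module_hom R M N"
    and H: "fg_submodule H R M"
  shows "fg_submodule (f ` H) R N"
proof -
  interpret N: lmodule R N using N by (rule lmodule.intro)
  obtain A where A: "finite A" "A \<subseteq> carrier M" "H = module_span R M A"
    using H by (auto simp: fg_submodule_def)
  have "f ` A \<subseteq> carrier N" using A module_homD(1)[OF M N f] by blast
  then show ?thesis using N.fg_submoduleI[of "f ` A"] A module_hom_span[OF M N f] by simp
qed

lemma module_hom_restrict:
  assumes f: "f \<in> module_hom R M N" and H: "H \<subseteq> carrier M" and K: "f ` H \<subseteq> K"
  shows "f \<in> module_hom R (submod M H) (submod N K)"
  using assms by (auto simp: module_hom_def hom_def subset_iff Pi_iff image_subset_iff)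

context lmodule
begin

lemma coset_rep_ker:
  assumes W: "submodule W R M" and H: "H \<subseteq> carrier M"
  shows "{x \<in> H. q W x = \<zero>\<^bsub>Q W\<^esub>} = H \<inter> W"
  using coset_rep_zero_iff[OF W] H by (auto simp: quotient_simps(2)[OF W])

lemma coset_rep_add_mem:
  assumes W: "submodule W R M" and x: "x \<in> carrier M" and c: "c \<in> W"
  shows "q W (x \<oplus>\<^bsub>M\<^esub> c) = q W x"
proof -
  have cM: "c \<in> carrier M" using c submoduleD(1)[OF W] by blast
  then have "(x \<oplus>\<^bsub>M\<^esub> c) \<ominus>\<^bsub>M\<^esub> x = c"
    using x by (simp add: a_minus_def M.a_ac M.r_neg1 M.r_neg2 M.r_neg)
  then show ?thesis using x c cM by (simp add: coset_rep_eq_iff[OF W])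
qed

lemma coset_rep_image_set_add:
  assumes W: "submodule W R M" and X: "X \<subseteq> carrier M" and C: "C \<subseteq> W" "\<zero>\<^bsub>M\<^esub> \<in> C"
  shows "q W ` (X <+>\<^bsub>M\<^esub> C) = q W ` X"
proof -
  have *: "q W (x \<oplus>\<^bsub>M\<^esub> c) = q W x" if "x \<in> X" "c \<in> C" for x c
    using that X C by (intro coset_rep_add_mem W) auto
  have "X \<subseteq> X <+>\<^bsub>M\<^esub> C" using X C submoduleD(1)[OF W] by (intro M.subset_set_add(1)) auto
  then have "q W ` X \<subseteq> q W ` (X <+>\<^bsub>M\<^esub> C)" by (rule image_mono)
  moreover have "q W ` (X <+>\<^bsub>M\<^esub> C) \<subseteq> q W ` X" using * by (auto simp: set_add_iff)
  ultimately show ?thesis by blast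
qed

lemma fg_quotient_lift:
  assumes W: "submodule W R M" and H: "fg_submodule H R (Q W)"
  obtains K where "fg_submodule K R M" "q W ` K = H"
proof -
  interpret Q: lmodule R "Q W" using quotient_left_module[OF W] by (rule lmodule.intro)
  obtain A where A: "finite A" "A \<subseteq> q W ` carrier M" "H = Q.lspan A"
    using H quotient_simps(1)[OF W] by (auto simp: fg_submodule_def)
  obtain B where B: "B \<subseteq> carrier M" "finite B" "A = q W ` B"
    using finite_subset_image[OF A(1,2)] by blast
  have "q W ` lspan B = H"
    using module_hom_span[OF left_module_axioms quotient_left_module[OF W] coset_rep_hom[OF W] B(1)]
      A B by simp
  then show thesis using that fg_submoduleI[OF B(2,1)] by blast
qed

end

section \<open>Mean values of submodule ranks\<close>

text \<open>
  Lengths and relative ranks of finitely generated submodules have in common that they are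
  monotone and submodular; this is all that the valuation \<open>A \<mapsto> \<rho> \<langle>A\<rangle>\<close> needs.
\<close>

locale submodule_rank = lmodule R M
  for R :: "('r, 'a) ring_scheme" (structure) and M :: "('r, 'm) module" (structure) +
  fixes \<rho> :: "'m set \<Rightarrow> ennreal"
  assumes rank_finite: "fg_submodule H R M \<Longrightarrow> \<rho> H < top_class.top"
    and rank_zero: "\<rho> {\<zero>\<^bsub>M\<^esub>} = 0"
    and rank_mono: "\<lbrakk>fg_submodule H R M; fg_submodule K R M; H \<subseteq> K\<rbrakk> \<Longrightarrow> \<rho> H \<le> \<rho> K"
    and rank_modular: "\<lbrakk>fg_submodule X R M; fg_submodule Y R M; fg_submodule C R M; Y \<subseteq> X\<rbrakk> \<Longrightarrow>
      \<rho> (X <+>\<^bsub>M\<^esub> C) + \<rho> Y \<le> \<rho> (Y <+>\<^bsub>M\<^esub> C) + \<rho> X"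

lemma enn2real_add:
  assumes "a < top_class.top" "b < top_class.top"
  shows "enn2real (a + b) = enn2real a + enn2real b"
  using assms by (cases a; cases b) (auto simp flip: ennreal_plus)

text \<open>The common form of mean length and mean rank.\<close>

definition mean_value ::
    "('r, 'a) ring_scheme \<Rightarrow> ('g, 'b) monoid_scheme \<Rightarrow> ('m set \<Rightarrow> ennreal) \<Rightarrow>
     'm set \<Rightarrow> ('g \<Rightarrow> 'r, 'm) module \<Rightarrow> ennreal" where
  "mean_value R G \<rho> V M =
     (SUP A \<in> zero_finite_subsets M V.
        Lim (folner G) (\<lambda>F.
          \<rho> (module_span R (restrict_scalars R G M) (translate_sum R G M A F)) / of_nat (card F)))"

lemma restrict_scalars_simps [simp]:
  "carrier (restrict_scalars R G M) = carrier M"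
  "\<zero>\<^bsub>restrict_scalars R G M\<^esub> = \<zero>\<^bsub>M\<^esub>"
  "x \<oplus>\<^bsub>restrict_scalars R G M\<^esub> y = x \<oplus>\<^bsub>M\<^esub> y"
  "A <+>\<^bsub>restrict_scalars R G M\<^esub> B = A <+>\<^bsub>M\<^esub> B"
  "r \<odot>\<^bsub>restrict_scalars R G M\<^esub> x = gr_monom R G r \<one>\<^bsub>G\<^esub> \<odot>\<^bsub>M\<^esub> x"
  by (simp_all add: restrict_scalars_def set_add_image)

lemma restrict_scalars_submod: "restrict_scalars R G (submod M W) = submod (restrict_scalars R G M) W"
  by (simp add: restrict_scalars_def)

lemma coset_rep_restrict_scalars [simp]: "coset_rep (restrict_scalars R G M) W = coset_rep M W"
  by (simp add: coset_rep_def[abs_def] a_r_coset_def r_coset_def)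

lemma restrict_scalars_quotient:
  "restrict_scalars R G (quotient_module M W) = quotient_module (restrict_scalars R G M) W"
  by (simp add: quotient_module_def) (simp add: restrict_scalars_def)

context group_ring_module
begin

abbreviation "Mr \<equiv> restrict_scalars R G M"

lemma monom_one: "gr_monom R G \<one>\<^bsub>R\<^esub> \<one>\<^bsub>G\<^esub> = \<one>\<^bsub>group_ring R G\<^esub>"
  by (simp add: gr_monom_def group_ring_def)

lemma restrict_scalars_left_module: "left_module R Mr"
proof -
  have "abelian_group Mr"
  proof (rule abelian_groupI)
    fix x assume "x \<in> carrier Mr"
    then show "\<exists>y\<in>carrier Mr. y \<oplus>\<^bsub>Mr\<^esub> x = \<zero>\<^bsub>Mr\<^esub>"
      by (intro bexI[of _ "\<ominus>\<^bsub>M\<^esub> x"]) (auto simp: M.M.l_neg)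
  qed (auto simp: M.M.a_ac)
  moreover have "gr_monom R G r \<one>\<^bsub>G\<^esub> \<in> carrier (group_ring R G)" if "r \<in> carrier R" for r
    using that by (rule gr_monom_closed[OF R.ring_axioms])
  ultimately show ?thesis
    using gr_monom_mult[OF R.ring_axioms G.group_axioms] M.smult_assoc1
    by (intro left_module.intro left_module_axioms.intro R.ring_axioms)
      (simp_all add: M.smult_l_distr M.smult_r_distr gr_monom_add[OF R.ring_axioms] monom_one
        flip: M.smult_assoc1)
qed

sublocale Mr: lmodule R Mr
  using restrict_scalars_left_module by (rule lmodule.intro)

lemma restrict_scalars_submodule:
  assumes "submodule W (group_ring R G) M"
  shows "submodule W R Mr"
  using M.submoduleD[OF assms] gr_monom_closed[OF R.ring_axioms, of _ G]
  by (intro Mr.submoduleI) auto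

lemma translate_hom: "s \<in> carrier G \<Longrightarrow> tr s \<in> module_hom R Mr Mr"
proof -
  assume s: "s \<in> carrier G"
  have "tr s (gr_monom R G r \<one>\<^bsub>G\<^esub> \<odot>\<^bsub>M\<^esub> x) = gr_monom R G r \<one>\<^bsub>G\<^esub> \<odot>\<^bsub>M\<^esub> tr s x"
    if r: "r \<in> carrier R" and x: "x \<in> carrier M" for r x
  proof -
    let ?r = "gr_monom R G r \<one>\<^bsub>G\<^esub>" and ?s = "gr_monom R G \<one>\<^bsub>R\<^esub> s"
    have "?s \<otimes>\<^bsub>group_ring R G\<^esub> ?r = ?r \<otimes>\<^bsub>group_ring R G\<^esub> ?s"
      using r s by (simp add: gr_monom_mult[OF R.ring_axioms G.group_axioms])
    moreover have "?r \<in> carrier (group_ring R G)" using r by (rule gr_monom_closed[OF R.ring_axioms])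
    ultimately show ?thesis
      using x monom_closed by (simp add: translate_def flip: M.smult_assoc1)
  qed
  then show ?thesis
    by (auto simp: module_hom_def hom_def translate_closed translate_add)
qed

lemma translate_iso: "s \<in> carrier G \<Longrightarrow> tr s \<in> module_iso R Mr Mr"
  using translate_hom translate_inv translate_closed
  by (auto simp: module_iso_def intro!: bij_betw_byWitness[of _ "tr (inv\<^bsub>G\<^esub> s)"])

lemma span_translate: "s \<in> carrier G \<Longrightarrow> A \<subseteq> carrier M \<Longrightarrow> Mr.lspan (tr s ` A) = tr s ` Mr.lspan A"
  using module_hom_span[OF restrict_scalars_left_module restrict_scalars_left_module translate_hom, of s A]
  by simp

lemma rank_valuation:
  assumes \<rho>: "submodule_rank R Mr \<rho>"
    and inv: "\<And>s H. s \<in> carrier G \<Longrightarrow> fg_submodule H R Mr \<Longrightarrow> \<rho> (tr s ` H) = \<rho> H"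
    and V: "submodule V (group_ring R G) M"
  shows "translation_valuation R G M V (\<lambda>A. enn2real (\<rho> (Mr.lspan A)))"
proof -
  interpret \<rho>: submodule_rank R Mr \<rho> by fact
  have A: "A \<subseteq> carrier M" "\<zero>\<^bsub>M\<^esub> \<in> A" "fg_submodule (Mr.lspan A) R Mr"
    if "A \<in> zero_finite_subsets M V" for A
  proof -
    show "A \<subseteq> carrier M" "\<zero>\<^bsub>M\<^esub> \<in> A"
      using zero_finite_subsetsD[OF that] M.submoduleD(1)[OF V] by auto
    then show "fg_submodule (Mr.lspan A) R Mr"
      using zero_finite_subsetsD(1)[OF that] by (intro Mr.fg_submoduleI) auto
  qed
  show ?thesis
  proof (intro translation_valuation.intro translation_valuation_axioms.intro group_ring_module_axioms V)
    show "enn2real (\<rho> (Mr.lspan {\<zero>\<^bsub>M\<^esub>})) = 0"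
      using \<rho>.rank_zero Mr.span_of_submodule[OF Mr.zero_submodule] by simp
  next
    fix A B assume *: "A \<in> zero_finite_subsets M V" "B \<in> zero_finite_subsets M V"
    show "enn2real (\<rho> (Mr.lspan A)) \<le> enn2real (\<rho> (Mr.lspan B))" if "A \<subseteq> B"
      using A(3)[OF *(1)] A(3)[OF *(2)] that
      by (intro enn2real_mono \<rho>.rank_mono \<rho>.rank_finite Mr.span_mono)
    have lspan: "Mr.lspan (A <+>\<^bsub>M\<^esub> B) = Mr.lspan A <+>\<^bsub>M\<^esub> Mr.lspan B"
      using Mr.span_set_add[of A B] A(1,2) * by simp
    have "\<rho> (Mr.lspan A <+>\<^bsub>M\<^esub> Mr.lspan B) + \<rho> {\<zero>\<^bsub>M\<^esub>}
        \<le> \<rho> ({\<zero>\<^bsub>M\<^esub>} <+>\<^bsub>M\<^esub> Mr.lspan B) + \<rho> (Mr.lspan A)"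
      using \<rho>.rank_modular[OF A(3)[OF *(1)] Mr.fg_zero A(3)[OF *(2)]]
        Mr.submoduleD(2)[OF Mr.fg_submodule_submodule[OF A(3)[OF *(1)]]] by simp
    then have "\<rho> (Mr.lspan A <+>\<^bsub>M\<^esub> Mr.lspan B) \<le> \<rho> (Mr.lspan A) + \<rho> (Mr.lspan B)"
      using \<rho>.rank_zero Mr.submoduleD(1)[OF Mr.fg_submodule_submodule[OF A(3)[OF *(2)]]]
      by (simp add: M.M.set_add_zero add.commute)
    then have "enn2real (\<rho> (Mr.lspan A <+>\<^bsub>M\<^esub> Mr.lspan B)) \<le> enn2real (\<rho> (Mr.lspan A) + \<rho> (Mr.lspan B))"
      using \<rho>.rank_finite A(3) * by (intro enn2real_mono) auto
    then show "enn2real (\<rho> (Mr.lspan (A <+>\<^bsub>M\<^esub> B))) \<le> enn2real (\<rho> (Mr.lspan A)) + enn2real (\<rho> (Mr.lspan B))"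
      using \<rho>.rank_finite A(3) * by (simp add: lspan enn2real_add)
  next
    fix A s assume "A \<in> zero_finite_subsets M V" "s \<in> carrier G"
    then show "enn2real (\<rho> (Mr.lspan (tr s ` A))) = enn2real (\<rho> (Mr.lspan A))"
      using A by (simp add: span_translate inv)
  qed
qed

lemma mean_value_eq:
  assumes amen: "amenable G" and \<rho>: "submodule_rank R Mr \<rho>"
    and inv: "\<And>s H. s \<in> carrier G \<Longrightarrow> fg_submodule H R Mr \<Longrightarrow> \<rho> (tr s ` H) = \<rho> H"
    and V: "submodule V (group_ring R G) M"
  shows "mean_value R G \<rho> V M = valuation_entropy R G M V (\<lambda>A. enn2real (\<rho> (Mr.lspan A)))"
  unfolding mean_value_def valuation_entropy_def
proof (rule SUP_cong[OF refl])
  interpret \<rho>: submodule_rank R Mr \<rho> by fact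
  interpret v: translation_valuation R G M V "\<lambda>A. enn2real (\<rho> (Mr.lspan A))"
    using \<rho> inv V by (rule rank_valuation)
  fix A assume A: "A \<in> zero_finite_subsets M V"
  have "((\<lambda>F. ennreal (enn2real (\<rho> (Mr.lspan (ts A F))) / real (card F))) \<longlongrightarrow> ennreal (v.rate A)) (folner G)"
    by (intro tendsto_ennrealI v.valuation_limit(1) amen A)
  moreover have "eventually (\<lambda>F. ennreal (enn2real (\<rho> (Mr.lspan (ts A F))) / real (card F))
      = \<rho> (Mr.lspan (ts A F)) / of_nat (card F)) (folner G)"
    using G.eventually_folner_finite
  proof eventually_elim
    case (elim F)
    have "ts A F \<in> zero_finite_subsets M V" using elim A V by (intro translate_sum_closed) auto
    then have "\<rho> (Mr.lspan (ts A F)) < top_class.top"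
      using v.zfs_carrier
      by (intro \<rho>.rank_finite Mr.fg_submoduleI) (auto simp: zero_finite_subsets_def)
    moreover have "real (card F) > 0" using elim by (simp add: card_gt_0_iff)
    ultimately show ?case
      by (simp flip: divide_ennreal add: ennreal_of_nat_eq_real_of_nat)
  qed
  ultimately have "((\<lambda>F. \<rho> (Mr.lspan (ts A F)) / of_nat (card F)) \<longlongrightarrow> ennreal (v.rate A)) (folner G)"
    by (rule Lim_transform_eventually)
  then show "Lim (folner G) (\<lambda>F. \<rho> (Mr.lspan (ts A F)) / of_nat (card F)) = ennreal (v.rate A)"
    using G.folner_nontrivial[OF amen] by (intro tendsto_Lim)
qed

text \<open>
  As \<open>upper\<close> compares \<open>\<rho>\<close> on \<open>X + Y\<close> and on \<open>Y\<close>, submodularity gives the same comparison after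
  an arbitrary \<open>C\<close> has been added to both.
\<close>

theorem mean_value_add:
  assumes amen: "amenable G" and V: "submodule V (group_ring R G) M"
    and W: "submodule W (group_ring R G) M" "W \<subseteq> V"
    and \<rho>: "submodule_rank R Mr \<rho>"
    and inv: "\<And>s H. s \<in> carrier G \<Longrightarrow> fg_submodule H R Mr \<Longrightarrow> \<rho> (tr s ` H) = \<rho> H"
    and \<sigma>: "submodule_rank R (quotient_module Mr W) \<sigma>"
    and \<sigma>_inv: "\<And>s H. s \<in> carrier G \<Longrightarrow> fg_submodule H R (quotient_module Mr W) \<Longrightarrow>
      \<sigma> (translate R G (quotient_module M W) s ` H) = \<sigma> H"
    and lower: "\<And>X Y. fg_submodule X R Mr \<Longrightarrow> fg_submodule Y R Mr \<Longrightarrow> X \<subseteq> W \<Longrightarrow>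
      \<rho> X + \<sigma> (coset_rep M W ` Y) \<le> \<rho> (X <+>\<^bsub>M\<^esub> Y)"
    and upper: "\<And>X e. fg_submodule X R Mr \<Longrightarrow> e > 0 \<Longrightarrow> \<exists>Y. fg_submodule Y R Mr \<and> Y \<subseteq> W \<and>
      \<rho> (X <+>\<^bsub>M\<^esub> Y) \<le> \<rho> Y + \<sigma> (coset_rep M W ` X) + ennreal e"
  shows "mean_value R G \<rho> V M = mean_value R G \<rho> W M
    + mean_value R G \<sigma> (coset_rep M W ` V) (quotient_module M W)"
proof -
  interpret Q: group_ring_module R G "quotient_module M W"
    using W(1) by (rule quotient_group_ring_module)
  let ?q = "coset_rep M W"
  have Qr: "Q.Mr = quotient_module Mr W" by (rule restrict_scalars_quotient)
  note WR = restrict_scalars_submodule[OF W(1)]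
  have q: "?q \<in> module_hom R Mr Q.Mr" using Mr.coset_rep_hom[OF WR] unfolding Qr by simp
  interpret \<rho>: submodule_rank R Mr \<rho> by fact
  interpret \<sigma>: submodule_rank R Q.Mr \<sigma> using \<sigma> unfolding Qr .
  have qV: "submodule (?q ` V) (group_ring R G) (quotient_module M W)"
    using W(1) V by (rule quotient_submodule_image)
  note \<sigma>' = \<sigma>.submodule_rank_axioms and \<sigma>_inv' = \<sigma>_inv[folded Qr]
  let ?\<phi> = "\<lambda>A. enn2real (\<rho> (Mr.lspan A))" and ?\<psi> = "\<lambda>A. enn2real (\<sigma> (Q.Mr.lspan A))"
  interpret v: translation_valuation R G M V ?\<phi> using \<rho> inv V by (rule rank_valuation)
  have span_q: "Q.Mr.lspan (?q ` A) = ?q ` Mr.lspan A" if "A \<subseteq> carrier M" for A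
    using module_hom_span[OF restrict_scalars_left_module Q.restrict_scalars_left_module q, of A] that by simp
  have fg: "fg_submodule (Mr.lspan A) R Mr" if "A \<in> zero_finite_subsets M V" for A
    using that v.zfs_carrier[OF that] by (intro Mr.fg_submoduleI) (auto simp: zero_finite_subsets_def)
  have fgq: "fg_submodule (?q ` H) R Q.Mr" if "fg_submodule H R Mr" for H
    using restrict_scalars_left_module Q.restrict_scalars_left_module q that by (rule fg_submodule_image)
  have WV: "A \<in> zero_finite_subsets M V" if "A \<in> zero_finite_subsets M W" for A
    using that W(2) by (auto simp: zero_finite_subsets_def)
  have span_add: "Mr.lspan (A <+>\<^bsub>M\<^esub> B) = Mr.lspan A <+>\<^bsub>M\<^esub> Mr.lspan B"
    if "A \<in> zero_finite_subsets M V" "B \<in> zero_finite_subsets M V" for A B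
    using Mr.span_set_add[of A B] v.zfs_carrier that
      zero_finite_subsetsD(2)[OF that(1)] zero_finite_subsetsD(2)[OF that(2)] by simp
  have "valuation_entropy R G M V ?\<phi> = valuation_entropy R G M W ?\<phi>
      + valuation_entropy R G (quotient_module M W) (?q ` V) ?\<psi>"
  proof (rule valuation_entropy_quotient[OF amen v.translation_valuation_axioms _ W])
    show "translation_valuation R G (quotient_module M W) (?q ` V) ?\<psi>"
      using \<sigma>' \<sigma>_inv' qV by (rule Q.rank_valuation)
  next
    fix A B assume A: "A \<in> zero_finite_subsets M W" and B: "B \<in> zero_finite_subsets M V"
    have AW: "Mr.lspan A \<subseteq> W" using WR zero_finite_subsetsD(3)[OF A] by (rule Mr.span_least)
    have "\<rho> (Mr.lspan A) + \<sigma> (?q ` Mr.lspan B) \<le> \<rho> (Mr.lspan A <+>\<^bsub>M\<^esub> Mr.lspan B)"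
      using fg[OF WV[OF A]] fg[OF B] AW by (rule lower)
    then have "enn2real (\<rho> (Mr.lspan A) + \<sigma> (?q ` Mr.lspan B)) \<le> enn2real (\<rho> (Mr.lspan A <+>\<^bsub>M\<^esub> Mr.lspan B))"
      using Mr.fg_set_add[OF fg[OF WV[OF A]] fg[OF B]] by (intro enn2real_mono \<rho>.rank_finite) auto
    then show "?\<phi> A + ?\<psi> (?q ` B) \<le> ?\<phi> (A <+>\<^bsub>M\<^esub> B)"
      using \<rho>.rank_finite[OF fg[OF WV[OF A]]] \<sigma>.rank_finite[OF fgq[OF fg[OF B]]]
      by (simp add: span_q[OF v.zfs_carrier[OF B]] span_add[OF WV[OF A] B] enn2real_add)
  next
    fix A and e :: real assume A: "A \<in> zero_finite_subsets M V" and e: "e > 0"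
    let ?X = "Mr.lspan A"
    obtain Y where Y: "fg_submodule Y R Mr" "Y \<subseteq> W"
      and le: "\<rho> (?X <+>\<^bsub>M\<^esub> Y) \<le> \<rho> Y + \<sigma> (?q ` ?X) + ennreal e"
      using upper[OF fg[OF A] e] by blast
    obtain B where B: "B \<in> zero_finite_subsets Mr Y" "Y = Mr.lspan B" using Y(1) by (rule Mr.fg_submoduleE)
    have BW: "B \<in> zero_finite_subsets M W" using B(1) Y(2) by (auto simp: zero_finite_subsets_def)
    show "\<exists>B \<in> zero_finite_subsets M W. \<forall>D \<in> zero_finite_subsets M V.
        ?\<phi> (A <+>\<^bsub>M\<^esub> D) \<le> ?\<psi> (?q ` A) + e + ?\<phi> (B <+>\<^bsub>M\<^esub> D)"
    proof (intro bexI[OF _ BW] ballI)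
      fix D assume D: "D \<in> zero_finite_subsets M V"
      let ?C = "Mr.lspan D"
      note X = fg[OF A] and C = fg[OF D]
      note Xs = Mr.submoduleD[OF Mr.fg_submodule_submodule[OF X]]
        and Ys = Mr.submoduleD[OF Mr.fg_submodule_submodule[OF Y(1)]]
        and Cs = Mr.submoduleD[OF Mr.fg_submodule_submodule[OF C]]
      have XY: "fg_submodule (?X <+>\<^bsub>M\<^esub> Y) R Mr" using Mr.fg_set_add[OF X Y(1)] by simp
      have YC: "fg_submodule (Y <+>\<^bsub>M\<^esub> ?C) R Mr" using Mr.fg_set_add[OF Y(1) C] by simp
      have XC: "fg_submodule (?X <+>\<^bsub>M\<^esub> ?C) R Mr" using Mr.fg_set_add[OF X C] by simp
      have XYC: "fg_submodule (?X <+>\<^bsub>M\<^esub> Y <+>\<^bsub>M\<^esub> ?C) R Mr" using Mr.fg_set_add[OF XY C] by simp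
      have YXY: "Y \<subseteq> ?X <+>\<^bsub>M\<^esub> Y" using Xs(1,2) Ys(1) by (intro M.M.subset_set_add(2)) auto
      have "?X \<subseteq> ?X <+>\<^bsub>M\<^esub> Y" using Xs(1) Ys(1,2) by (intro M.M.subset_set_add(1)) auto
      then have "\<rho> (?X <+>\<^bsub>M\<^esub> ?C) \<le> \<rho> (?X <+>\<^bsub>M\<^esub> Y <+>\<^bsub>M\<^esub> ?C)"
        by (intro \<rho>.rank_mono XC XYC set_add_mono order_refl)
      then have "\<rho> (?X <+>\<^bsub>M\<^esub> ?C) + \<rho> Y \<le> \<rho> (?X <+>\<^bsub>M\<^esub> Y <+>\<^bsub>M\<^esub> ?C) + \<rho> Y" by (rule add_right_mono)
      also have "\<dots> \<le> \<rho> (Y <+>\<^bsub>M\<^esub> ?C) + \<rho> (?X <+>\<^bsub>M\<^esub> Y)"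
        using \<rho>.rank_modular[OF XY Y(1) C YXY] by simp
      also have "\<dots> \<le> \<rho> (Y <+>\<^bsub>M\<^esub> ?C) + (\<rho> Y + \<sigma> (?q ` ?X) + ennreal e)"
        using le by (rule add_left_mono)
      finally have "enn2real (\<rho> (?X <+>\<^bsub>M\<^esub> ?C) + \<rho> Y)
          \<le> enn2real (\<rho> (Y <+>\<^bsub>M\<^esub> ?C) + (\<rho> Y + \<sigma> (?q ` ?X) + ennreal e))"
        using \<rho>.rank_finite[OF Y(1)] \<rho>.rank_finite[OF YC] \<sigma>.rank_finite[OF fgq[OF X]]
        by (intro enn2real_mono) auto
      then have "enn2real (\<rho> (?X <+>\<^bsub>M\<^esub> ?C)) \<le> enn2real (\<sigma> (?q ` ?X)) + e + enn2real (\<rho> (Y <+>\<^bsub>M\<^esub> ?C))"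
        using \<rho>.rank_finite[OF Y(1)] \<rho>.rank_finite[OF YC] \<rho>.rank_finite[OF XC]
          \<sigma>.rank_finite[OF fgq[OF X]] e
        by (simp add: enn2real_add)
      then show "?\<phi> (A <+>\<^bsub>M\<^esub> D) \<le> ?\<psi> (?q ` A) + e + ?\<phi> (B <+>\<^bsub>M\<^esub> D)"
        using span_add[OF A D] span_add[OF WV[OF BW] D] span_q[OF v.zfs_carrier[OF A]] B(2) by simp
    qed
  qed
  then show ?thesis
    using mean_value_eq[OF amen \<rho> inv V] mean_value_eq[OF amen \<rho> inv W(1)]
      Q.mean_value_eq[OF amen \<sigma>' \<sigma>_inv' qV] by simp
qed

end

section \<open>Length functions\<close>

context length_function
begin

lemma length_image:
  assumes M: "left_module R M" and N: "left_module R N" and f: "f \<in> module_hom R M N"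
    and H: "submodule H R M"
  shows "L (submod M H) = L (submod M {x \<in> H. f x = \<zero>\<^bsub>N\<^esub>}) + L (submod N (f ` H))"
proof -
  interpret M: lmodule R M using M by (rule lmodule.intro)
  interpret N: lmodule R N using N by (rule lmodule.intro)
  have K: "submodule {x \<in> H. f x = \<zero>\<^bsub>N\<^esub>} R M"
    using M.Int_submodule[OF H module_hom_vimage_submodule[OF M N f N.zero_submodule]]
      M.submoduleD(1)[OF H] by (auto elim!: back_subst[of "\<lambda>X. submodule X R M"])
  have "short_exact R (submod M {x \<in> H. f x = \<zero>\<^bsub>N\<^esub>}) (\<lambda>x. x) (submod M H) f (submod N (f ` H))"
    unfolding short_exact_def
  proof (intro conjI)
    show "left_module R (submod M {x \<in> H. f x = \<zero>\<^bsub>N\<^esub>})" "left_module R (submod M H)"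
      "left_module R (submod N (f ` H))"
      by (intro M.submod_left_module N.submod_left_module K H module_hom_image_submodule[OF M N f])+
    show "f \<in> module_hom R (submod M H) (submod N (f ` H))"
      using f M.submoduleD(1)[OF H] order_refl by (rule module_hom_restrict)
    show "(\<lambda>x. x) \<in> module_hom R (submod M {x \<in> H. f x = \<zero>\<^bsub>N\<^esub>}) (submod M H)"
      by (auto simp: module_hom_def hom_def)
    show "(\<lambda>x. x) ` carrier (submod M {x \<in> H. f x = \<zero>\<^bsub>N\<^esub>}) = a_kernel (submod M H) (submod N (f ` H)) f"
      by (auto simp: a_kernel_def kernel_def)
  qed auto
  then show ?thesis by (rule length_additive)
qed

lemma length_quotient:
  assumes M: "left_module R M" and W: "submodule W R M" and H: "submodule H R M"
  shows "L (submod M H) = L (submod M (H \<inter> W)) + L (submod (quotient_module M W) (coset_rep M W ` H))"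
proof -
  interpret M: lmodule R M using M by (rule lmodule.intro)
  show ?thesis
    using length_image[OF M M.quotient_left_module[OF W] M.coset_rep_hom[OF W] H]
      M.coset_rep_ker[OF W M.submoduleD(1)[OF H]] by simp
qed

lemma length_mono:
  assumes M: "left_module R M" and X: "submodule X R M" and Y: "submodule Y R M" "X \<subseteq> Y"
  shows "L (submod M X) \<le> L (submod M Y)"
  using length_quotient[OF M X Y(1)] Y(2) by (simp add: Int_absorb1)

text \<open>
  For \<open>Y \<subseteq> X\<close> the quotient \<open>(X + C) / (Y + C)\<close> is the image of \<open>X\<close> under a map that vanishes on
  \<open>Y\<close>, which yields submodularity.
\<close>

lemma length_submodule_rank:
  assumes M: "left_module R M" and fin: "locally_length_finite R L M"
  shows "submodule_rank R M (\<lambda>H. L (submod M H))"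
proof -
  interpret M: lmodule R M using M by (rule lmodule.intro)
  show ?thesis
  proof (intro submodule_rank.intro submodule_rank_axioms.intro M.lmodule_axioms)
    fix H assume "fg_submodule H R M"
    then show "L (submod M H) < top_class.top" using fin by (simp add: locally_length_finite_def)
  next
    show "L (submod M {\<zero>\<^bsub>M\<^esub>}) = 0"
      using M.submod_left_module[OF M.zero_submodule] by (rule length_zero) simp
  next
    fix H K assume "fg_submodule H R M" "fg_submodule K R M" "H \<subseteq> K"
    then show "L (submod M H) \<le> L (submod M K)"
      by (intro length_mono M M.fg_submodule_submodule)
  next
    fix X Y C
    assume fg: "fg_submodule X R M" "fg_submodule Y R M" "fg_submodule C R M" and YX: "Y \<subseteq> X"
    note X = M.fg_submodule_submodule[OF fg(1)] and Y = M.fg_submodule_submodule[OF fg(2)]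
      and C = M.fg_submodule_submodule[OF fg(3)]
    let ?W = "Y <+>\<^bsub>M\<^esub> C"
    have W: "submodule ?W R M" using Y C by (rule M.set_add_submodule)
    have XC: "submodule (X <+>\<^bsub>M\<^esub> C) R M" using X C by (rule M.set_add_submodule)
    let ?l = "L (submod (quotient_module M ?W) (coset_rep M ?W ` X))"
    have "Y \<subseteq> ?W" "C \<subseteq> ?W"
      using M.submoduleD[OF Y] M.submoduleD[OF C] M.M.subset_set_add by auto
    then have "coset_rep M ?W ` (X <+>\<^bsub>M\<^esub> C) = coset_rep M ?W ` X"
      using M.submoduleD[OF X] M.submoduleD[OF C] by (intro M.coset_rep_image_set_add W) auto
    moreover have "(X <+>\<^bsub>M\<^esub> C) \<inter> ?W = ?W" using set_add_mono[OF YX order_refl] by blast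
    ultimately have 1: "L (submod M (X <+>\<^bsub>M\<^esub> C)) = L (submod M ?W) + ?l"
      using length_quotient[OF M W XC] by simp
    have "L (submod M Y) \<le> L (submod M (X \<inter> ?W))"
      using YX \<open>Y \<subseteq> ?W\<close> by (intro length_mono M Y M.Int_submodule X W) auto
    then have "?l + L (submod M Y) \<le> L (submod M X)"
      unfolding length_quotient[OF M W X] by (subst add.commute) (rule add_right_mono)
    then show "L (submod M (X <+>\<^bsub>M\<^esub> C)) + L (submod M Y) \<le> L (submod M ?W) + L (submod M X)"
      unfolding 1 add.assoc by (rule add_left_mono)
  qed
qed

lemma locally_length_finite_quotient:
  assumes M: "left_module R M" and fin: "locally_length_finite R L M" and W: "submodule W R M"
  shows "locally_length_finite R L (quotient_module M W)"
  unfolding locally_length_finite_def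
proof (intro allI impI)
  interpret M: lmodule R M using M by (rule lmodule.intro)
  fix H assume "fg_submodule H R (quotient_module M W)"
  then obtain K where K: "fg_submodule K R M" "coset_rep M W ` K = H" by (rule M.fg_quotient_lift[OF W])
  then have "L (submod (quotient_module M W) H) \<le> L (submod M K)"
    using length_quotient[OF M W M.fg_submodule_submodule[OF K(1)]] by simp
  also have "\<dots> < \<infinity>" using fin K(1) by (simp add: locally_length_finite_def)
  finally show "L (submod (quotient_module M W) H) < \<infinity>" .
qed

text \<open>
  By continuity \<open>X \<inter> W\<close> has a finitely generated submodule \<open>Y\<close> of almost the same length.
\<close>

lemma length_upper:
  assumes M: "left_module R M" and fin: "locally_length_finite R L M" and W: "submodule W R M"
    and X: "fg_submodule X R M" and e: "e > 0"
  shows "\<exists>Y. fg_submodule Y R M \<and> Y \<subseteq> W \<and> L (submod M (X <+>\<^bsub>M\<^esub> Y))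
    \<le> L (submod M Y) + L (submod (quotient_module M W) (coset_rep M W ` X)) + ennreal e"
proof -
  interpret M: lmodule R M using M by (rule lmodule.intro)
  note X' = M.fg_submodule_submodule[OF X]
  let ?K = "X \<inter> W"
  have K: "submodule ?K R M" using X' W by (rule M.Int_submodule)
  have "L (submod M ?K) \<le> L (submod M X)" using M K X' by (rule length_mono) simp
  then have Kfin: "L (submod M ?K) \<noteq> \<infinity>" using fin X by (auto simp: locally_length_finite_def)
  have "L (submod M ?K) = (SUP H \<in> {H. fg_submodule H R (submod M ?K)}. L (submod M H))"
    using length_continuous[OF M.submod_left_module[OF K]] by simp
  from SUP_approx_ennreal[OF e _ this] Kfin
  obtain Y where Y: "fg_submodule Y R (submod M ?K)" "L (submod M ?K) < L (submod M Y) + ennreal e"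
    using M.fg_zero M.submoduleD(2)[OF K] by (auto simp: M.fg_submodule_submod_iff[OF K])
  then have fgY: "fg_submodule Y R M" and YK: "Y \<subseteq> ?K" by (simp_all add: M.fg_submodule_submod_iff[OF K])
  have "X <+>\<^bsub>M\<^esub> Y = X" using YK by (intro M.set_add_absorb X' M.fg_submodule_submodule fgY) auto
  moreover have "L (submod M X) \<le> L (submod M Y) + ennreal e
      + L (submod (quotient_module M W) (coset_rep M W ` X))"
    unfolding length_quotient[OF M W X'] using Y(2) by (intro add_right_mono less_imp_le)
  ultimately show ?thesis using fgY YK by (intro exI[of _ Y]) (auto simp: add_ac)
qed

theorem mean_length_add:
  assumes amen: "amenable G" and G: "group G" and M: "left_module (group_ring R G) M"
    and W: "submodule W (group_ring R G) M"
    and fin: "locally_length_finite R L (restrict_scalars R G M)"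
  shows "mean_length R G L M = mean_length R G L (submod M W) + mean_length R G L (quotient_module M W)"
proof -
  interpret group_ring_module R G M
    using G M by (intro group_ring_module.intro lmodule.intro ring_axioms)
  interpret Q: group_ring_module R G "quotient_module M W" using W by (rule quotient_group_ring_module)
  note Mr = restrict_scalars_left_module and WR = restrict_scalars_submodule[OF W]
  have Qr: "Q.Mr = quotient_module Mr W" by (rule restrict_scalars_quotient)
  let ?\<rho> = "\<lambda>H. L (submod Mr H)" and ?\<sigma> = "\<lambda>H. L (submod (quotient_module Mr W) H)"
  have iso_invariant: "L (submod N (f ` H)) = L (submod N H)"
    if N: "left_module R N" and f: "f \<in> module_iso R N N" and H: "submodule H R N" for N f H
  proof -
    interpret N: lmodule R N using N by (rule lmodule.intro)
    have hom: "f \<in> module_hom R N N" and inj: "inj_on f (carrier N)"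
      using f by (auto simp: module_iso_def bij_betw_def)
    have "{x \<in> H. f x = \<zero>\<^bsub>N\<^esub>} = {\<zero>\<^bsub>N\<^esub>}"
      using N.submoduleD(1,2)[OF H] module_homD(4)[OF N N hom] inj_onD[OF inj, of _ "\<zero>\<^bsub>N\<^esub>"]
      by (auto simp: subset_iff)
    then show ?thesis
      using length_image[OF N N hom H] length_zero[OF N.submod_left_module[OF N.zero_submodule]] by simp
  qed
  have "mean_length R G L M = mean_value R G ?\<rho> (carrier M) M"
    by (simp add: mean_length_def mean_value_def)
  also have "\<dots> = mean_value R G ?\<rho> W M + mean_value R G ?\<sigma> (coset_rep M W ` carrier M) (quotient_module M W)"
  proof (rule mean_value_add[OF amen M.carrier_submodule W M.submoduleD(1)[OF W]])
    show "submodule_rank R Mr ?\<rho>" using Mr fin by (rule length_submodule_rank)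
    show "submodule_rank R (quotient_module Mr W) ?\<sigma>"
      by (intro length_submodule_rank Mr.quotient_left_module WR locally_length_finite_quotient Mr fin)
    show "?\<rho> (tr s ` H) = ?\<rho> H" if "s \<in> carrier G" "fg_submodule H R Mr" for s H
      using Mr translate_iso[OF that(1)] Mr.fg_submodule_submodule[OF that(2)] by (rule iso_invariant)
    show "?\<sigma> (Q.tr s ` H) = ?\<sigma> H" if "s \<in> carrier G" "fg_submodule H R (quotient_module Mr W)" for s H
      using Q.restrict_scalars_left_module Q.translate_iso[OF that(1)]
        Q.Mr.fg_submodule_submodule[OF that(2)[folded Qr]]
      unfolding Qr by (rule iso_invariant)
  next
    fix X Y assume fg: "fg_submodule X R Mr" "fg_submodule Y R Mr" and XW: "X \<subseteq> W"
    note X = Mr.fg_submodule_submodule[OF fg(1)] and Y = Mr.fg_submodule_submodule[OF fg(2)]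
    have XY: "submodule (X <+>\<^bsub>M\<^esub> Y) R Mr" using Mr.set_add_submodule[OF X Y] by simp
    have "X <+>\<^bsub>M\<^esub> Y = Y <+>\<^bsub>M\<^esub> X"
      using Mr.submoduleD(1)[OF X] Mr.submoduleD(1)[OF Y] by (intro M.M.set_add_commute) auto
    then have "coset_rep M W ` (X <+>\<^bsub>M\<^esub> Y) = coset_rep M W ` Y"
      using Mr.coset_rep_image_set_add[OF WR Mr.submoduleD(1)[OF Y] XW Mr.submoduleD(2)[OF X]] by simp
    moreover have "X \<subseteq> X <+>\<^bsub>M\<^esub> Y"
      using Mr.submoduleD(1)[OF X] Mr.submoduleD(1,2)[OF Y] by (intro M.M.subset_set_add(1)) auto
    then have "?\<rho> X \<le> ?\<rho> ((X <+>\<^bsub>M\<^esub> Y) \<inter> W)"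
      using XW by (intro length_mono Mr X Mr.Int_submodule XY WR) auto
    ultimately show "?\<rho> X + ?\<sigma> (coset_rep M W ` Y) \<le> ?\<rho> (X <+>\<^bsub>M\<^esub> Y)"
      using length_quotient[OF Mr WR XY] by (simp add: add_right_mono)
  next
    fix X and e :: real assume "fg_submodule X R Mr" "e > 0"
    then show "\<exists>Y. fg_submodule Y R Mr \<and> Y \<subseteq> W \<and>
        ?\<rho> (X <+>\<^bsub>M\<^esub> Y) \<le> ?\<rho> Y + ?\<sigma> (coset_rep M W ` X) + ennreal e"
      using length_upper[OF Mr fin WR, of X e] by simp
  qed
  also have "mean_value R G ?\<rho> W M = mean_length R G L (submod M W)"
    unfolding mean_length_def mean_value_def restrict_scalars_submod
  proof (intro SUP_cong)
    fix A assume "A \<in> zero_finite_subsets (submod M W) (carrier (submod M W))"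
    then have A: "A \<in> zero_finite_subsets M W" by (simp add: zero_finite_subsets_def)
    have "module_span R (submod Mr W) (translate_sum R G (submod M W) A F) = Mr.lspan (ts A F)" if "finite F" for F
      using translate_sum_submod[OF W zero_finite_subsetsD(3)[OF A]]
        zero_finite_subsetsD(3)[OF translate_sum_closed[OF A W that]]
      by (simp add: Mr.span_submod[OF WR])
    then have eq: "eventually (\<lambda>F. L (submod Mr (Mr.lspan (ts A F))) / of_nat (card F)
        = L (submod Mr (module_span R (submod Mr W) (translate_sum R G (submod M W) A F))) / of_nat (card F))
      (folner G)"
      by (intro eventually_mono[OF G.eventually_folner_finite]) simp
    show "Lim (folner G) (\<lambda>F. L (submod Mr (Mr.lspan (ts A F))) / of_nat (card F))
      = Lim (folner G) (\<lambda>F. L (submod Mr W\<lparr>carrier :=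
          module_span R (submod Mr W) (translate_sum R G (submod M W) A F)\<rparr>) / of_nat (card F))"
      unfolding Topological_Spaces.Lim_def using tendsto_cong[OF eq] by simp
  qed (simp add: zero_finite_subsets_def)
  also have "mean_value R G ?\<sigma> (coset_rep M W ` carrier M) (quotient_module M W)
      = mean_length R G L (quotient_module M W)"
    by (simp add: mean_length_def mean_value_def restrict_scalars_quotient M.quotient_simps(1)[OF W])
  finally show ?thesis .
qed

end

section \<open>Transport, direct sums and the first isomorphism theorem\<close>

text \<open>Transport of structure carries modules of any type into the type on which a rank is defined.\<close>

definition transport_module :: "('m \<Rightarrow> 'u) \<Rightarrow> ('r, 'm) module \<Rightarrow> ('r, 'u) module" where
  "transport_module f M = (let g = inv_into (carrier M) f in
     \<lparr>carrier = f ` carrier M, mult = undefined, one = undefined, zero = f \<zero>\<^bsub>M\<^esub>,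
      add = (\<lambda>x y. f (g x \<oplus>\<^bsub>M\<^esub> g y)), smult = (\<lambda>a x. f (a \<odot>\<^bsub>M\<^esub> g x))\<rparr>)"

lemma transport_module:
  assumes M: "left_module R M" and f: "inj_on f (carrier M)"
  shows "left_module R (transport_module f M)" "f \<in> module_iso R M (transport_module f M)"
proof -
  interpret M: lmodule R M using M by (rule lmodule.intro)
  let ?T = "transport_module f M"
  have s: "carrier ?T = f ` carrier M" "\<zero>\<^bsub>?T\<^esub> = f \<zero>\<^bsub>M\<^esub>"
    "\<And>x y. x \<in> carrier M \<Longrightarrow> y \<in> carrier M \<Longrightarrow> f x \<oplus>\<^bsub>?T\<^esub> f y = f (x \<oplus>\<^bsub>M\<^esub> y)"
    "\<And>a x. x \<in> carrier M \<Longrightarrow> a \<odot>\<^bsub>?T\<^esub> f x = f (a \<odot>\<^bsub>M\<^esub> x)"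
    using f by (simp_all add: transport_module_def Let_def)
  have "abelian_group ?T"
  proof (rule abelian_groupI)
    fix x assume "x \<in> carrier ?T"
    then obtain y where "y \<in> carrier M" "x = f y" by (auto simp: s)
    then show "\<exists>y\<in>carrier ?T. y \<oplus>\<^bsub>?T\<^esub> x = \<zero>\<^bsub>?T\<^esub>"
      by (intro bexI[of _ "f (\<ominus>\<^bsub>M\<^esub> y)"]) (auto simp: s M.M.l_neg)
  qed (auto simp: s M.M.a_ac)
  then show "left_module R ?T"
    by (intro left_module.intro left_module_axioms.intro M.R.ring_axioms)
      (auto simp: s M.smult_l_distr M.smult_r_distr M.smult_assoc1)
  show "f \<in> module_iso R M ?T"
    using f by (auto simp: module_iso_def module_hom_def hom_def bij_betw_def s)
qed

lemma regular_left_module: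
  assumes "ring R" shows "left_module R (regular_module R)"
proof -
  interpret ring R by fact
  have "abelian_group (regular_module R)"
  proof (rule abelian_groupI)
    fix x assume "x \<in> carrier (regular_module R)"
    then show "\<exists>y\<in>carrier (regular_module R). y \<oplus>\<^bsub>regular_module R\<^esub> x = \<zero>\<^bsub>regular_module R\<^esub>"
      by (intro bexI[of _ "\<ominus>\<^bsub>R\<^esub> x"]) (auto simp: regular_module_def l_neg)
  qed (auto simp: regular_module_def a_ac)
  then show ?thesis
    by (intro left_module.intro left_module_axioms.intro ring_axioms)
      (auto simp: regular_module_def l_distr r_distr m_assoc)
qed

lemma direct_sum_simps:
  "carrier (direct_sum_module M N) = carrier M \<times> carrier N"
  "\<zero>\<^bsub>direct_sum_module M N\<^esub> = (\<zero>\<^bsub>M\<^esub>, \<zero>\<^bsub>N\<^esub>)"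
  "(x, y) \<oplus>\<^bsub>direct_sum_module M N\<^esub> (x', y') = (x \<oplus>\<^bsub>M\<^esub> x', y \<oplus>\<^bsub>N\<^esub> y')"
  "a \<odot>\<^bsub>direct_sum_module M N\<^esub> (x, y) = (a \<odot>\<^bsub>M\<^esub> x, a \<odot>\<^bsub>N\<^esub> y)"
  by (simp_all add: direct_sum_module_def)

lemma direct_sum_left_module:
  assumes M: "left_module R M" and N: "left_module R N"
  shows "left_module R (direct_sum_module M N)"
proof -
  interpret M: lmodule R M using M by (rule lmodule.intro)
  interpret N: lmodule R N using N by (rule lmodule.intro)
  have "abelian_group (direct_sum_module M N)"
  proof (rule abelian_groupI)
    fix x assume "x \<in> carrier (direct_sum_module M N)"
    then show "\<exists>y\<in>carrier (direct_sum_module M N).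
        y \<oplus>\<^bsub>direct_sum_module M N\<^esub> x = \<zero>\<^bsub>direct_sum_module M N\<^esub>"
      by (intro bexI[of _ "(\<ominus>\<^bsub>M\<^esub> fst x, \<ominus>\<^bsub>N\<^esub> snd x)"])
        (auto simp: direct_sum_simps M.M.l_neg N.M.l_neg)
  qed (auto simp: direct_sum_simps M.M.a_ac N.M.a_ac)
  then show ?thesis
    by (intro left_module.intro left_module_axioms.intro M.R.ring_axioms)
      (auto simp: direct_sum_simps M.smult_l_distr N.smult_l_distr M.smult_r_distr N.smult_r_distr
        M.smult_assoc1 N.smult_assoc1)
qed

lemma module_hom_comp:
  assumes "f \<in> module_hom R M N" "g \<in> module_hom R N P"
  shows "(\<lambda>x. g (f x)) \<in> module_hom R M P"
  using assms by (auto simp: module_hom_def hom_def Pi_iff)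

lemma module_iso_inverse:
  assumes M: "left_module R M" and N: "left_module R N" and f: "f \<in> module_iso R M N"
  shows "inv_into (carrier M) f \<in> module_hom R N M"
proof -
  interpret M: lmodule R M using M by (rule lmodule.intro)
  have hom: "f \<in> module_hom R M N" and bij: "bij_betw f (carrier M) (carrier N)"
    using f by (auto simp: module_iso_def)
  let ?g = "inv_into (carrier M) f"
  have g: "?g y \<in> carrier M" "f (?g y) = y" if "y \<in> carrier N" for y
    using bij that by (auto simp: bij_betw_def inv_into_into f_inv_into_f)
  have gf: "?g (f x) = x" if "x \<in> carrier M" for x using bij that by (simp add: bij_betw_inv_into_left)
  have "?g (x \<oplus>\<^bsub>N\<^esub> y) = ?g x \<oplus>\<^bsub>M\<^esub> ?g y" if "x \<in> carrier N" "y \<in> carrier N" for x y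
    using gf[of "?g x \<oplus>\<^bsub>M\<^esub> ?g y"] module_homD(2)[OF M N hom, of "?g x" "?g y"] g that by simp
  moreover have "?g (a \<odot>\<^bsub>N\<^esub> x) = a \<odot>\<^bsub>M\<^esub> ?g x" if "a \<in> carrier R" "x \<in> carrier N" for a x
    using gf[of "a \<odot>\<^bsub>M\<^esub> ?g x"] module_homD(3)[OF M N hom, of a "?g x"] g that by simp
  ultimately show ?thesis using g by (auto simp: module_hom_def hom_def)
qed

lemma (in abelian_group) minus_eq_zero_iff:
  assumes "x \<in> carrier G" "y \<in> carrier G"
  shows "x \<ominus> y = \<zero> \<longleftrightarrow> x = y"
proof
  assume "x \<ominus> y = \<zero>"
  moreover have "(x \<ominus> y) \<oplus> y = x" using assms by (simp add: a_minus_def a_assoc l_neg)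
  ultimately show "x = y" using assms by simp
qed (use assms in \<open>simp add: a_minus_def r_neg\<close>)

text \<open>
  As the quotient consists of representatives, a surjection is itself, without any change, an
  isomorphism from the quotient by its kernel.
\<close>

lemma first_isomorphism:
  assumes M: "left_module R M" and N: "left_module R N" and f: "f \<in> module_hom R M N"
    and surj: "f ` carrier M = carrier N" and W: "W = {x \<in> carrier M. f x = \<zero>\<^bsub>N\<^esub>}"
  shows "submodule W R M" "f \<in> module_iso R (quotient_module M W) N"
proof -
  interpret M: lmodule R M using M by (rule lmodule.intro)
  interpret N: lmodule R N using N by (rule lmodule.intro)
  note fD = module_homD[OF M N f]
  show Ws: "submodule W R M"
    using module_hom_vimage_submodule[OF M N f N.zero_submodule] by (simp add: W)
  note qs = M.quotient_simps[OF Ws] and qd = M.coset_rep_diff[OF Ws]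
  have diff: "f x = f y \<longleftrightarrow> x \<ominus>\<^bsub>M\<^esub> y \<in> W" if "x \<in> carrier M" "y \<in> carrier M" for x y
    using that fD(1,5) N.M.minus_eq_zero_iff[of "f x" "f y"] M.M.minus_closed by (simp add: W)
  have fq: "f (coset_rep M W x) = f x" if "x \<in> carrier M" for x
    using qd[OF that] that by (simp add: diff)
  have "inj_on f (carrier (quotient_module M W))"
  proof (rule inj_onI)
    fix u v assume "u \<in> carrier (quotient_module M W)" "v \<in> carrier (quotient_module M W)" and eq: "f u = f v"
    then obtain x y where xy: "x \<in> carrier M" "y \<in> carrier M" "u = coset_rep M W x" "v = coset_rep M W y"
      by (auto simp: qs)
    then have "f x = f y" using eq fq by simp
    then show "u = v" using xy by (simp add: diff M.coset_rep_eq_iff[OF Ws])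
  qed
  moreover have "f ` carrier (quotient_module M W) = carrier N"
    using fq surj by (force simp: qs image_image)
  moreover have "f \<in> module_hom R (quotient_module M W) N"
    using fD by (auto simp: module_hom_def hom_def qs fq)
  ultimately show "f \<in> module_iso R (quotient_module M W) N"
    by (simp add: module_iso_def bij_betw_def)
qed

section \<open>Bivariant Sylvester rank functions\<close>

text \<open>
  The universe has to contain a copy of \<open>R\<close>, against which cyclic modules are compared, and has to
  be infinite, so that direct sums of two modules have a copy in it.
\<close>

locale universal_rank = bivariant_sylvester_rank R rk
  for R :: "('r, 'a) ring_scheme" (structure) and rk :: "'u set \<Rightarrow> ('r, 'u) module \<Rightarrow> ennreal" +
  assumes infinite_universe: "infinite (UNIV :: 'u set)"
    and ring_embeds: "\<exists>\<iota> :: 'r \<Rightarrow> 'u. inj_on \<iota> (carrier R)"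
begin

abbreviation "rdim M \<equiv> rk (carrier M) M"
abbreviation "rcodim W M \<equiv> rdim (quotient_module M W)"

lemma dim_iso:
  assumes "left_module R M" "left_module R N" "f \<in> module_iso R M N"
  shows "rdim N = rdim M"
proof -
  interpret M: lmodule R M using assms(1) by (rule lmodule.intro)
  have "f ` carrier M = carrier N" using assms(3) by (auto simp: module_iso_def bij_betw_def)
  then show ?thesis using rk_iso[OF assms(1,2) M.carrier_submodule assms(3)] by simp
qed

lemma dim_surj:
  assumes M: "left_module R M" and N: "left_module R N" and f: "f \<in> module_hom R M N"
    and surj: "f ` carrier M = carrier N"
  shows "rdim N = rcodim {x \<in> carrier M. f x = \<zero>\<^bsub>N\<^esub>} M"
proof -
  interpret M: lmodule R M using M by (rule lmodule.intro)
  note * = first_isomorphism[OF M N f surj refl]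
  show ?thesis by (rule dim_iso[OF M.quotient_left_module[OF *(1)] N *(2)])
qed

lemma rk_mono:
  assumes M: "left_module R M" and H: "submodule H R M" and K: "submodule K R M" and "H \<subseteq> K"
  shows "rk H M \<le> rk K M"
  unfolding rk_sup[OF M H] rk_sup[OF M K] using \<open>H \<subseteq> K\<close> by (intro SUP_subset_mono) auto

lemma rk_antimono:
  assumes M: "left_module R M" and "fg_submodule H R M" "fg_submodule K R M" "H \<subseteq> K"
  shows "rk H M \<le> rk H (submod M K)"
  unfolding rk_inf[OF M assms(2)] using assms(3,4) by (intro INF_lower) auto

lemma rk_antimono_submod:
  assumes M: "left_module R M" and "fg_submodule H R M" "fg_submodule K R M" "fg_submodule K' R M"
    and "H \<subseteq> K" "K \<subseteq> K'"
  shows "rk H (submod M K') \<le> rk H (submod M K)"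
proof -
  interpret M: lmodule R M using M by (rule lmodule.intro)
  have K': "submodule K' R M" using assms(4) by (rule M.fg_submodule_submodule)
  show ?thesis
    using rk_antimono[OF M.submod_left_module[OF K'], of H K] assms
    by (simp add: M.fg_submodule_submod_iff[OF K'])
qed

lemma dim_cyclic_le:
  assumes N: "left_module R N" and a: "a \<in> carrier N"
    and gen: "carrier N \<subseteq> (\<lambda>r. r \<odot>\<^bsub>N\<^esub> a) ` carrier R"
  shows "rdim N \<le> 1"
proof -
  interpret N: lmodule R N using N by (rule lmodule.intro)
  obtain \<iota> :: "'r \<Rightarrow> 'u" where \<iota>: "inj_on \<iota> (carrier R)" using ring_embeds by blast
  let ?S = "regular_module R" and ?P = "transport_module \<iota> (regular_module R)"
  have S: "left_module R ?S" using ring_axioms by (rule regular_left_module)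
  have cS: "carrier ?S = carrier R" by (simp add: regular_module_def)
  have P: "left_module R ?P" "\<iota> \<in> module_iso R ?S ?P"
    using transport_module[OF S, of \<iota>] \<iota> by (simp_all add: cS)
  interpret P: lmodule R ?P using P(1) by (rule lmodule.intro)
  have "(\<lambda>r. r \<odot>\<^bsub>N\<^esub> a) \<in> module_hom R ?S N"
    using a by (auto simp: module_hom_def hom_def regular_module_def N.smult_l_distr N.smult_assoc1)
  then have g: "(\<lambda>x. inv_into (carrier ?S) \<iota> x \<odot>\<^bsub>N\<^esub> a) \<in> module_hom R ?P N" (is "?g \<in> _")
    using module_iso_inverse[OF S P] by (rule module_hom_comp[rotated])
  have "inv_into (carrier ?S) \<iota> ` carrier ?P = carrier ?S"
    by (rule bij_betw_imp_surj_on[OF bij_betw_inv_into]) (use P(2) in \<open>simp add: module_iso_def\<close>)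
  then have "?g ` carrier ?P = (\<lambda>r. r \<odot>\<^bsub>N\<^esub> a) ` carrier R"
    unfolding image_image[of "\<lambda>r. r \<odot>\<^bsub>N\<^esub> a" "inv_into (carrier ?S) \<iota>" "carrier ?P", symmetric] by (simp add: cS)
  also have "\<dots> = carrier N" using gen a by auto
  finally have surj: "?g ` carrier ?P = carrier N" .
  have "rdim N = rcodim {x \<in> carrier ?P. ?g x = \<zero>\<^bsub>N\<^esub>} ?P" using P(1) N g surj by (rule dim_surj)
  also have "\<dots> \<le> rdim ?P"
    using rk_quotient[OF P(1) first_isomorphism(1)[OF P(1) N g surj refl]] by simp
  also have "\<dots> = 1" using P by (rule rk_ring)
  finally show ?thesis .
qed

text \<open>Adding one generator raises the dimension by at most that of a cyclic module.\<close>

lemma dim_fg_finite: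
  assumes M: "left_module R M" and H: "fg_submodule H R M"
  shows "rdim (submod M H) < top_class.top"
proof -
  interpret M: lmodule R M using M by (rule lmodule.intro)
  have "rdim (submod M (M.lspan A)) < top_class.top" if "finite A" "A \<subseteq> carrier M" for A
    using that
  proof (induction A rule: finite_induct)
    case empty
    have "M.lspan {} \<subseteq> {\<zero>\<^bsub>M\<^esub>}" by (intro M.span_least M.zero_submodule) simp
    then have "M.lspan {} = {\<zero>\<^bsub>M\<^esub>}" using M.submoduleD(2)[OF M.span_submodule[of "{}"]] by auto
    then show ?case using rk_zero[OF M.submod_left_module[OF M.zero_submodule]] by simp
  next
    case (insert a A)
    let ?H = "M.lspan A" and ?K = "M.lspan (insert a A)"
    have a: "a \<in> carrier M" "a \<in> ?K" and A: "A \<subseteq> carrier M"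
      using insert.prems M.span_superset[of "insert a A"] by auto
    have fgH: "fg_submodule ?H R M" and fgK: "fg_submodule ?K R M"
      using insert by (auto intro!: M.fg_submoduleI)
    note Hs = M.fg_submodule_submodule[OF fgH] and Ks = M.fg_submodule_submodule[OF fgK]
    have HK: "?H \<subseteq> ?K" by (rule M.span_mono) blast
    interpret K: lmodule R "submod M ?K" using M.submod_left_module[OF Ks] by (rule lmodule.intro)
    have HsK: "submodule ?H R (submod M ?K)" using Hs HK by (simp add: M.submodule_submod_iff[OF Ks])
    let ?N = "quotient_module (submod M ?K) ?H" and ?q = "coset_rep M ?H"
    have N: "left_module R ?N" using HsK by (rule K.quotient_left_module)
    note qs = K.quotient_simps[OF HsK, unfolded coset_rep_submod, simplified]
    have smult: "r \<odot>\<^bsub>?N\<^esub> ?q a = ?q (r \<odot>\<^bsub>M\<^esub> a)" if "r \<in> carrier R" for r using that a qs(4) by simp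
    define J where "J = {x \<in> carrier M. ?q x \<in> (\<lambda>r. ?q (r \<odot>\<^bsub>M\<^esub> a)) ` carrier R}"
    have ra: "r \<odot>\<^bsub>M\<^esub> a \<in> carrier M" if "r \<in> carrier R" for r using that a by simp
    have "submodule J R M"
    proof (rule M.submoduleI)
      show "\<zero>\<^bsub>M\<^esub> \<in> J" using M.smult_l_null[OF a(1)] by (auto simp: J_def intro!: image_eqI[of _ _ \<zero>])
    next
      fix x y assume "x \<in> J" "y \<in> J"
      then obtain r r' where *: "x \<in> carrier M" "y \<in> carrier M" "r \<in> carrier R" "r' \<in> carrier R"
        "?q x = ?q (r \<odot>\<^bsub>M\<^esub> a)" "?q y = ?q (r' \<odot>\<^bsub>M\<^esub> a)" by (auto simp: J_def)
      then have "?q (x \<oplus>\<^bsub>M\<^esub> y) = ?q ((r \<oplus> r') \<odot>\<^bsub>M\<^esub> a)"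
        using ra a M.quotient_simps(3)[OF Hs, symmetric] by (simp add: M.smult_l_distr)
      then show "x \<oplus>\<^bsub>M\<^esub> y \<in> J" using * by (auto simp: J_def)
    next
      fix b x assume b: "b \<in> carrier R" and "x \<in> J"
      then obtain r where *: "x \<in> carrier M" "r \<in> carrier R" "?q x = ?q (r \<odot>\<^bsub>M\<^esub> a)" by (auto simp: J_def)
      then have "?q (b \<odot>\<^bsub>M\<^esub> x) = ?q ((b \<otimes> r) \<odot>\<^bsub>M\<^esub> a)"
        using b a ra M.quotient_simps(4)[OF Hs, symmetric] by (simp add: M.smult_assoc1)
      then show "b \<odot>\<^bsub>M\<^esub> x \<in> J" using * b by (auto simp: J_def)
    qed (auto simp: J_def)
    moreover have "insert a A \<subseteq> J"
    proof -
      have "?q x = ?q (\<zero> \<odot>\<^bsub>M\<^esub> a)" if "x \<in> A" for x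
        using that A a M.span_superset[of A] M.coset_rep_zero_iff[OF Hs, of x]
        by (auto simp: M.smult_l_null)
      moreover have "?q a \<in> (\<lambda>r. ?q (r \<odot>\<^bsub>M\<^esub> a)) ` carrier R"
        using a by (intro image_eqI[of _ _ \<one>]) auto
      ultimately show ?thesis using A a by (auto simp: J_def)
    qed
    ultimately have "?K \<subseteq> J" by (rule M.span_least)
    then have "carrier ?N \<subseteq> (\<lambda>r. r \<odot>\<^bsub>?N\<^esub> ?q a) ` carrier R"
      using smult by (auto simp: qs(1) J_def image_iff)
    moreover have "?q a \<in> carrier ?N" using a by (simp add: qs(1))
    ultimately have "rdim ?N \<le> 1" by (intro dim_cyclic_le N)
    then have "rdim ?N < top_class.top" by (rule order_le_less_trans) simp
    moreover have "rk ?H (submod M ?K) \<le> rdim (submod M ?H)"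
      using rk_antimono_submod[OF M fgH fgH fgK order_refl HK] by simp
    then have "rk ?H (submod M ?K) < top_class.top" using insert.IH[OF A] by (rule order_le_less_trans)
    ultimately show ?case using rk_quotient[OF K.left_module_axioms HsK] by (simp add: less_top)
  qed
  then show ?thesis using H by (auto simp: fg_submodule_def)
qed

lemma fg_carrier_submod:
  assumes M: "left_module R M" and K: "fg_submodule K R M"
  shows "left_module R (submod M K)" "fg_submodule K R (submod M K)"
proof -
  interpret M: lmodule R M using M by (rule lmodule.intro)
  note Ks = M.fg_submodule_submodule[OF K]
  show "left_module R (submod M K)" using Ks by (rule M.submod_left_module)
  show "fg_submodule K R (submod M K)" using K by (simp add: M.fg_submodule_submod_iff[OF Ks])
qed

text \<open>
  The diagonal map \<open>K \<rightarrow> K/U \<oplus> K/V\<close> has kernel \<open>U \<inter> V\<close> and cokernel \<open>K/(U + V)\<close>, and the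
  relative rank of its image is at most the rank of that image.
\<close>

lemma codim_submodular:
  assumes K: "left_module R K" and fg: "fg_submodule (carrier K) R K"
    and U: "submodule U R K" and V: "submodule V R K"
  shows "rcodim U K + rcodim V K \<le> rcodim (U \<inter> V) K + rcodim (U <+>\<^bsub>K\<^esub> V) K"
proof -
  interpret K: lmodule R K using K by (rule lmodule.intro)
  let ?QU = "quotient_module K U" and ?QV = "quotient_module K V"
  let ?S = "direct_sum_module ?QU ?QV"
  have QU: "left_module R ?QU" and QV: "left_module R ?QV" using U V by (auto intro: K.quotient_left_module)
  interpret QU: lmodule R ?QU using QU by (rule lmodule.intro)
  interpret QV: lmodule R ?QV using QV by (rule lmodule.intro)
  have S: "left_module R ?S" using QU QV by (rule direct_sum_left_module)
  obtain \<sigma> :: "'u \<times> 'u \<Rightarrow> 'u" where \<sigma>: "inj \<sigma>"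
  proof -
    have "\<exists>f :: 'u \<times> 'u \<Rightarrow> 'u. bij_betw f (UNIV \<times> UNIV) UNIV"
      unfolding card_of_ordIso by (rule card_of_Times_same_infinite[OF infinite_universe])
    then obtain f :: "'u \<times> 'u \<Rightarrow> 'u" where "bij_betw f (UNIV \<times> UNIV) UNIV" by blast
    then show thesis using that by (auto simp: bij_betw_def)
  qed
  let ?T = "transport_module \<sigma> ?S"
  have T: "left_module R ?T" "\<sigma> \<in> module_iso R ?S ?T"
    using transport_module[OF S, of \<sigma>] inj_on_subset[OF \<sigma>] by auto
  interpret T: lmodule R ?T using T(1) by (rule lmodule.intro)
  have \<sigma>h: "\<sigma> \<in> module_hom R ?S ?T" and cT: "carrier ?T = \<sigma> ` (carrier ?QU \<times> carrier ?QV)"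
    using T(2) by (auto simp: module_iso_def bij_betw_def direct_sum_simps)
  have dimT: "rdim ?T = rcodim U K + rcodim V K"
    using rk_direct_sum[OF QU QV T(1) QU.carrier_submodule QV.carrier_submodule T(2)] cT by simp
  let ?qU = "coset_rep K U" and ?qV = "coset_rep K V" and ?q = "coset_rep K (U <+>\<^bsub>K\<^esub> V)"
  note qU = K.coset_rep_hom[OF U] and qV = K.coset_rep_hom[OF V]
  define g where "g x = \<sigma> (?qU x, ?qV x)" for x
  have "(\<lambda>x. (?qU x, ?qV x)) \<in> module_hom R K ?S"
    using qU qV by (auto simp: module_hom_def hom_def direct_sum_simps)
  then have g: "g \<in> module_hom R K ?T" unfolding g_def[abs_def] using \<sigma>h by (rule module_hom_comp)
  let ?I = "g ` carrier K"
  have I: "fg_submodule ?I R ?T" using K T(1) g fg by (rule fg_submodule_image)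
  note Is = T.fg_submodule_submodule[OF I]
  have "rk ?I ?T \<le> rdim (submod ?T ?I)" using rk_antimono[OF T(1) I I order_refl] by simp
  also have "\<dots> = rcodim {x \<in> carrier K. g x = \<zero>\<^bsub>?T\<^esub>} K"
    using dim_surj[OF K T.submod_left_module[OF Is], of g]
      module_hom_restrict[OF g, of "carrier K" ?I] by simp
  also have "{x \<in> carrier K. g x = \<zero>\<^bsub>?T\<^esub>} = U \<inter> V"
  proof -
    have "\<zero>\<^bsub>?T\<^esub> = \<sigma> (?qU \<zero>\<^bsub>K\<^esub>, ?qV \<zero>\<^bsub>K\<^esub>)"
      using module_homD(4)[OF S T(1) \<sigma>h] K.quotient_simps(2)[OF U] K.quotient_simps(2)[OF V]
      by (simp add: direct_sum_simps)
    then show ?thesis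
      using \<sigma> K.coset_rep_zero_iff[OF U] K.coset_rep_zero_iff[OF V] K.submoduleD(1)[OF U]
      by (auto simp: g_def inj_eq)
  qed
  finally have rkI: "rk ?I ?T \<le> rcodim (U \<inter> V) K" .
  have UV: "submodule (U <+>\<^bsub>K\<^esub> V) R K" using U V by (rule K.set_add_submodule)
  have UUV: "U \<subseteq> U <+>\<^bsub>K\<^esub> V" and VUV: "V \<subseteq> U <+>\<^bsub>K\<^esub> V"
    using K.submoduleD(1,2)[OF U] K.submoduleD(1,2)[OF V]
    by (intro K.M.subset_set_add; simp)+
  note UVD = K.submoduleD[OF UV] and qUd = K.coset_rep_diff[OF U] and qVd = K.coset_rep_diff[OF V]
  let ?C = "quotient_module K (U <+>\<^bsub>K\<^esub> V)"
  have C: "left_module R ?C" using UV by (rule K.quotient_left_module)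
  interpret C: lmodule R ?C using C by (rule lmodule.intro)
  note qC = module_homD[OF K C K.coset_rep_hom[OF UV]]
  have eqU: "?q (?qU x) = ?q x" if "x \<in> carrier K" for x
    using qUd[OF that] UUV that by (auto simp: K.coset_rep_eq_iff[OF UV])
  have eqV: "?q (?qV x) = ?q x" if "x \<in> carrier K" for x
    using qVd[OF that] VUV that by (auto simp: K.coset_rep_eq_iff[OF UV])
  define h where "h p = ?q (fst p) \<ominus>\<^bsub>?C\<^esub> ?q (snd p)" for p
  have hq: "h (?qU x, ?qV y) = ?q x \<ominus>\<^bsub>?C\<^esub> ?q y" if "x \<in> carrier K" "y \<in> carrier K" for x y
    using that by (simp add: h_def eqU eqV)
  note qUs = K.quotient_simps[OF U] and qVs = K.quotient_simps[OF V]
  have Sel: "\<exists>x\<in>carrier K. \<exists>y\<in>carrier K. p = (?qU x, ?qV y)" if "p \<in> carrier ?S" for p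
    using that unfolding direct_sum_simps(1) qUs(1) qVs(1) by blast
  have h: "h \<in> module_hom R ?S ?C"
  proof -
    have "h (p \<oplus>\<^bsub>?S\<^esub> p') = h p \<oplus>\<^bsub>?C\<^esub> h p'" if pS: "p \<in> carrier ?S" "p' \<in> carrier ?S" for p p'
    proof -
      obtain x y x' y' where c: "x \<in> carrier K" "y \<in> carrier K" "x' \<in> carrier K" "y' \<in> carrier K"
        and p: "p = (?qU x, ?qV y)" "p' = (?qU x', ?qV y')"
        using Sel[OF pS(1)] Sel[OF pS(2)] by blast
      have "h (p \<oplus>\<^bsub>?S\<^esub> p') = ?q (x \<oplus>\<^bsub>K\<^esub> x') \<ominus>\<^bsub>?C\<^esub> ?q (y \<oplus>\<^bsub>K\<^esub> y')"
        using c by (simp add: p direct_sum_simps qUs(3) qVs(3) hq)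
      also have "\<dots> = (?q x \<ominus>\<^bsub>?C\<^esub> ?q y) \<oplus>\<^bsub>?C\<^esub> (?q x' \<ominus>\<^bsub>?C\<^esub> ?q y')"
        using c qC(1) by (simp add: qC(2) a_minus_def C.M.minus_add C.M.a_ac)
      finally show ?thesis using c by (simp add: p hq)
    qed
    moreover have "h (a \<odot>\<^bsub>?S\<^esub> p) = a \<odot>\<^bsub>?C\<^esub> h p" if aS: "a \<in> carrier R" "p \<in> carrier ?S" for a p
    proof -
      obtain x y where c: "x \<in> carrier K" "y \<in> carrier K" and p: "p = (?qU x, ?qV y)"
        using Sel[OF aS(2)] by blast
      have "h (a \<odot>\<^bsub>?S\<^esub> p) = ?q (a \<odot>\<^bsub>K\<^esub> x) \<ominus>\<^bsub>?C\<^esub> ?q (a \<odot>\<^bsub>K\<^esub> y)"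
        using c that by (simp add: p direct_sum_simps qUs(4) qVs(4) hq)
      also have "\<dots> = ?q (a \<odot>\<^bsub>K\<^esub> (x \<ominus>\<^bsub>K\<^esub> y))"
      proof -
        have "a \<odot>\<^bsub>K\<^esub> (\<ominus>\<^bsub>K\<^esub> y) = \<ominus>\<^bsub>K\<^esub> (a \<odot>\<^bsub>K\<^esub> y)"
          using K.smult_r_distr[of a "\<ominus>\<^bsub>K\<^esub> y" y] that c
          by (intro K.M.minus_equality[symmetric]) (simp_all add: K.M.l_neg K.smult_r_null)
        then have "a \<odot>\<^bsub>K\<^esub> (x \<ominus>\<^bsub>K\<^esub> y) = a \<odot>\<^bsub>K\<^esub> x \<ominus>\<^bsub>K\<^esub> a \<odot>\<^bsub>K\<^esub> y"
          using that c by (simp add: a_minus_def K.smult_r_distr)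
        then show ?thesis using that c by (simp add: qC(5))
      qed
      also have "\<dots> = a \<odot>\<^bsub>?C\<^esub> h p" using that c by (simp add: p hq qC(3) qC(5)[symmetric])
      finally show ?thesis .
    qed
    moreover have "h p \<in> carrier ?C" if "p \<in> carrier ?S" for p
      using that qC(1) by (auto simp: direct_sum_simps qUs(1) qVs(1) hq)
    ultimately show ?thesis by (auto simp: module_hom_def hom_def)
  qed
  let ?h = "\<lambda>x. h (inv_into (carrier ?S) \<sigma> x)"
  have h': "?h \<in> module_hom R ?T ?C" using module_iso_inverse[OF S T] h by (rule module_hom_comp)
  have inv: "inv_into (carrier ?S) \<sigma> (\<sigma> p) = p" if "p \<in> carrier ?S" for p
    using that inj_on_subset[OF \<sigma>] by (intro inv_into_f_f) auto
  have h\<sigma>: "?h (\<sigma> (?qU x, ?qV y)) = ?q x \<ominus>\<^bsub>?C\<^esub> ?q y" if "x \<in> carrier K" "y \<in> carrier K" for x y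
    using that by (subst inv) (simp_all add: direct_sum_simps(1) qUs(1) qVs(1) hq)
  have Tel: "\<exists>x\<in>carrier K. \<exists>y\<in>carrier K. p = \<sigma> (?qU x, ?qV y)" if "p \<in> carrier ?T" for p
    using that unfolding cT qUs(1) qVs(1) by blast
  have surj: "?h ` carrier ?T = carrier ?C"
  proof
    show "?h ` carrier ?T \<subseteq> carrier ?C" using module_homD(1)[OF T(1) C h'] by blast
    show "carrier ?C \<subseteq> ?h ` carrier ?T"
    proof
      fix c assume "c \<in> carrier ?C"
      then obtain x where x: "x \<in> carrier K" "c = ?q x" using K.quotient_simps(1)[OF UV] by blast
      have "?h (\<sigma> (?qU x, ?qV \<zero>\<^bsub>K\<^esub>)) = ?q (x \<ominus>\<^bsub>K\<^esub> \<zero>\<^bsub>K\<^esub>)" using x by (simp add: h\<sigma> qC(5))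
      also have "x \<ominus>\<^bsub>K\<^esub> \<zero>\<^bsub>K\<^esub> = x"
        using x K.M.minus_equality[of "\<zero>\<^bsub>K\<^esub>" "\<zero>\<^bsub>K\<^esub>"] by (simp add: a_minus_def)
      finally have "c = ?h (\<sigma> (?qU x, ?qV \<zero>\<^bsub>K\<^esub>))" using x by simp
      moreover have "\<sigma> (?qU x, ?qV \<zero>\<^bsub>K\<^esub>) \<in> carrier ?T" using x unfolding cT qUs(1) qVs(1) by simp
      ultimately show "c \<in> ?h ` carrier ?T" by (rule image_eqI)
    qed
  qed
  have "{p \<in> carrier ?T. ?h p = \<zero>\<^bsub>?C\<^esub>} = ?I"
  proof (intro equalityI subsetI)
    fix p assume "p \<in> {p \<in> carrier ?T. ?h p = \<zero>\<^bsub>?C\<^esub>}"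
    then obtain x y where xy: "x \<in> carrier K" "y \<in> carrier K" "p = \<sigma> (?qU x, ?qV y)" "?h p = \<zero>\<^bsub>?C\<^esub>"
      using Tel by blast
    then have "?q x \<ominus>\<^bsub>?C\<^esub> ?q y = \<zero>\<^bsub>?C\<^esub>" using h\<sigma> by simp
    then have "?q x = ?q y" using xy qC(1) by (simp add: C.M.minus_eq_zero_iff)
    then have "x \<ominus>\<^bsub>K\<^esub> y \<in> U <+>\<^bsub>K\<^esub> V" using xy by (simp add: K.coset_rep_eq_iff[OF UV])
    then obtain u v where uv: "u \<in> U" "v \<in> V" "x \<ominus>\<^bsub>K\<^esub> y = u \<oplus>\<^bsub>K\<^esub> v" by (auto simp: set_add_iff)
    have c: "u \<in> carrier K" "v \<in> carrier K" using uv K.submoduleD(1)[OF U] K.submoduleD(1)[OF V] by auto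
    \<comment> \<open>the common element \<open>x - u = y + v\<close> maps to \<open>p\<close> under the diagonal\<close>
    have z: "x \<ominus>\<^bsub>K\<^esub> u = y \<oplus>\<^bsub>K\<^esub> v"
    proof -
      have "x = (x \<ominus>\<^bsub>K\<^esub> y) \<oplus>\<^bsub>K\<^esub> y" using xy by (simp add: a_minus_def K.M.a_assoc K.M.l_neg)
      then have "x = (y \<oplus>\<^bsub>K\<^esub> v) \<oplus>\<^bsub>K\<^esub> u" using uv(3) c xy by (simp add: K.M.a_ac)
      then show ?thesis using c xy by (simp add: a_minus_def K.M.a_assoc K.M.r_neg)
    qed
    have "?qU (x \<ominus>\<^bsub>K\<^esub> u) = ?qU x"
      unfolding a_minus_def using xy(1) K.submoduleD(4)[OF U uv(1)] by (rule K.coset_rep_add_mem[OF U])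
    moreover have "?qV (x \<ominus>\<^bsub>K\<^esub> u) = ?qV y"
      unfolding z using xy(2) uv(2) by (rule K.coset_rep_add_mem[OF V])
    ultimately have "p = g (x \<ominus>\<^bsub>K\<^esub> u)" using xy by (simp add: g_def)
    then show "p \<in> ?I" using c xy by blast
  next
    fix p assume "p \<in> ?I"
    then obtain x where x: "x \<in> carrier K" "p = \<sigma> (?qU x, ?qV x)" by (auto simp: g_def)
    then show "p \<in> {p \<in> carrier ?T. ?h p = \<zero>\<^bsub>?C\<^esub>}"
      using h\<sigma>[of x x] qC(1) unfolding cT qUs(1) qVs(1) by (simp add: C.M.minus_eq_zero_iff)
  qed
  then have "rdim ?C = rcodim ?I ?T" using dim_surj[OF T(1) C h' surj] by simp
  then have "rdim ?T = rk ?I ?T + rdim ?C" using rk_quotient[OF T(1) Is] by simp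
  then show ?thesis using rkI by (simp add: dimT add_right_mono)
qed

end

lemma ennreal_submodular_complement:
  fixes s :: ennreal
  assumes "s = u + u'" "s = v + v'" "s = i + i'" "s = j + j'" "s < top_class.top" "u' + v' \<le> i' + j'"
  shows "i + j \<le> u + v"
proof -
  have "(i + j) + (u' + v') \<le> (i + j) + (i' + j')" using assms(6) by (rule add_left_mono)
  also have "\<dots> = (i + i') + (j + j')" by (simp add: add_ac)
  also have "\<dots> = (u + u') + (v + v')" using assms(1-4) by simp
  also have "\<dots> = (u + v) + (u' + v')" by (simp add: add_ac)
  finally have "(u' + v') + (i + j) \<le> (u' + v') + (u + v)" by (simp add: add_ac)
  moreover have "u' < top_class.top" using assms(5) unfolding assms(1) by simp
  moreover have "v' < top_class.top" using assms(5) unfolding assms(2) by simp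
  ultimately show ?thesis by (auto simp: ennreal_add_left_cancel_le)
qed

context universal_rank
begin

text \<open>
  In a finitely generated module \<open>K\<close> the rank of \<open>U\<close> and that of \<open>K/U\<close> add up to the finite rank
  of \<open>K\<close>, so submodularity of the latter turns into submodularity of the former.
\<close>

lemma rk_submodular:
  assumes K: "left_module R K" and fg: "fg_submodule (carrier K) R K"
    and U: "submodule U R K" and V: "submodule V R K"
  shows "rk (U <+>\<^bsub>K\<^esub> V) K + rk (U \<inter> V) K \<le> rk U K + rk V K"
proof -
  interpret K: lmodule R K using K by (rule lmodule.intro)
  have fin: "rdim K < top_class.top" using dim_fg_finite[OF K fg] by simp
  show ?thesis
    using codim_submodular[OF K fg U V]
    by (intro ennreal_submodular_complement[OF rk_quotient[OF K U] rk_quotient[OF K V]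
          rk_quotient[OF K K.set_add_submodule[OF U V]] rk_quotient[OF K K.Int_submodule[OF U V]] fin])
      (simp only: add.commute)
qed

lemma rk_fg_finite:
  assumes K: "left_module R K" and fg: "fg_submodule (carrier K) R K" and U: "submodule U R K"
  shows "rk U K < top_class.top"
proof -
  interpret K: lmodule R K using K by (rule lmodule.intro)
  have "rk U K \<le> rdim K" using K.submoduleD(1)[OF U] by (intro rk_mono K U K.carrier_submodule)
  also have "\<dots> < top_class.top" using dim_fg_finite[OF K fg] by simp
  finally show ?thesis .
qed

text \<open>Both sides are complements, with respect to the rank of \<open>K\<close>, of the rank of \<open>K / (Y + W)\<close>.\<close>

lemma rk_image:
  assumes K: "left_module R K" and fg: "fg_submodule (carrier K) R K" and N: "left_module R N"
    and f: "f \<in> module_hom R K N" and surj: "f ` carrier K = carrier N"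
    and W: "W = {x \<in> carrier K. f x = \<zero>\<^bsub>N\<^esub>}" and Y: "submodule Y R K"
  shows "rk (f ` Y) N + rk W K = rk (Y <+>\<^bsub>K\<^esub> W) K"
proof -
  interpret K: lmodule R K using K by (rule lmodule.intro)
  interpret N: lmodule R N using N by (rule lmodule.intro)
  have Ws: "submodule W R K" using K N f surj W by (rule first_isomorphism(1))
  have fY: "submodule (f ` Y) R N" using K N f Y by (rule module_hom_image_submodule)
  have YW: "submodule (Y <+>\<^bsub>K\<^esub> W) R K" using Y Ws by (rule K.set_add_submodule)
  let ?Q = "quotient_module N (f ` Y)" and ?q = "coset_rep N (f ` Y)"
  note fD = module_homD[OF K N f]
  have Q: "left_module R ?Q" using fY by (rule N.quotient_left_module)
  have qf: "(\<lambda>x. ?q (f x)) \<in> module_hom R K ?Q" using f N.coset_rep_hom[OF fY] by (rule module_hom_comp)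
  have qsurj: "(\<lambda>x. ?q (f x)) ` carrier K = carrier ?Q"
    using N.quotient_simps(1)[OF fY] surj by (metis image_image)
  have "{x \<in> carrier K. ?q (f x) = \<zero>\<^bsub>?Q\<^esub>} = Y <+>\<^bsub>K\<^esub> W"
  proof (intro equalityI subsetI)
    fix x assume "x \<in> {x \<in> carrier K. ?q (f x) = \<zero>\<^bsub>?Q\<^esub>}"
    then have x: "x \<in> carrier K" "f x \<in> f ` Y"
      using N.coset_rep_zero_iff[OF fY] fD(1) by (auto simp: N.quotient_simps(2)[OF fY])
    then obtain y where y: "y \<in> Y" "f x = f y" by blast
    have yc: "y \<in> carrier K" using y K.submoduleD(1)[OF Y] by blast
    then have "f (x \<ominus>\<^bsub>K\<^esub> y) = \<zero>\<^bsub>N\<^esub>" using x y fD(1) by (simp add: fD(5) N.M.minus_eq_zero_iff)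
    then have "x \<ominus>\<^bsub>K\<^esub> y \<in> W" using x yc by (simp add: W)
    moreover have "x = y \<oplus>\<^bsub>K\<^esub> (x \<ominus>\<^bsub>K\<^esub> y)"
      using x yc by (simp add: a_minus_def K.M.a_ac K.M.r_neg1 K.M.r_neg2 K.M.r_neg)
    ultimately show "x \<in> Y <+>\<^bsub>K\<^esub> W" using y(1) by (metis set_addI)
  next
    fix x assume "x \<in> Y <+>\<^bsub>K\<^esub> W"
    then obtain y w where yw: "y \<in> Y" "w \<in> W" "x = y \<oplus>\<^bsub>K\<^esub> w" by (auto simp: set_add_iff)
    have c: "y \<in> carrier K" "w \<in> carrier K" "f w = \<zero>\<^bsub>N\<^esub>"
      using yw K.submoduleD(1)[OF Y] by (auto simp: W)
    then have "f x = f y" using fD(1) by (simp add: yw fD(2))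
    then have "?q (f x) = \<zero>\<^bsub>?Q\<^esub>"
      using yw c fD(1) N.coset_rep_zero_iff[OF fY, of "f y"] by (simp add: N.quotient_simps(2)[OF fY])
    then show "x \<in> {x \<in> carrier K. ?q (f x) = \<zero>\<^bsub>?Q\<^esub>}" using c yw by simp
  qed
  then have 1: "rdim ?Q = rcodim (Y <+>\<^bsub>K\<^esub> W) K" using dim_surj[OF K Q qf qsurj] by simp
  have "rdim K = rk W K + rdim N"
    using rk_quotient[OF K Ws] dim_surj[OF K N f surj] W by simp
  also have "\<dots> = rk W K + (rk (f ` Y) N + rdim ?Q)" using rk_quotient[OF N fY] by simp
  finally have "rk (Y <+>\<^bsub>K\<^esub> W) K + rdim ?Q = (rk (f ` Y) N + rk W K) + rdim ?Q"
    using rk_quotient[OF K YW] 1 by (simp add: add_ac)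
  moreover have "rdim ?Q < top_class.top"
  proof -
    have "rdim ?Q \<le> rdim K" using rk_quotient[OF K YW] 1 by simp
    also have "\<dots> < top_class.top" using dim_fg_finite[OF K fg] by simp
    finally show ?thesis .
  qed
  ultimately show ?thesis by (auto simp: add.commute[of _ "rdim ?Q"] ennreal_add_left_cancel)
qed

text \<open>
  The instance of the previous lemma for the image of a finitely generated submodule \<open>K\<close> in the
  quotient of an ambient module.
\<close>

lemma rk_quotient_image:
  assumes M: "left_module R M" and W: "submodule W R M" and K: "fg_submodule K R M"
    and Y: "submodule Y R M" "Y \<subseteq> K"
  shows "rk (coset_rep M W ` Y) (submod (quotient_module M W) (coset_rep M W ` K))
      + rk (K \<inter> W) (submod M K) = rk (Y <+>\<^bsub>M\<^esub> (K \<inter> W)) (submod M K)"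
proof -
  interpret M: lmodule R M using M by (rule lmodule.intro)
  interpret Q: lmodule R "quotient_module M W" using M.quotient_left_module[OF W] by (rule lmodule.intro)
  note Ks = M.fg_submodule_submodule[OF K]
  have qK: "submodule (coset_rep M W ` K) R (quotient_module M W)"
    using M Q.left_module_axioms M.coset_rep_hom[OF W] Ks by (rule module_hom_image_submodule)
  have "Y <+>\<^bsub>submod M K\<^esub> X = Y <+>\<^bsub>M\<^esub> X" for X by (simp add: set_add_image)
  then show ?thesis
    using rk_image[of "submod M K" "submod (quotient_module M W) (coset_rep M W ` K)"
        "coset_rep M W" "K \<inter> W" Y]
      fg_carrier_submod[OF M K] Q.submod_left_module[OF qK]
      module_hom_restrict[OF M.coset_rep_hom[OF W] M.submoduleD(1)[OF Ks] order_refl]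
      M.coset_rep_ker[OF W M.submoduleD(1)[OF Ks]] Y
    by (simp add: M.submodule_submod_iff[OF Ks])
qed

text \<open>
  Finitely many relative ranks in \<open>M\<close> are approximated simultaneously in one finitely generated
  submodule, because a near-optimal \<open>K\<close> may be enlarged.
\<close>

lemma rk_approx:
  assumes M: "left_module R M" and H: "fg_submodule H R M" and L: "fg_submodule L R M" and e: "e > 0"
  obtains K where "fg_submodule K R M" "H \<subseteq> K" "L \<subseteq> K" "rk H (submod M K) \<le> rk H M + ennreal e"
proof -
  interpret M: lmodule R M using M by (rule lmodule.intro)
  have "rk H M \<le> rk H (submod M H)" by (intro rk_antimono M H order_refl)
  also have "\<dots> < top_class.top" using dim_fg_finite[OF M H] by simp
  finally have "rk H M \<noteq> \<infinity>" by simp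
  with INF_approx_ennreal[OF e rk_inf[OF M H]]
  obtain K0 where K0: "fg_submodule K0 R M" "H \<subseteq> K0" "rk H (submod M K0) < rk H M + ennreal e" by auto
  let ?K = "K0 <+>\<^bsub>M\<^esub> L"
  note K0D = M.submoduleD[OF M.fg_submodule_submodule[OF K0(1)]]
    and LD = M.submoduleD[OF M.fg_submodule_submodule[OF L]]
  have K: "fg_submodule ?K R M" using K0(1) L by (rule M.fg_set_add)
  have sub: "K0 \<subseteq> ?K" "L \<subseteq> ?K" using K0D LD by (intro M.M.subset_set_add; simp)+
  have "rk H (submod M ?K) \<le> rk H (submod M K0)" by (intro rk_antimono_submod M H K0 K sub)
  also have "\<dots> \<le> rk H M + ennreal e" using K0(3) by (rule less_imp_le)
  finally show thesis using that K K0(2) sub by blast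
qed

text \<open>
  Submodularity in \<open>M\<close> is the limit of submodularity in large finitely generated submodules
  \<open>K\<close>, applied there to \<open>X\<close> and \<open>Y + C\<close>.
\<close>

lemma rk_submodule_rank:
  assumes M: "left_module R M"
  shows "submodule_rank R M (\<lambda>H. rk H M)"
proof -
  interpret M: lmodule R M using M by (rule lmodule.intro)
  show ?thesis
  proof (intro submodule_rank.intro submodule_rank_axioms.intro M.lmodule_axioms)
    fix H assume H: "fg_submodule H R M"
    have "rk H M \<le> rk H (submod M H)" by (intro rk_antimono M H order_refl)
    also have "\<dots> < top_class.top" using dim_fg_finite[OF M H] by simp
    finally show "rk H M < top_class.top" .
  next
    have "rk {\<zero>\<^bsub>M\<^esub>} M \<le> rk {\<zero>\<^bsub>M\<^esub>} (submod M {\<zero>\<^bsub>M\<^esub>})" by (intro rk_antimono M M.fg_zero order_refl)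
    also have "\<dots> = 0" using rk_zero[OF M.submod_left_module[OF M.zero_submodule]] by simp
    finally show "rk {\<zero>\<^bsub>M\<^esub>} M = 0" by simp
  next
    fix H K assume "fg_submodule H R M" "fg_submodule K R M" "H \<subseteq> K"
    then show "rk H M \<le> rk K M" by (intro rk_mono M M.fg_submodule_submodule)
  next
    fix X Y C
    assume X: "fg_submodule X R M" and Y: "fg_submodule Y R M" and C: "fg_submodule C R M"
      and YX: "Y \<subseteq> X"
    note Xs = M.fg_submodule_submodule[OF X] and Ys = M.fg_submodule_submodule[OF Y]
      and Cs = M.fg_submodule_submodule[OF C]
    let ?XC = "X <+>\<^bsub>M\<^esub> C" and ?YC = "Y <+>\<^bsub>M\<^esub> C"
    have YC: "fg_submodule ?YC R M" using Y C by (rule M.fg_set_add)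
    have XC: "fg_submodule ?XC R M" using X C by (rule M.fg_set_add)
    have sub: "Y \<subseteq> ?YC" "C \<subseteq> ?YC" "X \<subseteq> ?XC" "?YC \<subseteq> ?XC"
      using M.submoduleD[OF Xs] M.submoduleD[OF Ys] M.submoduleD[OF Cs] YX
      by (intro M.M.subset_set_add set_add_mono; simp)+
    show "rk ?XC M + rk Y M \<le> rk ?YC M + rk X M"
    proof (rule ennreal_le_epsilon)
      fix e :: real assume e: "e > 0"
      obtain K0 where K0: "fg_submodule K0 R M" "X \<subseteq> K0" "?XC \<subseteq> K0"
        "rk X (submod M K0) \<le> rk X M + ennreal (e/2)"
        using rk_approx[OF M X XC, of "e/2"] e by auto
      obtain K where K: "fg_submodule K R M" "?YC \<subseteq> K" "K0 \<subseteq> K"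
        "rk ?YC (submod M K) \<le> rk ?YC M + ennreal (e/2)"
        using rk_approx[OF M YC K0(1), of "e/2"] e by auto
      note KM = fg_carrier_submod[OF M K(1)]
      interpret K: lmodule R "submod M K" using KM(1) by (rule lmodule.intro)
      have Ks: "submodule H R (submod M K)" if "submodule H R M" "H \<subseteq> K" for H
        using that by (simp add: M.submodule_submod_iff[OF M.fg_submodule_submodule[OF K(1)]])
      have XCK: "?XC \<subseteq> K" using K0 K by blast
      note XCs = M.fg_submodule_submodule[OF XC] and YCs = M.fg_submodule_submodule[OF YC]
      have XKs: "submodule X R (submod M K)" and YCK: "submodule ?YC R (submod M K)"
        using Ks[OF Xs] Ks[OF YCs] sub XCK K(2) by auto
      have seteq: "A <+>\<^bsub>submod M K\<^esub> B = A <+>\<^bsub>M\<^esub> B" for A B by (simp add: set_add_image)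
      have sums: "submodule (X <+>\<^bsub>M\<^esub> ?YC) R (submod M K)" "submodule (X \<inter> ?YC) R (submod M K)"
        using K.set_add_submodule[OF XKs YCK] K.Int_submodule[OF XKs YCK] by (simp_all add: seteq)
      have "rk ?XC M + rk Y M \<le> rk ?XC (submod M K) + rk Y (submod M K)"
        using sub XCK by (intro add_mono rk_antimono M XC Y K(1)) auto
      also have "\<dots> \<le> rk (X <+>\<^bsub>M\<^esub> ?YC) (submod M K) + rk (X \<inter> ?YC) (submod M K)"
        using sub YX XCK by (intro add_mono rk_mono KM(1) sums Ks XCs Ys set_add_mono) auto
      also have "\<dots> \<le> rk X (submod M K) + rk ?YC (submod M K)"
        using rk_submodular[OF KM(1) _ XKs YCK] KM(2) by (simp add: seteq)
      also have "rk X (submod M K) \<le> rk X (submod M K0)"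
        by (intro rk_antimono_submod M X K0 K)
      also have "\<dots> \<le> rk X M + ennreal (e/2)" by (rule K0(4))
      also have "rk ?YC (submod M K) \<le> rk ?YC M + ennreal (e/2)" by (rule K(4))
      finally have "rk ?XC M + rk Y M \<le> rk ?YC M + rk X M + (ennreal (e/2) + ennreal (e/2))"
        by (simp add: add_ac)
      also have "ennreal (e/2) + ennreal (e/2) = ennreal e" using e by (simp flip: ennreal_plus)
      finally show "rk ?XC M + rk Y M \<le> rk ?YC M + rk X M + ennreal e" .
    qed
  qed
qed

text \<open>
  In a large finitely generated \<open>K\<close> this is submodularity for \<open>X + Y\<close> and \<open>K \<inter> W\<close>, whose
  intersection contains \<open>X\<close>.
\<close>

lemma rk_lower:
  assumes M: "left_module R M" and W: "submodule W R M"
    and X: "fg_submodule X R M" "X \<subseteq> W" and Y: "fg_submodule Y R M"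
  shows "rk X M + rk (coset_rep M W ` Y) (quotient_module M W) \<le> rk (X <+>\<^bsub>M\<^esub> Y) M"
proof (rule ennreal_le_epsilon)
  fix e :: real assume e: "e > 0"
  interpret M: lmodule R M using M by (rule lmodule.intro)
  let ?q = "coset_rep M W" and ?Q = "quotient_module M W"
  have Q: "left_module R ?Q" using W by (rule M.quotient_left_module)
  have XY: "fg_submodule (X <+>\<^bsub>M\<^esub> Y) R M" using X(1) Y by (rule M.fg_set_add)
  note Xs = M.fg_submodule_submodule[OF X(1)] and Ys = M.fg_submodule_submodule[OF Y]
    and XYs = M.fg_submodule_submodule[OF XY]
  have sub: "X \<subseteq> X <+>\<^bsub>M\<^esub> Y" "Y \<subseteq> X <+>\<^bsub>M\<^esub> Y"
    using M.submoduleD[OF Xs] M.submoduleD[OF Ys] by (intro M.M.subset_set_add; simp)+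
  obtain K where K: "fg_submodule K R M" "X <+>\<^bsub>M\<^esub> Y \<subseteq> K"
    "rk (X <+>\<^bsub>M\<^esub> Y) (submod M K) \<le> rk (X <+>\<^bsub>M\<^esub> Y) M + ennreal e"
    using rk_approx[OF M XY XY e] by auto
  note KM = fg_carrier_submod[OF M K(1)] and Kss = M.fg_submodule_submodule[OF K(1)]
  interpret K: lmodule R "submod M K" using KM(1) by (rule lmodule.intro)
  let ?K = "submod M K" and ?V = "K \<inter> W"
  have V: "submodule ?V R ?K" and XYK: "submodule (X <+>\<^bsub>M\<^esub> Y) R ?K" and XK: "submodule X R ?K"
    and YK: "submodule Y R ?K"
    using M.Int_submodule[OF Kss W] XYs Xs Ys sub K(2) by (auto simp: M.submodule_submod_iff[OF Kss])
  have seteq: "A <+>\<^bsub>?K\<^esub> B = A <+>\<^bsub>M\<^esub> B" for A B by (simp add: set_add_image)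
  note sums = K.set_add_submodule[OF YK V, unfolded seteq] K.set_add_submodule[OF XYK V, unfolded seteq]
  have qfg: "fg_submodule (?q ` H) R ?Q" if "fg_submodule H R M" for H
    using M Q M.coset_rep_hom[OF W] that by (rule fg_submodule_image)
  have "rk X ?K + rk (Y <+>\<^bsub>M\<^esub> ?V) ?K \<le> rk ((X <+>\<^bsub>M\<^esub> Y) \<inter> ?V) ?K + rk (X <+>\<^bsub>M\<^esub> Y <+>\<^bsub>M\<^esub> ?V) ?K"
    using X(2) sub K(2) by (intro add_mono rk_mono KM(1) XK K.Int_submodule XYK V sums set_add_mono) auto
  also have "\<dots> \<le> rk (X <+>\<^bsub>M\<^esub> Y) ?K + rk ?V ?K"
    using rk_submodular[OF KM(1) _ XYK V] KM(2) by (simp add: seteq add.commute)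
  finally have "rk ?V ?K + (rk X ?K + rk (?q ` Y) (submod ?Q (?q ` K))) \<le> rk ?V ?K + rk (X <+>\<^bsub>M\<^esub> Y) ?K"
    using rk_quotient_image[OF M W K(1) Ys] sub K(2) by (simp add: add_ac)
  moreover have "rk ?V ?K < top_class.top" using rk_fg_finite[OF KM(1) _ V] KM(2) by simp
  ultimately have le: "rk X ?K + rk (?q ` Y) (submod ?Q (?q ` K)) \<le> rk (X <+>\<^bsub>M\<^esub> Y) ?K"
    by (auto simp: ennreal_add_left_cancel_le)
  have "rk X M + rk (?q ` Y) ?Q \<le> rk X ?K + rk (?q ` Y) (submod ?Q (?q ` K))"
    using sub K(2) by (intro add_mono rk_antimono M Q X(1) K(1) qfg Y image_mono) auto
  also note le
  also note K(3)
  finally show "rk X M + rk (?q ` Y) ?Q \<le> rk (X <+>\<^bsub>M\<^esub> Y) M + ennreal e" .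
qed

text \<open>
  The difference of the ranks of \<open>Z\<close> and \<open>Y\<close> in \<open>K\<close> is the rank of \<open>Z/Y\<close> relative to \<open>K/Y\<close>,
  which decreases when \<open>K\<close> grows.
\<close>

lemma rk_relative_antimono:
  assumes M: "left_module R M" and Y: "fg_submodule Y R M" and Z: "fg_submodule Z R M"
    and K: "fg_submodule K R M" and YZ: "Y \<subseteq> Z" and ZK: "Z \<subseteq> K" and e: "e > 0"
  shows "rk Z M + rk Y (submod M K) \<le> rk Y M + rk Z (submod M K) + ennreal e"
proof -
  interpret M: lmodule R M using M by (rule lmodule.intro)
  note Ys = M.fg_submodule_submodule[OF Y] and Zs = M.fg_submodule_submodule[OF Z]
  let ?q = "coset_rep M Y" and ?Q = "quotient_module M Y"
  have Q: "left_module R ?Q" using Ys by (rule M.quotient_left_module)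
  have qfg: "fg_submodule (?q ` H) R ?Q" if "fg_submodule H R M" for H
    using M Q M.coset_rep_hom[OF Ys] that by (rule fg_submodule_image)
  obtain K' where K': "fg_submodule K' R M" "Y \<subseteq> K'" "K \<subseteq> K'"
    "rk Y (submod M K') \<le> rk Y M + ennreal e" using rk_approx[OF M Y K e] by auto
  have ZY: "Z <+>\<^bsub>M\<^esub> Y = Z" using Zs Ys YZ by (rule M.set_add_absorb)
  have rel: "rk (?q ` Z) (submod ?Q (?q ` H)) + rk Y (submod M H) = rk Z (submod M H)"
    if "fg_submodule H R M" "K \<subseteq> H" for H
    using rk_quotient_image[OF M Ys that(1) Zs] that(2) ZK YZ
    by (simp add: Int_absorb1[OF order_trans[OF YZ order_trans[OF ZK that(2)]]] ZY order_trans)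
  have "rk Z M + rk Y (submod M K) \<le> rk Z (submod M K') + rk Y (submod M K)"
    using ZK K' by (intro add_right_mono rk_antimono M Z) auto
  also have "\<dots> = rk (?q ` Z) (submod ?Q (?q ` K')) + rk Y (submod M K') + rk Y (submod M K)"
    using rel[OF K'(1,3)] by simp
  also have "\<dots> \<le> rk (?q ` Z) (submod ?Q (?q ` K)) + (rk Y M + ennreal e) + rk Y (submod M K)"
    using ZK K' by (intro add_mono order_refl rk_antimono_submod Q qfg Z K image_mono) auto
  also have "\<dots> = rk Y M + (rk (?q ` Z) (submod ?Q (?q ` K)) + rk Y (submod M K)) + ennreal e"
    by (simp add: add_ac)
  finally show ?thesis using rel[OF K order_refl] by simp
qed

text \<open>
  The rank of the image of \<open>X\<close> is nearly attained in the image of a finitely generated \<open>K\<close>. There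
  it is the difference of the ranks of \<open>X + (K \<inter> W)\<close> and of \<open>K \<inter> W\<close>, and \<open>K \<inter> W\<close> is
  approximated by a finitely generated \<open>Y\<close>. The difference of the ranks of \<open>X + Y\<close> and \<open>Y\<close> only
  decreases when \<open>K\<close> grows to \<open>M\<close>.
\<close>

lemma rk_upper:
  assumes M: "left_module R M" and W: "submodule W R M" and X: "fg_submodule X R M" and e: "e > 0"
  shows "\<exists>Y. fg_submodule Y R M \<and> Y \<subseteq> W \<and>
    rk (X <+>\<^bsub>M\<^esub> Y) M \<le> rk Y M + rk (coset_rep M W ` X) (quotient_module M W) + ennreal e"
proof -
  interpret M: lmodule R M using M by (rule lmodule.intro)
  let ?q = "coset_rep M W" and ?Q = "quotient_module M W"
  have Q: "left_module R ?Q" using W by (rule M.quotient_left_module)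
  interpret Q: lmodule R ?Q using Q by (rule lmodule.intro)
  have qfg: "fg_submodule (?q ` H) R ?Q" if "fg_submodule H R M" for H
    using M Q M.coset_rep_hom[OF W] that by (rule fg_submodule_image)
  note Xs = M.fg_submodule_submodule[OF X]
  have e3: "e / 3 > 0" using e by simp
  obtain L where L: "fg_submodule L R ?Q" "?q ` X \<subseteq> L"
    "rk (?q ` X) (submod ?Q L) \<le> rk (?q ` X) ?Q + ennreal (e/3)"
    using rk_approx[OF Q qfg[OF X] qfg[OF X] e3] by auto
  obtain K0 where K0: "fg_submodule K0 R M" "?q ` K0 = L" using W L(1) by (rule M.fg_quotient_lift)
  let ?K = "K0 <+>\<^bsub>M\<^esub> X"
  have K: "fg_submodule ?K R M" using K0(1) X by (rule M.fg_set_add)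
  note Ks = M.fg_submodule_submodule[OF K] and K0s = M.fg_submodule_submodule[OF K0(1)]
  have sub: "K0 \<subseteq> ?K" "X \<subseteq> ?K"
    using M.submoduleD[OF K0s] M.submoduleD[OF Xs] by (intro M.M.subset_set_add; simp)+
  have qK: "?q ` ?K = L"
  proof
    show "L \<subseteq> ?q ` ?K" using K0(2) sub(1) by blast
    show "?q ` ?K \<subseteq> L"
    proof
      fix z assume "z \<in> ?q ` ?K"
      then obtain k x where kx: "k \<in> K0" "x \<in> X" "z = ?q (k \<oplus>\<^bsub>M\<^esub> x)" by (auto simp: set_add_iff)
      then have "k \<in> carrier M" "x \<in> carrier M" using M.submoduleD(1)[OF K0s] M.submoduleD(1)[OF Xs] by auto
      then have "z = ?q k \<oplus>\<^bsub>?Q\<^esub> ?q x" using kx by (simp add: M.quotient_simps(3)[OF W])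
      moreover have "?q k \<in> L" "?q x \<in> L" using kx K0(2) L(2) by auto
      ultimately show "z \<in> L" using Q.submoduleD(3)[OF Q.fg_submodule_submodule[OF L(1)]] by simp
    qed
  qed
  let ?V = "?K \<inter> W"
  note KM = fg_carrier_submod[OF M K]
  interpret K: lmodule R "submod M ?K" using KM(1) by (rule lmodule.intro)
  have V: "submodule ?V R (submod M ?K)"
    using M.Int_submodule[OF Ks W] by (simp add: M.submodule_submod_iff[OF Ks])
  have Vfin: "rk ?V (submod M ?K) \<noteq> \<infinity>" using rk_fg_finite[OF KM(1) _ V] KM(2) by simp
  have "{\<zero>\<^bsub>M\<^esub>} \<subseteq> ?V" using K.submoduleD(2)[OF V] by simp
  then have ne: "{H'. fg_submodule H' R (submod M ?K) \<and> H' \<subseteq> ?V} \<noteq> {}" using K.fg_zero by auto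
  obtain Y where Y: "fg_submodule Y R (submod M ?K)" "Y \<subseteq> ?V"
    "rk ?V (submod M ?K) < rk Y (submod M ?K) + ennreal (e/3)"
    using SUP_approx_ennreal[OF e3 ne rk_sup[OF KM(1) V] Vfin] by auto
  then have fgY: "fg_submodule Y R M" by (simp add: M.fg_submodule_submod_iff[OF Ks])
  note Ys = M.fg_submodule_submodule[OF fgY]
  let ?Z = "X <+>\<^bsub>M\<^esub> Y"
  have Z: "fg_submodule ?Z R M" using X fgY by (rule M.fg_set_add)
  have YZ: "Y \<subseteq> ?Z" using M.submoduleD[OF Xs] M.submoduleD[OF Ys] by (intro M.M.subset_set_add; simp)
  have ZK: "?Z \<subseteq> ?K"
    using sub(2) Y(2) M.submoduleD(3)[OF Ks] by (auto simp: set_add_iff subset_iff)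
  have seteq: "A <+>\<^bsub>submod M ?K\<^esub> B = A <+>\<^bsub>M\<^esub> B" for A B by (simp add: set_add_image)
  have XK: "submodule X R (submod M ?K)" and ZsK: "submodule ?Z R (submod M ?K)"
    using Xs M.fg_submodule_submodule[OF Z] sub(2) ZK by (simp_all add: M.submodule_submod_iff[OF Ks])
  have "rk ?Z (submod M ?K) \<le> rk (X <+>\<^bsub>M\<^esub> ?V) (submod M ?K)"
    using K.set_add_submodule[OF XK V] Y(2) by (intro rk_mono KM(1) ZsK set_add_mono) (auto simp: seteq)
  also have "\<dots> = rk (?q ` X) (submod ?Q L) + rk ?V (submod M ?K)"
    using rk_quotient_image[OF M W K Xs sub(2)] qK by simp
  also have "\<dots> \<le> (rk (?q ` X) ?Q + ennreal (e/3)) + (rk Y (submod M ?K) + ennreal (e/3))"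
    using L(3) Y(3) by (intro add_mono) auto
  finally have le: "rk ?Z (submod M ?K)
      \<le> (rk (?q ` X) ?Q + ennreal (e/3)) + (rk Y (submod M ?K) + ennreal (e/3))" .
  have "rk ?Z M + rk Y (submod M ?K) \<le> rk Y M + rk ?Z (submod M ?K) + ennreal (e/3)"
    using M fgY Z K YZ ZK e3 by (rule rk_relative_antimono)
  also have "\<dots> \<le> rk Y M + ((rk (?q ` X) ?Q + ennreal (e/3)) + (rk Y (submod M ?K) + ennreal (e/3)))
      + ennreal (e/3)"
    using le by (intro add_mono order_refl)
  also have "\<dots> = rk Y M + rk (?q ` X) ?Q + (ennreal (e/3) + ennreal (e/3) + ennreal (e/3))
      + rk Y (submod M ?K)"
    by (simp add: add_ac)
  also have "ennreal (e/3) + ennreal (e/3) + ennreal (e/3) = ennreal e"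
    using e by (simp flip: ennreal_plus)
  finally have "rk Y (submod M ?K) + rk ?Z M
      \<le> rk Y (submod M ?K) + (rk Y M + rk (?q ` X) ?Q + ennreal e)" by (simp add: add_ac)
  moreover have "rk Y (submod M ?K) < top_class.top"
    using rk_fg_finite[OF KM(1) _ K.fg_submodule_submodule[OF Y(1)]] KM(2) by simp
  ultimately have "rk ?Z M \<le> rk Y M + rk (?q ` X) ?Q + ennreal e"
    by (auto simp: ennreal_add_left_cancel_le)
  then show ?thesis using fgY Y(2) by blast
qed

theorem mean_rank_add:
  assumes amen: "amenable G" and G: "group G" and M: "left_module (group_ring R G) M"
    and V: "submodule V (group_ring R G) M" and W: "submodule W (group_ring R G) M" "W \<subseteq> V"
  shows "mean_rank R G rk V M = mean_rank R G rk W M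
    + mean_rank R G rk (coset_rep M W ` V) (quotient_module M W)"
proof -
  interpret group_ring_module R G M
    using G M by (intro group_ring_module.intro lmodule.intro ring_axioms)
  interpret Q: group_ring_module R G "quotient_module M W" using W(1) by (rule quotient_group_ring_module)
  note Mr = restrict_scalars_left_module and WR = restrict_scalars_submodule[OF W(1)]
  have Qr: "Q.Mr = quotient_module Mr W" by (rule restrict_scalars_quotient)
  let ?\<rho> = "\<lambda>H. rk H Mr" and ?\<sigma> = "\<lambda>H. rk H (quotient_module Mr W)"
  have "mean_value R G ?\<rho> V M
      = mean_value R G ?\<rho> W M + mean_value R G ?\<sigma> (coset_rep M W ` V) (quotient_module M W)"
  proof (rule mean_value_add[OF amen V W])
    show "submodule_rank R Mr ?\<rho>" using Mr by (rule rk_submodule_rank)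
    show "submodule_rank R (quotient_module Mr W) ?\<sigma>"
      by (intro rk_submodule_rank Mr.quotient_left_module WR)
    show "?\<rho> (tr s ` H) = ?\<rho> H" if "s \<in> carrier G" "fg_submodule H R Mr" for s H
      using Mr Mr Mr.fg_submodule_submodule[OF that(2)] translate_iso[OF that(1)] by (rule rk_iso)
    show "?\<sigma> (Q.tr s ` H) = ?\<sigma> H" if "s \<in> carrier G" "fg_submodule H R (quotient_module Mr W)" for s H
      using Q.restrict_scalars_left_module Q.restrict_scalars_left_module
        Q.Mr.fg_submodule_submodule[OF that(2)[folded Qr]] Q.translate_iso[OF that(1)]
      unfolding Qr by (rule rk_iso)
    show "?\<rho> X + ?\<sigma> (coset_rep M W ` Y) \<le> ?\<rho> (X <+>\<^bsub>M\<^esub> Y)"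
      if "fg_submodule X R Mr" "fg_submodule Y R Mr" "X \<subseteq> W" for X Y
      using rk_lower[OF Mr WR that(1,3,2)] by simp
    show "\<exists>Y. fg_submodule Y R Mr \<and> Y \<subseteq> W \<and>
        ?\<rho> (X <+>\<^bsub>M\<^esub> Y) \<le> ?\<rho> Y + ?\<sigma> (coset_rep M W ` X) + ennreal e"
      if "fg_submodule X R Mr" "e > 0" for X and e :: real
      using rk_upper[OF Mr WR that] by simp
  qed
  then show ?thesis by (simp add: mean_value_def mean_rank_def restrict_scalars_quotient)
qed

end

theorem corollary1p3:
  fixes R :: "('r, 'a) ring_scheme" and \<Gamma> :: "('g, 'b) monoid_scheme"
  assumes "ring R" and "group \<Gamma>" and "amenable \<Gamma>"
  shows
    "(\<forall>(M2 :: ('g \<Rightarrow> int, 'm) module) M1.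
        left_module (group_ring int_ring \<Gamma>) M2 \<longrightarrow>
        submodule M1 (group_ring int_ring \<Gamma>) M2 \<longrightarrow>
        algebraic_entropy \<Gamma> M2 =
          algebraic_entropy \<Gamma> (submod M2 M1) + algebraic_entropy \<Gamma> (quotient_module M2 M1))
     \<and>
     (\<forall>(L :: ('r, 'v) module \<Rightarrow> ennreal) N2 N1.
        length_function R L \<longrightarrow>
        left_module (group_ring R \<Gamma>) N2 \<longrightarrow>
        submodule N1 (group_ring R \<Gamma>) N2 \<longrightarrow>
        locally_length_finite R L (restrict_scalars R \<Gamma> N2) \<longrightarrow>
        locally_length_finite R L (restrict_scalars R \<Gamma> (submod N2 N1)) \<longrightarrow>
        mean_length R \<Gamma> L N2 =
          mean_length R \<Gamma> L (submod N2 N1) + mean_length R \<Gamma> L (quotient_module N2 N1))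
     \<and>
     (\<forall>(rk :: 'u set \<Rightarrow> ('r, 'u) module \<Rightarrow> ennreal) M3 M2 M1.
        infinite (UNIV :: 'u set) \<longrightarrow>
        (\<exists>\<iota> :: 'r \<Rightarrow> 'u. inj_on \<iota> (carrier R)) \<longrightarrow>
        bivariant_sylvester_rank R rk \<longrightarrow>
        left_module (group_ring R \<Gamma>) M3 \<longrightarrow>
        submodule M2 (group_ring R \<Gamma>) M3 \<longrightarrow>
        submodule M1 (group_ring R \<Gamma>) M3 \<longrightarrow>
        M1 \<subseteq> M2 \<longrightarrow>
        mean_rank R \<Gamma> rk M2 M3 =
          mean_rank R \<Gamma> rk M1 M3 +
          mean_rank R \<Gamma> rk (carrier (quotient_module (submod M3 M2) M1)) (quotient_module M3 M1))"
proof (intro conjI allI impI)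
  fix M2 :: "('g \<Rightarrow> int, 'm) module" and M1
  assume "left_module (group_ring int_ring \<Gamma>) M2" "submodule M1 (group_ring int_ring \<Gamma>) M2"
  then show "algebraic_entropy \<Gamma> M2 =
      algebraic_entropy \<Gamma> (submod M2 M1) + algebraic_entropy \<Gamma> (quotient_module M2 M1)"
    by (rule algebraic_entropy_add[OF assms(3,2)])
next
  fix L :: "('r, 'v) module \<Rightarrow> ennreal" and N2 :: "('g \<Rightarrow> 'r, 'v) module" and N1
  assume L: "length_function R L" and N: "left_module (group_ring R \<Gamma>) N2"
    "submodule N1 (group_ring R \<Gamma>) N2" "locally_length_finite R L (restrict_scalars R \<Gamma> N2)"
  show "mean_length R \<Gamma> L N2 =
      mean_length R \<Gamma> L (submod N2 N1) + mean_length R \<Gamma> L (quotient_module N2 N1)"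
    using L assms(3,2) N by (rule length_function.mean_length_add)
next
  fix rk :: "'u set \<Rightarrow> ('r, 'u) module \<Rightarrow> ennreal" and M3 :: "('g \<Rightarrow> 'r, 'u) module" and M2 M1
  assume rk: "infinite (UNIV :: 'u set)" "\<exists>\<iota> :: 'r \<Rightarrow> 'u. inj_on \<iota> (carrier R)"
      "bivariant_sylvester_rank R rk"
    and M: "left_module (group_ring R \<Gamma>) M3" "submodule M2 (group_ring R \<Gamma>) M3"
      "submodule M1 (group_ring R \<Gamma>) M3" "M1 \<subseteq> M2"
  have "universal_rank R rk"
    using rk by (intro universal_rank.intro universal_rank_axioms.intro)
  from universal_rank.mean_rank_add[OF this assms(3,2) M]
  show "mean_rank R \<Gamma> rk M2 M3 = mean_rank R \<Gamma> rk M1 M3 +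
      mean_rank R \<Gamma> rk (carrier (quotient_module (submod M3 M2) M1)) (quotient_module M3 M1)"
    by (simp add: quotient_submod)
qed

end
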